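(* Let $E$ be a finite directed graph which is transitive and in which every cycle has an exit. Let $u$ be a unitary in $\mathfrak{B}$ such that $u\mathcal{D}_E^1u^*\neq\mathcal{D}_E^1$. Then there is no non-zero element $x\in C^*(E)$ satisfying $x\lambda_u(\mathcal{D}_E)=\mathcal{D}_E x$ (equality of subsets of $C^*(E)$). In particular, there is no unitary $w\in C^*(E)$ such that $w\mathcal{D}_E w^*=\lambda_u(\mathcal{D}_E)$.
   Context: A finite directed graph $E=(E^0,E^1,r,s)$ consists of finite sets $E^0$ (vertices) and $E^1$ (edges) and range and source maps $r,s:E^1\to E^0$; multiple edges and loops are allowed. A path of length $k\ge 1$ is a sequence $\mu=(\mu_1,\dots,\mu_k)$ of edges with $r(\mu_j)=s(\mu_{j+1})$ for $1\le j\le k-1$; set $s(\mu)=s(\mu_1)$, $r(\mu)=r(\mu_k)$. Vertices are paths of length $0$. $E^k$ is the set of paths of length $k$ and $E^*$ is the set of all finite paths (including length $0$). A cycle is a path $\mu$ of length at least $1$ with $s(\mu)=r(\mu)$; it has an exit if for some $j$ the vertex $s(\mu_j)$ emits at least two distinct edges. $E$ is transitive if for any two vertices $v,w$ there is a path of non-zero length from $v$ to $w$. $C^*(E)$ is the universal $C^*$-algebra generated by mutually orthogonal projections $P_v$, $v\in E^0$, and partial isometries $S_e$, $e\in E^1$, subject to $S_e^*S_e=P_{r(e)}$ for all $e\in E^1$, and $P_v=\sum_{s(e)=v}S_eS_e^*$ for every $v\in E^0$ that emits at least one edge. For a path $\mu=(\mu_1,\dots,\mu_k)$ put $S_\mu=S_{\mu_1}\cdots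 S_{\mu_k}$, and $S_v=P_v$ for $v\in E^0$; put $P_\mu=S_\mu S_\mu^*$. $\mathcal{D}_E$ is the (abelian) $C^*$-subalgebra of $C^*(E)$ generated by all $P_\mu$, $\mu\in E^*$, and $\mathcal{D}_E^k=\mathrm{span}\{P_\mu:\mu\in E^k\}$ for $k\ge 0$. $\mathcal{F}_E^1$ is the linear span of $\{S_eS_f^*: e,f\in E^1\}$ (note $S_eS_f^*\ne 0$ iff $r(e)=r(f)$). $\mathfrak{B}:=(\mathcal{D}_E^0)'\cap\mathcal{F}_E^1$ is the set of elements of $\mathcal{F}_E^1$ commuting with all $P_v$, $v\in E^0$; equivalently, the linear span of the elements $S_eS_f^*$ with $e,f\in E^1$ and $s(e)=s(f)$. For a unitary $u\in\mathfrak{B}$, $\lambda_u$ denotes the unique unital $*$-homomorphism $C^*(E)\to C^*(E)$ with $\lambda_u(S_e)=uS_e$ for $e\in E^1$ and $\lambda_u(P_v)=P_v$ for $v\in E^0$; it is an automorphism with inverse $\lambda_{u^*}$. *)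

theory Defs
  imports
    "HOL-Analysis.Analysis"
    "HOL-Algebra.Ring"
    "Graph_Theory.Arc_Walk"
begin

section \<open>C*-algebras\<close>

text \<open>
  Complex C*-algebras as types. No unit is built in: the C*-algebra of a finite graph is unital,
  with unit the sum of the vertex projections, and it is zero for the graph without vertices,
  which \<^class>\<open>real_normed_algebra_1\<close> would not allow.
\<close>

class cstar_algebra = real_normed_algebra + banach +
  fixes scaleC :: "complex \<Rightarrow> 'a \<Rightarrow> 'a"
    and star :: "'a \<Rightarrow> 'a"
  assumes scaleC_add_right: "scaleC a (x + y) = scaleC a x + scaleC a y"
    and scaleC_add_left: "scaleC (a + b) x = scaleC a x + scaleC b x"
    and scaleC_scaleC: "scaleC a (scaleC b x) = scaleC (a * b) x"
    and scaleC_of_real: "scaleC (complex_of_real t) x = t *\<^sub>R x"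
    and mult_scaleC_left: "scaleC a x * y = scaleC a (x * y)"
    and mult_scaleC_right: "x * scaleC a y = scaleC a (x * y)"
    and norm_scaleC: "norm (scaleC a x) = cmod a * norm x"
    and star_add: "star (x + y) = star x + star y"
    and star_scaleC: "star (scaleC a x) = scaleC (cnj a) (star x)"
    and star_mult: "star (x * y) = star y * star x"
    and star_star: "star (star x) = x"
    and cstar_identity: "norm (star x * x) = (norm x)\<^sup>2"

global_interpretation complex_vs: vector_space "scaleC :: complex \<Rightarrow> 'a \<Rightarrow> 'a::cstar_algebra"
  defines cspan = complex_vs.span
proof
  fix x :: 'a
  show "scaleC 1 x = x"
    using scaleC_of_real[of 1 x] by simp
qed (simp_all add: scaleC_add_right scaleC_add_left scaleC_scaleC)

definition is_identity :: "'a::cstar_algebra \<Rightarrow> bool" where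
  "is_identity p \<longleftrightarrow> (\<forall>x. p * x = x \<and> x * p = x)"

definition unitary :: "'a::cstar_algebra \<Rightarrow> bool" where
  "unitary u \<longleftrightarrow> is_identity (star u * u) \<and> is_identity (u * star u)"

definition cstar_subalgebra :: "'a::cstar_algebra set \<Rightarrow> bool" where
  "cstar_subalgebra B \<longleftrightarrow> closed B \<and> 0 \<in> B \<and>
     (\<forall>x\<in>B. \<forall>y\<in>B. x + y \<in> B \<and> x * y \<in> B) \<and>
     (\<forall>a. \<forall>x\<in>B. scaleC a x \<in> B) \<and> (\<forall>x\<in>B. star x \<in> B)"

text \<open>
  Complex C*-algebras with an explicit carrier, needed because a universal property quantifies
  over algebras. The field \<^const>\<open>one\<close> inherited from the ring record is never used.
\<close>

record 'b cstar = "'b ring" +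
  scale :: "complex \<Rightarrow> 'b \<Rightarrow> 'b"
  adj :: "'b \<Rightarrow> 'b"
  nrm :: "'b \<Rightarrow> real"

locale cstar_on = abelian_group B for B :: "('b, 'm) cstar_scheme" (structure) +
  assumes m_closed: "\<lbrakk>x \<in> carrier B; y \<in> carrier B\<rbrakk> \<Longrightarrow> x \<otimes> y \<in> carrier B"
    and m_assoc: "\<lbrakk>x \<in> carrier B; y \<in> carrier B; z \<in> carrier B\<rbrakk> \<Longrightarrow>
          (x \<otimes> y) \<otimes> z = x \<otimes> (y \<otimes> z)"
    and l_distr: "\<lbrakk>x \<in> carrier B; y \<in> carrier B; z \<in> carrier B\<rbrakk> \<Longrightarrow>
          (x \<oplus> y) \<otimes> z = x \<otimes> z \<oplus> y \<otimes> z"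
    and r_distr: "\<lbrakk>x \<in> carrier B; y \<in> carrier B; z \<in> carrier B\<rbrakk> \<Longrightarrow>
          z \<otimes> (x \<oplus> y) = z \<otimes> x \<oplus> z \<otimes> y"
    and scale_closed: "x \<in> carrier B \<Longrightarrow> scale B a x \<in> carrier B"
    and scale_add_right: "\<lbrakk>x \<in> carrier B; y \<in> carrier B\<rbrakk> \<Longrightarrow>
          scale B a (x \<oplus> y) = scale B a x \<oplus> scale B a y"
    and scale_add_left: "x \<in> carrier B \<Longrightarrow> scale B (a + b) x = scale B a x \<oplus> scale B b x"
    and scale_scale: "x \<in> carrier B \<Longrightarrow> scale B a (scale B b x) = scale B (a * b) x"
    and scale_one: "x \<in> carrier B \<Longrightarrow> scale B 1 x = x"
    and scale_mult_left: "\<lbrakk>x \<in> carrier B; y \<in> carrier B\<rbrakk> \<Longrightarrow>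
          scale B a x \<otimes> y = scale B a (x \<otimes> y)"
    and scale_mult_right: "\<lbrakk>x \<in> carrier B; y \<in> carrier B\<rbrakk> \<Longrightarrow>
          x \<otimes> scale B a y = scale B a (x \<otimes> y)"
    and adj_closed: "x \<in> carrier B \<Longrightarrow> adj B x \<in> carrier B"
    and adj_add: "\<lbrakk>x \<in> carrier B; y \<in> carrier B\<rbrakk> \<Longrightarrow> adj B (x \<oplus> y) = adj B x \<oplus> adj B y"
    and adj_scale: "x \<in> carrier B \<Longrightarrow> adj B (scale B a x) = scale B (cnj a) (adj B x)"
    and adj_mult: "\<lbrakk>x \<in> carrier B; y \<in> carrier B\<rbrakk> \<Longrightarrow> adj B (x \<otimes> y) = adj B y \<otimes> adj B x"
    and adj_adj: "x \<in> carrier B \<Longrightarrow> adj B (adj B x) = x"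
    and nrm_nonneg: "x \<in> carrier B \<Longrightarrow> 0 \<le> nrm B x"
    and nrm_eq_0_iff: "x \<in> carrier B \<Longrightarrow> nrm B x = 0 \<longleftrightarrow> x = \<zero>"
    and nrm_scale: "x \<in> carrier B \<Longrightarrow> nrm B (scale B a x) = cmod a * nrm B x"
    and nrm_triangle: "\<lbrakk>x \<in> carrier B; y \<in> carrier B\<rbrakk> \<Longrightarrow> nrm B (x \<oplus> y) \<le> nrm B x + nrm B y"
    and nrm_mult: "\<lbrakk>x \<in> carrier B; y \<in> carrier B\<rbrakk> \<Longrightarrow> nrm B (x \<otimes> y) \<le> nrm B x * nrm B y"
    and nrm_cstar: "x \<in> carrier B \<Longrightarrow> nrm B (adj B x \<otimes> x) = (nrm B x)\<^sup>2"
    and nrm_complete: "Metric_space.mcomplete (carrier B) (\<lambda>x y. nrm B (x \<ominus> y))"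

definition type_cstar :: "'a::cstar_algebra cstar" where
  "type_cstar = \<lparr>carrier = UNIV, mult = (*), one = undefined, zero = 0, add = (+),
     scale = scaleC, adj = star, nrm = norm\<rparr>"

lemma type_cstar_simps [simp]:
  "carrier (type_cstar :: 'a::cstar_algebra cstar) = UNIV"
  "mult (type_cstar :: 'a cstar) = (*)"
  "zero (type_cstar :: 'a cstar) = 0"
  "add (type_cstar :: 'a cstar) = (+)"
  "scale (type_cstar :: 'a cstar) = scaleC"
  "adj (type_cstar :: 'a cstar) = star"
  "nrm (type_cstar :: 'a cstar) = norm"
  by (simp_all add: type_cstar_def)

lemma abelian_group_type_cstar: "abelian_group (type_cstar :: 'a::cstar_algebra cstar)"
proof (rule abelian_groupI)
  fix x :: 'a
  show "\<exists>y\<in>carrier type_cstar. y \<oplus>\<^bsub>type_cstar\<^esub> x = \<zero>\<^bsub>type_cstar\<^esub>"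
    by (auto intro: exI[of _ "- x"])
qed (simp_all add: algebra_simps)

lemma a_minus_type_cstar: "x \<ominus>\<^bsub>type_cstar\<^esub> y = x - (y :: 'a::cstar_algebra)"
proof -
  interpret abelian_group "type_cstar :: 'a cstar" by (rule abelian_group_type_cstar)
  have "\<ominus>\<^bsub>type_cstar\<^esub> y = - y"
    using minus_equality[of "- y" y] by simp
  then show ?thesis by (simp add: a_minus_def)
qed

lemma finsum_type_cstar:
  "finite I \<Longrightarrow> finsum type_cstar f I = (\<Sum>i\<in>I. (f i :: 'a::cstar_algebra))"
proof (induction rule: finite_induct)
  case empty
  interpret abelian_group "type_cstar :: 'a cstar" by (rule abelian_group_type_cstar)
  show ?case by simp
next
  case (insert i I)
  interpret abelian_group "type_cstar :: 'a cstar" by (rule abelian_group_type_cstar)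
  show ?case using insert by simp
qed

lemma cstar_on_type_cstar: "cstar_on (type_cstar :: 'a::cstar_algebra cstar)"
proof -
  interpret abelian_group "type_cstar :: 'a cstar" by (rule abelian_group_type_cstar)
  have "(\<lambda>x y :: 'a. norm (x - y)) = dist"
    by (simp add: dist_norm fun_eq_iff)
  moreover have "Met_TC.mcomplete TYPE('a)"
    using complete_UNIV by (simp add: mcomplete_iff_complete)
  ultimately show ?thesis
    by unfold_locales
      (simp_all add: algebra_simps scaleC_add_right scaleC_add_left scaleC_scaleC
        mult_scaleC_left mult_scaleC_right norm_scaleC star_add star_scaleC star_mult star_star
        cstar_identity norm_triangle_ineq norm_mult_ineq a_minus_type_cstar)
qed

definition star_hom :: "('a, 'm) cstar_scheme \<Rightarrow> ('b, 'n) cstar_scheme \<Rightarrow> ('a \<Rightarrow> 'b) \<Rightarrow> bool" where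
  "star_hom A B \<phi> \<longleftrightarrow>
     \<phi> \<in> carrier A \<rightarrow> carrier B \<and>
     (\<forall>x\<in>carrier A. \<forall>y\<in>carrier A.
        \<phi> (x \<oplus>\<^bsub>A\<^esub> y) = \<phi> x \<oplus>\<^bsub>B\<^esub> \<phi> y \<and> \<phi> (x \<otimes>\<^bsub>A\<^esub> y) = \<phi> x \<otimes>\<^bsub>B\<^esub> \<phi> y) \<and>
     (\<forall>a. \<forall>x\<in>carrier A. \<phi> (scale A a x) = scale B a (\<phi> x)) \<and>
     (\<forall>x\<in>carrier A. \<phi> (adj A x) = adj B (\<phi> x))"


section \<open>Directed graphs\<close>

text \<open>
  Directed multigraphs are those of the library, with \<^const>\<open>tail\<close> the source and \<^const>\<open>head\<close>
  the range map. A path from \<open>v\<close> to \<open>w\<close> is an \<^const>\<open>pre_digraph.awalk\<close>, whose edge list is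
  empty exactly for the path \<open>v\<close> of length zero.
\<close>

definition transitive_graph :: "('v, 'e) pre_digraph \<Rightarrow> bool" where
  "transitive_graph E \<longleftrightarrow>
     (\<forall>v\<in>verts E. \<forall>w\<in>verts E. \<exists>p. p \<noteq> [] \<and> pre_digraph.awalk E v p w)"

text \<open>Vertices may repeat along a cycle, unlike in \<^const>\<open>pre_digraph.cycle\<close>.\<close>

definition every_cycle_has_exit :: "('v, 'e) pre_digraph \<Rightarrow> bool" where
  "every_cycle_has_exit E \<longleftrightarrow>
     (\<forall>v p. p \<noteq> [] \<and> pre_digraph.awalk E v p v \<longrightarrow>
        (\<exists>e\<in>set p. \<exists>f\<in>arcs E. \<exists>g\<in>arcs E. f \<noteq> g \<and> tail E f = tail E e \<and> tail E g = tail E e))"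

text \<open>A path is represented by its source together with its list of edges.\<close>

definition paths_of_length :: "('v, 'e) pre_digraph \<Rightarrow> nat \<Rightarrow> ('v \<times> 'e list) set" where
  "paths_of_length E k = {(v, p). (\<exists>w. pre_digraph.awalk E v p w) \<and> length p = k}"

definition paths :: "('v, 'e) pre_digraph \<Rightarrow> ('v \<times> 'e list) set" where
  "paths E = (\<Union>k. paths_of_length E k)"


section \<open>The C*-algebra of a finite graph\<close>

definition ck_family ::
    "('v, 'e) pre_digraph \<Rightarrow> ('b, 'm) cstar_scheme \<Rightarrow> ('v \<Rightarrow> 'b) \<Rightarrow> ('e \<Rightarrow> 'b) \<Rightarrow> bool" where
  "ck_family E B Q T \<longleftrightarrow>
     (\<forall>v\<in>verts E. Q v \<in> carrier B \<and> adj B (Q v) = Q v \<and> Q v \<otimes>\<^bsub>B\<^esub> Q v = Q v) \<and>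
     (\<forall>v\<in>verts E. \<forall>w\<in>verts E. v \<noteq> w \<longrightarrow> Q v \<otimes>\<^bsub>B\<^esub> Q w = \<zero>\<^bsub>B\<^esub>) \<and>
     (\<forall>e\<in>arcs E. T e \<in> carrier B \<and> T e \<otimes>\<^bsub>B\<^esub> adj B (T e) \<otimes>\<^bsub>B\<^esub> T e = T e) \<and>
     (\<forall>e\<in>arcs E. adj B (T e) \<otimes>\<^bsub>B\<^esub> T e = Q (head E e)) \<and>
     (\<forall>v\<in>verts E. (\<exists>e\<in>arcs E. tail E e = v) \<longrightarrow>
        Q v = (\<Oplus>\<^bsub>B\<^esub>e\<in>{e \<in> arcs E. tail E e = v}. T e \<otimes>\<^bsub>B\<^esub> adj B (T e)))"

lemma ck_family_type_cstar_iff: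
  fixes P :: "'v \<Rightarrow> 'a::cstar_algebra"
  assumes "finite (arcs E)"
  shows "ck_family E type_cstar P S \<longleftrightarrow>
     (\<forall>v\<in>verts E. star (P v) = P v \<and> P v * P v = P v) \<and>
     (\<forall>v\<in>verts E. \<forall>w\<in>verts E. v \<noteq> w \<longrightarrow> P v * P w = 0) \<and>
     (\<forall>e\<in>arcs E. S e * star (S e) * S e = S e) \<and>
     (\<forall>e\<in>arcs E. star (S e) * S e = P (head E e)) \<and>
     (\<forall>v\<in>verts E. (\<exists>e\<in>arcs E. tail E e = v) \<longrightarrow>
        P v = (\<Sum>e | e \<in> arcs E \<and> tail E e = v. S e * star (S e)))"
  using assms by (simp add: ck_family_def finsum_type_cstar)

text \<open>
  The type \<open>'a\<close> is the C*-algebra of \<open>E\<close> with canonical generators \<open>P\<close> and \<open>S\<close>: it is generated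
  by them, and every Cuntz--Krieger \<open>E\<close>-family in a C*-algebra \<open>B\<close> is the image of \<open>P\<close>, \<open>S\<close> under
  a *-homomorphism (unique, because \<open>P\<close> and \<open>S\<close> generate). HOL cannot quantify over all
  C*-algebras \<open>B\<close>, but it suffices to let the carrier range over the subsets of
  \<open>'a \<times> real\<close>: the algebra \<open>B\<close> may be replaced by its C*-subalgebra generated by the
  family, which is separable since \<open>E\<close> is finite, so has at most continuum many
  elements, and hence has an isomorphic copy with carrier inside this type.
\<close>

definition is_graph_cstar_algebra ::
    "('v, 'e) pre_digraph \<Rightarrow> ('v \<Rightarrow> 'a::cstar_algebra) \<Rightarrow> ('e \<Rightarrow> 'a) \<Rightarrow> bool" where
  "is_graph_cstar_algebra E P S \<longleftrightarrow>
     ck_family E type_cstar P S \<and>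
     cstar_subalgebra hull (P ` verts E \<union> S ` arcs E) = UNIV \<and>
     (\<forall>(B :: ('a \<times> real) cstar) Q T. cstar_on B \<and> ck_family E B Q T \<longrightarrow>
        (\<exists>\<pi>. star_hom type_cstar B \<pi> \<and>
             (\<forall>v\<in>verts E. \<pi> (P v) = Q v) \<and> (\<forall>e\<in>arcs E. \<pi> (S e) = T e)))"

fun path_elem :: "('v \<Rightarrow> 'a::cstar_algebra) \<Rightarrow> ('e \<Rightarrow> 'a) \<Rightarrow> 'v \<times> 'e list \<Rightarrow> 'a" where
  "path_elem P S (v, []) = P v"
| "path_elem P S (v, [e]) = S e"
| "path_elem P S (v, e # f # p) = S e * path_elem P S (v, f # p)"

definition path_proj :: "('v \<Rightarrow> 'a::cstar_algebra) \<Rightarrow> ('e \<Rightarrow> 'a) \<Rightarrow> 'v \<times> 'e list \<Rightarrow> 'a" where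
  "path_proj P S \<mu> = path_elem P S \<mu> * star (path_elem P S \<mu>)"

definition diag ::
    "('v, 'e) pre_digraph \<Rightarrow> ('v \<Rightarrow> 'a::cstar_algebra) \<Rightarrow> ('e \<Rightarrow> 'a) \<Rightarrow> 'a set" where
  "diag E P S = cstar_subalgebra hull (path_proj P S ` paths E)"

definition diag_level ::
    "('v, 'e) pre_digraph \<Rightarrow> ('v \<Rightarrow> 'a::cstar_algebra) \<Rightarrow> ('e \<Rightarrow> 'a) \<Rightarrow> nat \<Rightarrow> 'a set" where
  "diag_level E P S k = cspan (path_proj P S ` paths_of_length E k)"

definition core_level1 :: "('v, 'e) pre_digraph \<Rightarrow> ('e \<Rightarrow> 'a::cstar_algebra) \<Rightarrow> 'a set" where
  "core_level1 E S = cspan {S e * star (S f) | e f. e \<in> arcs E \<and> f \<in> arcs E}"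

definition frakB ::
    "('v, 'e) pre_digraph \<Rightarrow> ('v \<Rightarrow> 'a::cstar_algebra) \<Rightarrow> ('e \<Rightarrow> 'a) \<Rightarrow> 'a set" where
  "frakB E P S = {b \<in> core_level1 E S. \<forall>d\<in>diag_level E P S 0. b * d = d * b}"

definition quasi_free ::
    "('v, 'e) pre_digraph \<Rightarrow> ('v \<Rightarrow> 'a::cstar_algebra) \<Rightarrow> ('e \<Rightarrow> 'a) \<Rightarrow> 'a \<Rightarrow> 'a \<Rightarrow> 'a" where
  "quasi_free E P S u = (THE \<phi>. star_hom type_cstar type_cstar \<phi> \<and>
     (\<forall>p. is_identity p \<longrightarrow> \<phi> p = p) \<and>
     (\<forall>e\<in>arcs E. \<phi> (S e) = u * S e) \<and> (\<forall>v\<in>verts E. \<phi> (P v) = P v))"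

end

theory Submission
  imports Defs
begin

text \<open>
  Let \<open>\<phi>(a) = \<Sum>\<^sub>e S\<^sub>e a S\<^sub>e\<^sup>*\<close> be the canonical shift, so that \<open>S\<^sub>\<alpha> S\<^sub>\<beta>\<^sup>*\<close> intertwines \<open>\<phi>\<^sup>m\<close> with
  \<open>\<phi>\<^sup>m\<^sup>+\<^sup>n\<close>, \<open>n = |\<alpha>| - |\<beta>|\<close>, on the commutant of the vertex projections for large \<open>m\<close>.
  If \<open>u\<close> moves \<open>\<D>\<^sup>1\<close>, then some \<open>q = u P\<^sub>g u\<^sup>*\<close> has an off-diagonal entry
  \<open>P\<^sub>e q P\<^sub>f = c S\<^sub>e S\<^sub>f\<^sup>*\<close> with \<open>c \<noteq> 0\<close> and parallel edges \<open>e \<noteq> f\<close>, and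
  \<open>\<lambda>\<^sub>u(\<phi>\<^sup>m(P\<^sub>g)) = \<phi>\<^sup>m(q)\<close>. Hence an intertwiner satisfies \<open>x \<phi>\<^sup>m(q) = d\<^sub>m x\<close> with
  \<open>d\<^sub>m\<close> in the diagonal. The elements \<open>d\<^sub>m\<close> need not be bounded, but since they act on \<open>x\<close> as
  idempotents they can be replaced, up to a small error, by projections \<open>p\<^sub>m\<close> of the algebraic diagonal.

  Passing to approximate homogeneous components \<open>y\<close> of degree \<open>n\<close> by averaging over the gauge action gives
  \<open>(p\<^sub>m - \<phi>\<^sup>m\<^sup>+\<^sup>n(q)) y \<approx> 0\<close>. Sandwiching this between \<open>\<phi>\<^sup>m\<^sup>+\<^sup>n(P\<^sub>e)\<close> and \<open>\<phi>\<^sup>m\<^sup>+\<^sup>n(P\<^sub>f)\<close>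
  removes \<open>p\<^sub>m\<close>, so \<open>\<phi>\<^sup>m\<^sup>+\<^sup>n(P\<^sub>f) y \<approx> 0\<close> for all large \<open>m\<close>. By transitivity every vertex lies on a
  loop through \<open>f\<close>, and compressing with such loops yields \<open>y \<approx> 0\<close>. Thus all
  homogeneous components of \<open>x\<close> vanish, and \<open>x = 0\<close> by convergence of Fejer means.
\<close>

section \<open>Elementary C*-algebra theory\<close>

lemma scaleC_one [simp]: "scaleC 1 (x::'a::cstar_algebra) = x"
  using scaleC_of_real[of 1 x] by simp

lemma scaleC_zero_left [simp]: "scaleC 0 (x::'a::cstar_algebra) = 0"
  using scaleC_of_real[of 0 x] by simp

lemma scaleC_zero_right [simp]: "scaleC a (0::'a::cstar_algebra) = 0"
  by (rule complex_vs.scale_zero_right)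

lemma scaleC_sum_right: "scaleC a (\<Sum>i\<in>I. f i) = (\<Sum>i\<in>I. scaleC a (f i :: 'a::cstar_algebra))"
  by (rule complex_vs.scale_sum_right)

lemma scaleC_sum_left: "scaleC (\<Sum>i\<in>I. f i) x = (\<Sum>i\<in>I. scaleC (f i) (x :: 'a::cstar_algebra))"
  by (rule complex_vs.scale_sum_left)

lemma scaleC_minus_left: "scaleC (- a) x = - scaleC a (x::'a::cstar_algebra)"
  by (rule complex_vs.scale_minus_left)

lemma scaleC_diff_right: "scaleC a (x - y) = scaleC a x - scaleC a (y::'a::cstar_algebra)"
  by (rule complex_vs.scale_right_diff_distrib)

lemma scaleR_eq_scaleC: "t *\<^sub>R x = scaleC (complex_of_real t) (x::'a::cstar_algebra)"
  by (rule scaleC_of_real[symmetric])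

lemma star_zero [simp]: "star (0::'a::cstar_algebra) = 0"
  using star_add[of "0::'a" 0] by simp

lemma star_minus: "star (- x) = - star (x::'a::cstar_algebra)"
  using star_add[of x "- x"] by (simp add: eq_neg_iff_add_eq_0 add.commute)

lemma star_diff: "star (x - y) = star x - star (y::'a::cstar_algebra)"
  using star_add[of x "- y"] by (simp add: star_minus)

lemma star_sum: "star (\<Sum>i\<in>I. f i) = (\<Sum>i\<in>I. star (f i :: 'a::cstar_algebra))"
  by (induction I rule: infinite_finite_induct) (simp_all add: star_add)

lemma norm_star [simp]: "norm (star x) = norm (x::'a::cstar_algebra)"
proof -
  have le: "norm y \<le> norm (star y)" for y :: 'a
  proof (cases "y = 0")
    case False
    have "norm y * norm y \<le> norm (star y) * norm y"
      using norm_mult_ineq[of "star y" y] by (simp add: cstar_identity power2_eq_square)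
    then show ?thesis using False by simp
  qed simp
  from le[of x] le[of "star x"] show ?thesis by (simp add: star_star)
qed

lemma star_mult_self_eq_0: "star x * x = 0 \<longleftrightarrow> x = (0::'a::cstar_algebra)"
  using cstar_identity[of x] by auto

lemma tendsto_star: "(f \<longlongrightarrow> l) F \<Longrightarrow> ((\<lambda>x. star (f x)) \<longlongrightarrow> star (l::'a::cstar_algebra)) F"
  by (simp add: tendsto_iff dist_norm star_diff[symmetric])

lemma tendsto_scaleC: "(f \<longlongrightarrow> l) F \<Longrightarrow> ((\<lambda>x. scaleC a (f x)) \<longlongrightarrow> scaleC a (l::'a::cstar_algebra)) F"
proof -
  have "bounded_linear (\<lambda>x::'a. scaleC a x)"
    by (rule bounded_linear_intro[where K = "cmod a"])
      (simp_all add: scaleC_add_right norm_scaleC scaleR_eq_scaleC scaleC_scaleC mult.commute)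
  then show "(f \<longlongrightarrow> l) F \<Longrightarrow> ((\<lambda>x. scaleC a (f x)) \<longlongrightarrow> scaleC a l) F"
    by (rule bounded_linear.tendsto)
qed

section \<open>Projections, contractions and the unit\<close>

definition projection :: "'a::cstar_algebra \<Rightarrow> bool" where
  "projection p \<longleftrightarrow> star p = p \<and> p * p = p"

lemma norm_le_1_of_square:
  assumes "(norm (x::'a::cstar_algebra))\<^sup>2 \<le> 1"
  shows "norm x \<le> 1"
  using power2_le_imp_le[of "norm x" 1] assms by simp

lemma projection_norm_le:
  assumes "projection (p::'a::cstar_algebra)"
  shows "norm p \<le> 1"
proof (cases "p = 0")
  case False
  have "norm p * norm p = norm p"
    using assms cstar_identity[of p] by (simp add: projection_def power2_eq_square)
  then show ?thesis using False by simp
qed simp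

lemma norm_le_1_if_star_mult_projection:
  assumes "projection (star x * (x::'a::cstar_algebra))"
  shows "norm x \<le> 1"
  using projection_norm_le[OF assms] by (simp add: cstar_identity norm_le_1_of_square)

lemma norm_mult_le_left:
  "norm (a::'a::cstar_algebra) \<le> 1 \<Longrightarrow> norm (a * x) \<le> norm x"
  by (metis mult_left_le_one_le norm_ge_zero norm_mult_ineq order_trans)

lemma norm_mult_le_right:
  "norm (a::'a::cstar_algebra) \<le> 1 \<Longrightarrow> norm (x * a) \<le> norm x"
  by (metis mult_right_le_one_le norm_ge_zero norm_mult_ineq order_trans)

text \<open>This is contractivity of \<open>1 - p\<close> in a form that needs no unit: for
  \<open>t = y - p * y\<close> one has \<open>star t * t = star y * t\<close>, so the C*-identity
  bounds the square of \<open>norm t\<close> by \<open>norm y * norm t\<close>.\<close>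

lemma norm_diff_projection_mult_le:
  assumes "projection (p::'a::cstar_algebra)"
  shows "norm (y - p * y) \<le> norm y"
proof (cases "y - p * y = 0")
  case False
  have "star (y - p * y) * (y - p * y) = star y * (y - p * y)"
  proof -
    have "star (p * y) = star y * p" "p * (p * y) = p * y"
      using assms by (simp_all add: projection_def star_mult flip: mult.assoc)
    then show ?thesis by (simp add: star_diff left_diff_distrib right_diff_distrib mult.assoc)
  qed
  then have "norm (y - p * y) * norm (y - p * y) \<le> norm y * norm (y - p * y)"
    using cstar_identity[of "y - p * y"] norm_mult_ineq[of "star y" "y - p * y"]
    by (simp add: power2_eq_square)
  then show ?thesis using False by simp
qed simp

lemma is_identity_unique:
  assumes "is_identity e" "is_identity (f::'a::cstar_algebra)"
  shows "e = f"
  using assms unfolding is_identity_def by metis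

lemma is_identity_star:
  assumes "is_identity (e::'a::cstar_algebra)"
  shows "star e = e"
proof -
  have "star e * x = x" "x * star e = x" for x
    using assms unfolding is_identity_def by (metis star_mult star_star)+
  then have "is_identity (star e)" by (simp add: is_identity_def)
  then show ?thesis using assms is_identity_unique by blast
qed

section \<open>Generated subalgebras and linear spans\<close>

lemma cstar_subalgebra_closure:
  fixes B :: "'a::cstar_algebra set"
  assumes "0 \<in> B" "\<And>x y. x \<in> B \<Longrightarrow> y \<in> B \<Longrightarrow> x + y \<in> B" "\<And>x y. x \<in> B \<Longrightarrow> y \<in> B \<Longrightarrow> x * y \<in> B"
    "\<And>a x. x \<in> B \<Longrightarrow> scaleC a x \<in> B" "\<And>x. x \<in> B \<Longrightarrow> star x \<in> B"
  shows "cstar_subalgebra (closure B)"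
  unfolding cstar_subalgebra_def
proof (intro conjI ballI allI)
  show "0 \<in> closure B" using assms(1) closure_subset by blast
next
  fix x y assume "x \<in> closure B" "y \<in> closure B"
  then obtain f g where f: "\<And>n. f n \<in> B" "f \<longlonglongrightarrow> x" and g: "\<And>n. g n \<in> B" "g \<longlonglongrightarrow> y"
    unfolding closure_sequential by blast
  show "x + y \<in> closure B"
    unfolding closure_sequential
    by (rule exI[of _ "\<lambda>n. f n + g n"]) (simp add: assms(2) f g tendsto_add)
  show "x * y \<in> closure B"
    unfolding closure_sequential
    by (rule exI[of _ "\<lambda>n. f n * g n"]) (simp add: assms(3) f g tendsto_mult)
next
  fix a x assume "x \<in> closure B"
  then obtain f where f: "\<And>n. f n \<in> B" "f \<longlonglongrightarrow> x"
    unfolding closure_sequential by blast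
  show "scaleC a x \<in> closure B"
    unfolding closure_sequential
    by (rule exI[of _ "\<lambda>n. scaleC a (f n)"]) (simp add: assms(4) f tendsto_scaleC)
next
  fix x assume "x \<in> closure B"
  then obtain f where f: "\<And>n. f n \<in> B" "f \<longlonglongrightarrow> x"
    unfolding closure_sequential by blast
  show "star x \<in> closure B"
    unfolding closure_sequential
    by (rule exI[of _ "\<lambda>n. star (f n)"]) (simp add: assms(5) f tendsto_star)
qed simp

lemma cstar_subalgebra_hull: "cstar_subalgebra (cstar_subalgebra hull (X::'a::cstar_algebra set))"
proof (rule hull_in)
  fix T :: "'a set set" assume "Ball T cstar_subalgebra"
  then show "cstar_subalgebra (\<Inter> T)"
    by (auto simp: cstar_subalgebra_def)
qed

lemma cspan_subset_cstar_subalgebra: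
  assumes "cstar_subalgebra (B::'a::cstar_algebra set)" "X \<subseteq> B"
  shows "cspan X \<subseteq> B"
  using assms by (intro complex_vs.span_minimal)
    (auto simp: complex_vs.subspace_def cstar_subalgebra_def)

lemma cspan_mult_closed:
  assumes "\<And>x y. x \<in> X \<Longrightarrow> y \<in> X \<Longrightarrow> x * y \<in> cspan (X::'a::cstar_algebra set)"
    and x: "x \<in> cspan X" and y: "y \<in> cspan X"
  shows "x * y \<in> cspan X"
proof -
  have *: "a * y \<in> cspan X" if "a \<in> X" for a
    using y
  proof (induction rule: complex_vs.span_induct_alt)
    case (step c b z)
    then show ?case
      using assms(1)[OF that step(1)]
      by (simp add: distrib_left mult_scaleC_right complex_vs.span_add complex_vs.span_scale)
  qed (simp add: complex_vs.span_zero)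
  show ?thesis using x
  proof (induction rule: complex_vs.span_induct_alt)
    case (step c b z)
    then show ?case using *[OF step(1)]
      by (simp add: distrib_right mult_scaleC_left complex_vs.span_add complex_vs.span_scale)
  qed (simp add: complex_vs.span_zero)
qed

lemma cspan_star_closed:
  assumes "\<And>x. x \<in> X \<Longrightarrow> star x \<in> cspan (X::'a::cstar_algebra set)"
    and x: "x \<in> cspan X"
  shows "star x \<in> cspan X"
  using x
proof (induction rule: complex_vs.span_induct_alt)
  case (step c b z)
  then show ?case using assms(1)[OF step(1)]
    by (simp add: star_add star_scaleC complex_vs.span_add complex_vs.span_scale)
qed (simp add: complex_vs.span_zero)

subsection \<open>*-homomorphisms are contractive\<close>

lemma star_hom_type_iff:
  fixes \<pi> :: "'a::cstar_algebra \<Rightarrow> 'b::cstar_algebra"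
  shows "star_hom type_cstar type_cstar \<pi> \<longleftrightarrow>
    (\<forall>x y. \<pi> (x + y) = \<pi> x + \<pi> y \<and> \<pi> (x * y) = \<pi> x * \<pi> y) \<and>
    (\<forall>a x. \<pi> (scaleC a x) = scaleC a (\<pi> x)) \<and> (\<forall>x. \<pi> (star x) = star (\<pi> x))"
  by (simp add: star_hom_def)

text \<open>Here \<open>s\<close> plays the role of 1 - sqrt(1 - h^2), since the last equation says
  (1 - s)^2 = 1 - h^2. It is the fixed point of s -> (h^2 + s^2)/2, a contraction with constant
  \<open>norm h\<close> on the self-adjoint elements commuting with \<open>h\<close> in the ball of
  that radius; Banach's theorem thus replaces functional calculus.\<close>

lemma ex_sqrt_complement:
  fixes h :: "'a::cstar_algebra"
  assumes h: "star h = h" "norm h < 1"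
  obtains s where "star s = s" "s * h = h * s" "s + s = h * h + s * s"
proof -
  define r where "r = norm h"
  define X where "X = {s. star s = s \<and> s * h = h * s \<and> norm s \<le> r}"
  define f where "f s = (1/2::real) *\<^sub>R (h * h + s * s)" for s :: 'a
  have r: "0 \<le> r" "r < 1" using h by (auto simp: r_def)
  have cl: "closed X"
    unfolding closed_sequential_limits
  proof (intro allI impI, elim conjE)
    fix g l assume g: "\<forall>n. g n \<in> X" "g \<longlonglongrightarrow> l"
    then have 1: "star (g n) = g n" "g n * h = h * g n" "norm (g n) \<le> r" for n by (auto simp: X_def)
    have "star l = l"
      using LIMSEQ_unique[OF tendsto_star[OF g(2)]] g(2) 1 by simp
    moreover have "l * h = h * l"
      using LIMSEQ_unique[OF tendsto_mult_right[OF g(2), of h]] tendsto_mult_left[OF g(2), of h] 1(2)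
      by simp
    moreover have "norm l \<le> r"
      using tendsto_norm[OF g(2)] 1(3) by (meson LIMSEQ_le_const2)
    ultimately show "l \<in> X" by (simp add: X_def)
  qed
  have "\<exists>!x\<in>X. f x = x"
  proof (rule Banach_fix[where c = r])
    show "complete X" using cl complete_eq_closed by blast
    show "X \<noteq> {}" using r by (auto simp: X_def intro!: exI[of _ 0])
    show "0 \<le> r" "r < 1" using r by auto
    show "f ` X \<subseteq> X"
    proof safe
      fix s assume s: "s \<in> X"
      have "star (f s) = f s"
        using s h by (simp add: X_def f_def scaleR_eq_scaleC star_scaleC star_add star_mult)
      moreover have "s * s * h = h * (s * s)"
        using s by (simp add: X_def mult.assoc) (simp flip: mult.assoc)
      then have "f s * h = h * f s" by (simp add: f_def distrib_left distrib_right mult.assoc)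
      moreover have "norm (f s) \<le> r"
      proof -
        have "norm (h * h) \<le> r * r" using norm_mult_ineq[of h h] by (simp add: r_def)
        moreover have "norm (s * s) \<le> r * r"
          using norm_mult_ineq[of s s] s by (smt (verit) X_def mem_Collect_eq mult_mono' norm_ge_zero)
        ultimately have "norm (h * h + s * s) \<le> r * r + r * r"
          by (meson add_mono norm_triangle_ineq order_trans)
        moreover have "r * r \<le> r" using r by (simp add: mult_left_le)
        ultimately show ?thesis by (simp add: f_def)
      qed
      ultimately show "f s \<in> X" by (simp add: X_def)
    qed
    fix s t assume "s \<in> X" "t \<in> X"
    then have st: "norm s \<le> r" "norm t \<le> r" by (auto simp: X_def)
    have eq: "s * s - t * t = s * (s - t) + (s - t) * t" by (simp add: algebra_simps)
    have "norm (s * s - t * t) \<le> r * norm (s - t) + norm (s - t) * r"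
      unfolding eq
      by (intro norm_triangle_le add_mono order_trans[OF norm_mult_ineq] mult_right_mono
          mult_left_mono st norm_ge_zero)
    moreover have "f s - f t = (1/2::real) *\<^sub>R (s * s - t * t)"
      by (simp add: f_def algebra_simps)
    ultimately show "dist (f s) (f t) \<le> r * dist s t"
      by (simp add: dist_norm mult.commute)
  qed
  then obtain s where s: "s \<in> X" "f s = s" by auto
  have "s + s = f s + f s" using s by simp
  also have "\<dots> = h * h + s * s" unfolding f_def by (simp flip: scaleR_add_left)
  finally have "s + s = h * h + s * s" .
  moreover have "star s = s" "s * h = h * s" using s(1) by (simp_all add: X_def)
  ultimately show ?thesis using that by blast
qed

text \<open>With \<open>s\<close> as above, \<open>v = h + i(1 - s)\<close> is unitary with real part \<open>h\<close>.\<close>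

lemma star_hom_norm_le_self_adjoint:
  fixes \<pi> :: "'a::cstar_algebra \<Rightarrow> 'b::cstar_algebra"
  assumes e: "is_identity (e::'a)" and \<pi>: "star_hom type_cstar type_cstar \<pi>"
    and h: "star h = h" "norm h < 1"
  shows "norm (\<pi> h) \<le> 1"
proof -
  obtain s where s: "star s = s" "s * h = h * s" "s + s = h * h + s * s"
    using ex_sqrt_complement[OF h] .
  define b where "b = e - s"
  define v where "v = h + scaleC \<i> b"
  have e': "e * x = x" "x * e = x" for x using e by (auto simp: is_identity_def)
  have se: "star e = e" using e by (rule is_identity_star)
  have b: "star b = b" "b * h = h * b" "h * h + b * b = e"
    using s by (auto simp: b_def star_diff se algebra_simps e')
  have sv: "star v = h - scaleC \<i> b"
    using b h by (simp add: v_def star_add star_scaleC scaleC_minus_left)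
  have vv: "star v * v = e"
    unfolding sv unfolding v_def using b
    by (simp add: algebra_simps mult_scaleC_left mult_scaleC_right scaleC_scaleC scaleC_minus_left)
  have \<pi>': "\<pi> (x + y) = \<pi> x + \<pi> y" "\<pi> (x * y) = \<pi> x * \<pi> y" "\<pi> (scaleC a x) = scaleC a (\<pi> x)"
    "\<pi> (star x) = star (\<pi> x)" for x y a
    using \<pi> by (auto simp: star_hom_type_iff)
  \<comment> \<open>The image of the unit is only a projection in the target, but that is enough for
    \<open>\<pi> v\<close> to be a contraction.\<close>
  have "projection (star (\<pi> v) * \<pi> v)"
    unfolding projection_def by (metis \<pi>'(2,4) vv e'(1) se)
  then have nv: "norm (\<pi> v) \<le> 1" by (rule norm_le_1_if_star_mult_projection)
  have "h = scaleC (1/2) (v + star v)"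
  proof -
    have "v + star v = scaleC 2 h"
      using sv scaleC_add_left[of 1 1 h] unfolding v_def by simp
    then show ?thesis by (simp add: scaleC_scaleC)
  qed
  then have "\<pi> h = scaleC (1/2) (\<pi> v + star (\<pi> v))" by (metis \<pi>'(1,3,4))
  then have "norm (\<pi> h) = norm (\<pi> v + star (\<pi> v)) / 2" by (simp add: norm_scaleC)
  also have "\<dots> \<le> 1" using norm_triangle_ineq[of "\<pi> v" "star (\<pi> v)"] nv by simp
  finally show ?thesis .
qed

text \<open>A self-adjoint element is scaled into the open unit ball, with an arbitrarily small
  loss; the C*-identity then passes from \<open>star x * x\<close> to \<open>x\<close>.\<close>

lemma star_hom_norm_le:
  fixes \<pi> :: "'a::cstar_algebra \<Rightarrow> 'b::cstar_algebra"
  assumes e: "is_identity (e::'a)" and \<pi>: "star_hom type_cstar type_cstar \<pi>"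
  shows "norm (\<pi> x) \<le> norm x"
proof -
  have \<pi>': "\<pi> (x * y) = \<pi> x * \<pi> y" "\<pi> (scaleC a x) = scaleC a (\<pi> x)"
    "\<pi> (star x) = star (\<pi> x)" for x y a
    using \<pi> by (auto simp: star_hom_type_iff)
  have sa: "norm (\<pi> h) \<le> norm h" if h: "star h = h" for h
  proof (rule field_le_epsilon)
    fix \<epsilon> :: real assume "\<epsilon> > 0"
    define c where "c = norm h + \<epsilon>"
    have c: "c > 0" "norm h < c" using \<open>\<epsilon> > 0\<close> by (auto simp: c_def add_nonneg_pos)
    have n: "norm (scaleC (complex_of_real (1/c)) y) = norm y / c" for y :: "'d::cstar_algebra"
      using c by (simp add: norm_scaleC norm_divide)
    have "norm (\<pi> (scaleC (complex_of_real (1/c)) h)) \<le> 1"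
    proof (rule star_hom_norm_le_self_adjoint[OF e \<pi>])
      show "star (scaleC (complex_of_real (1/c)) h) = scaleC (complex_of_real (1/c)) h"
        using h by (simp add: star_scaleC)
      show "norm (scaleC (complex_of_real (1/c)) h) < 1"
        unfolding n using c by simp
    qed
    then show "norm (\<pi> h) \<le> norm h + \<epsilon>"
      unfolding \<pi>' n using c by (simp add: c_def)
  qed
  have "(norm (\<pi> x))\<^sup>2 = norm (\<pi> (star x * x))" by (simp add: \<pi>' cstar_identity)
  also have "\<dots> \<le> norm (star x * x)" by (rule sa) (simp add: star_mult star_star)
  also have "\<dots> = (norm x)\<^sup>2" by (rule cstar_identity)
  finally show ?thesis by (simp add: power2_le_iff_abs_le abs_le_square_iff)
qed

text \<open>Contractivity makes both maps continuous, so the set where they agree is a closed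
  *-subalgebra containing the generators.\<close>

lemma star_hom_eqI:
  fixes \<pi> \<rho> :: "'a::cstar_algebra \<Rightarrow> 'b::cstar_algebra"
  assumes e: "is_identity (e::'a)"
    and \<pi>: "star_hom type_cstar type_cstar \<pi>" and \<rho>: "star_hom type_cstar type_cstar \<rho>"
    and gen: "cstar_subalgebra hull X = UNIV" and eq: "\<And>x. x \<in> X \<Longrightarrow> \<pi> x = \<rho> x"
  shows "\<pi> = \<rho>"
proof -
  have \<pi>': "\<pi> (x + y) = \<pi> x + \<pi> y" "\<pi> (x * y) = \<pi> x * \<pi> y" "\<pi> (scaleC a x) = scaleC a (\<pi> x)"
    "\<pi> (star x) = star (\<pi> x)" for x y a
    using \<pi> by (auto simp: star_hom_type_iff)
  have \<rho>': "\<rho> (x + y) = \<rho> x + \<rho> y" "\<rho> (x * y) = \<rho> x * \<rho> y" "\<rho> (scaleC a x) = scaleC a (\<rho> x)"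
    "\<rho> (star x) = star (\<rho> x)" for x y a
    using \<rho> by (auto simp: star_hom_type_iff)
  have bl: "bounded_linear \<pi>" "bounded_linear \<rho>"
    using star_hom_norm_le[OF e \<pi>] star_hom_norm_le[OF e \<rho>]
    by (auto intro!: bounded_linear_intro[where K = 1] simp: \<pi>'(1,3) \<rho>'(1,3) scaleR_eq_scaleC)
  have "closed {x. \<pi> x = \<rho> x}"
    using linear_continuous_on[OF bl(1)] linear_continuous_on[OF bl(2)] by (rule closed_Collect_eq)
  moreover have "\<pi> 0 = 0" "\<rho> 0 = 0" using bl by (simp_all add: linear_simps)
  ultimately have "cstar_subalgebra {x. \<pi> x = \<rho> x}"
    by (auto simp: cstar_subalgebra_def \<pi>' \<rho>')
  then have "cstar_subalgebra hull X \<subseteq> {x. \<pi> x = \<rho> x}"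
    by (intro hull_minimal) (auto simp: eq)
  then show ?thesis using gen by auto
qed

subsection \<open>Averages over roots of unity\<close>

text \<open>Finite averages over the K-th roots of unity replace integrals over the circle
  throughout.\<close>

definition unity_root :: "nat \<Rightarrow> nat \<Rightarrow> complex" where
  "unity_root K j = cis (2 * pi * real j / real K)"

lemma cmod_unity_root [simp]: "cmod (unity_root K j) = 1"
  by (simp add: unity_root_def)

text \<open>The integer degree a - b is carried by a pair of naturals. The hypotheses say that its
  absolute value is below K, so a ratio of 1 in the geometric series can only come from a =
  b.\<close>

lemma sum_unity_root:
  assumes "a < b + K" "b < a + K"
  shows "(\<Sum>j<K. unity_root K j ^ a * cnj (unity_root K j) ^ b) = (if a = b then of_nat K else 0)"
proof -
  have K: "K > 0" using assms by auto
  define w where "w = cis (2 * pi * (real a - real b) / real K)"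
  have w: "unity_root K j ^ a * cnj (unity_root K j) ^ b = w ^ j" for j
  proof -
    have "unity_root K j ^ a * cnj (unity_root K j) ^ b
        = cis (real a * (2 * pi * real j / real K) + real b * - (2 * pi * real j / real K))"
      unfolding unity_root_def cis_cnj Complex.DeMoivre cis_mult ..
    also have "\<dots> = w ^ j"
      unfolding w_def Complex.DeMoivre by (rule arg_cong[of _ _ cis]) (use K in \<open>simp add: field_simps\<close>)
    finally show ?thesis .
  qed
  show ?thesis
  proof (cases "a = b")
    case True
    then have "w = 1" by (simp add: w_def)
    then show ?thesis unfolding w using True by simp
  next
    case False
    have wK: "w ^ K = 1"
    proof -
      have "w ^ K = cis (2 * pi * of_int (int a - int b))"
        using K by (simp add: w_def Complex.DeMoivre)
      then show ?thesis using cis_multiple_2pi[of "of_int (int a - int b)"] by simp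
    qed
    have "w \<noteq> 1"
    proof
      assume "w = 1"
      then have "cos (2 * pi * (real a - real b) / real K) = 1"
        by (simp add: w_def complex_eq_iff)
      then obtain n :: int where "2 * pi * (real a - real b) / real K = of_int n * 2 * pi"
        using cos_one_2pi_int by auto
      then have "2 * pi * (real a - real b) = 2 * pi * (of_int n * real K)"
        using K by (simp add: field_simps)
      then have "real a - real b = of_int n * real K" by (subst (asm) mult_cancel_left) simp
      then have n: "int a - int b = n * int K" by (metis of_int_diff of_int_eq_iff of_int_mult of_int_of_nat_eq)
      have "n \<noteq> 0" using n False by auto
      then have "\<bar>n\<bar> * int K \<ge> int K" using K by (simp add: mult_le_cancel_right1)
      moreover have "\<bar>int a - int b\<bar> < int K" using assms by linarith
      ultimately show False using n by (simp add: abs_mult)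
    qed
    then have "(\<Sum>j<K. w ^ j) = 0" by (simp add: geometric_sum wK)
    then show ?thesis using False by (simp add: w)
  qed
qed

lemma sum_unity_root_scaleC:
  assumes "a < b + K" "b < a + K"
  shows "(\<Sum>j<K. scaleC (unity_root K j ^ a * cnj (unity_root K j) ^ b) y)
    = (if a = b then real K *\<^sub>R y else (0::'a::cstar_algebra))"
  unfolding scaleC_sum_left[symmetric] sum_unity_root[OF assms]
  by (simp add: scaleR_eq_scaleC)

subsection \<open>Projections whose sum is a projection\<close>

text \<open>A projection is an extreme point of the unit ball of its corner. The linear coefficient of
  the contraction-valued polynomial \<open>(r + zb/2)\<^sup>n\<close> is \<open>nb/2\<close>, so \<open>b\<close> has norm at most \<open>2/n\<close>.\<close>

lemma projection_extreme:
  fixes r b :: "'a::cstar_algebra"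
  assumes r: "projection r" and rb: "r * b = b" "b * r = b" and sb: "star b = b"
    and n1: "norm (r + b) \<le> 1" and n2: "norm (r - b) \<le> 1"
  shows "b = 0"
proof -
  define u where "u z = r + scaleC z b" for z
  have r': "star r = r" "r * r = r" using r by (auto simp: projection_def)
  \<comment> \<open>Parallelogram identity: \<open>r + b * b\<close> is the mean of the squares of
    two contractions.\<close>
  have sq: "norm (r + b * b) \<le> 1"
  proof -
    have "r + b * b = (1/2::real) *\<^sub>R ((r + b) * (r + b) + (r - b) * (r - b))"
      using rb r' by (simp add: algebra_simps) (simp flip: scaleR_add_left)
    moreover have "norm ((r + b) * (r + b)) \<le> 1" "norm ((r - b) * (r - b)) \<le> 1"
      using norm_mult_le_left[OF n1] norm_mult_le_left[OF n2] n1 n2 order_trans by blast+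
    ultimately show ?thesis
      using norm_triangle_ineq[of "(r + b) * (r + b)" "(r - b) * (r - b)"] by simp
  qed
  \<comment> \<open>At these two points the cross terms of \<open>star (u z) * u z\<close> cancel
    and leave \<open>r + b * b\<close>.\<close>
  have ui: "norm (u \<i>) \<le> 1" "norm (u (-\<i>)) \<le> 1"
  proof -
    have "star (u z) * u z = r + b * b" if "z = \<i> \<or> z = - \<i>" for z
      using that rb r' sb
      by (auto simp: u_def star_add star_scaleC algebra_simps mult_scaleC_left mult_scaleC_right
          scaleC_scaleC scaleC_minus_left)
    then have "(norm (u z))\<^sup>2 \<le> 1" if "z = \<i> \<or> z = - \<i>" for z
      using that sq by (simp flip: cstar_identity)
    then show "norm (u \<i>) \<le> 1" "norm (u (-\<i>)) \<le> 1" by (auto intro: norm_le_1_of_square)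
  qed
  have u1: "norm (u 1) \<le> 1" "norm (u (-1)) \<le> 1" using n1 n2 by (simp_all add: u_def scaleC_minus_left)
  have conv: "norm (u (complex_of_real t * c)) \<le> 1"
    if "norm (u c) \<le> 1" "norm (u (- c)) \<le> 1" "\<bar>t\<bar> \<le> 1" for t c
  proof -
    have "u (complex_of_real t * c) = ((1 + t) / 2) *\<^sub>R u c + ((1 - t) / 2) *\<^sub>R u (- c)"
      unfolding u_def scaleC_minus_left scaleC_scaleC[symmetric] scaleC_of_real
      by (simp add: algebra_simps add_divide_distrib diff_divide_distrib) (simp flip: scaleR_add_left)
    also have "norm \<dots> \<le> (1 + t) / 2 * 1 + (1 - t) / 2 * 1"
      using that by (intro norm_triangle_le add_mono) (simp_all add: mult_left_le)
    finally show ?thesis by (simp add: field_simps)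
  qed
  \<comment> \<open>Half of a unimodular number is the midpoint of its real part and
    \<open>\<i>\<close> times its imaginary part, so the bounds on the diameters [-1, 1] and [-i, i]
    suffice.\<close>
  have un: "norm (u (z / 2)) \<le> 1" if z: "cmod z = 1" for z
  proof -
    have "u (z / 2) = (1/2::real) *\<^sub>R (u (complex_of_real (Re z) * 1) + u (complex_of_real (Im z) * \<i>))"
    proof -
      have z': "z / 2 = complex_of_real (1/2) * (complex_of_real (Re z) * 1)
          + complex_of_real (1/2) * (complex_of_real (Im z) * \<i>)"
        by (simp add: complex_eq_iff)
      show ?thesis
        unfolding u_def z' scaleC_add_left scaleC_scaleC[symmetric] scaleC_of_real
        by (simp add: algebra_simps) (simp flip: scaleR_add_left)
    qed
    moreover have "norm (u (complex_of_real (Re z) * 1)) \<le> 1" "norm (u (complex_of_real (Im z) * \<i>)) \<le> 1"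
      using abs_Re_le_cmod[of z] abs_Im_le_cmod[of z] z by (intro conv u1 ui; simp)+
    ultimately show ?thesis
      using norm_triangle_ineq[of "u (complex_of_real (Re z) * 1)" "u (complex_of_real (Im z) * \<i>)"]
      by simp
  qed
  \<comment> \<open>The iteration starts at \<open>r\<close>, the unit of the corner, so this is the
    n-th power of \<open>u (z / 2)\<close> there.\<close>
  define W where "W n z = ((\<lambda>y. u (z / 2) * y) ^^ n) r" for n z
  have W_Suc: "W (Suc n) z = u (z / 2) * W n z" "W 0 z = r" for n z by (simp_all add: W_def)
  have W1: "norm (W n z) \<le> 1" if "cmod z = 1" for n z
  proof (induction n)
    case (Suc n)
    then show ?case using norm_mult_le_left[OF un[OF that]] order_trans unfolding W_Suc by blast
  qed (simp add: W_Suc projection_norm_le r)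
  \<comment> \<open>\<open>B k\<close> is the coefficient of \<open>z ^ k\<close>. The range ends at
    \<open>Suc n\<close> so that the index 1 occurs even for n = 0.\<close>
  have expand: "\<exists>B. (\<forall>z. W n z = (\<Sum>k\<le>Suc n. scaleC (z ^ k) (B k))) \<and> B 0 = r \<and>
      B 1 = (real n / 2) *\<^sub>R b \<and> (\<forall>k. r * B k = B k) \<and> (\<forall>k>n. B k = 0)" for n
  proof (induction n)
    case 0
    show ?case by (rule exI[of _ "\<lambda>k. if k = 0 then r else 0"]) (simp add: W_Suc r')
  next
    case (Suc n)
    then obtain B where B: "\<And>z. W n z = (\<Sum>k\<le>Suc n. scaleC (z ^ k) (B k))" "B 0 = r"
      "B 1 = (real n / 2) *\<^sub>R b" "\<And>k. r * B k = B k" "\<And>k. k > n \<Longrightarrow> B k = 0" by auto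
    define B' where "B' k = B k + (case k of 0 \<Rightarrow> 0 | Suc l \<Rightarrow> scaleC (1/2) (b * B l))" for k
    have "W (Suc n) z = (\<Sum>k\<le>Suc (Suc n). scaleC (z ^ k) (B' k))" for z
    proof -
      have "W (Suc n) z = (\<Sum>k\<le>Suc n. scaleC (z ^ k) (B k)) + (\<Sum>k\<le>Suc n. scaleC (z ^ Suc k) (scaleC (1/2) (b * B k)))"
        unfolding W_Suc u_def B(1)
        by (simp add: distrib_right sum_distrib_left mult_scaleC_left mult_scaleC_right scaleC_scaleC B(4)
            scaleC_add_right sum.distrib mult.commute del: sum.atMost_Suc)
      also have "(\<Sum>k\<le>Suc n. scaleC (z ^ k) (B k)) = (\<Sum>k\<le>Suc (Suc n). scaleC (z ^ k) (B k))"
        by (simp add: B(5))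
      also have "(\<Sum>k\<le>Suc n. scaleC (z ^ Suc k) (scaleC (1/2) (b * B k))) =
          (\<Sum>k\<le>Suc (Suc n). scaleC (z ^ k) (case k of 0 \<Rightarrow> 0 | Suc l \<Rightarrow> scaleC (1/2) (b * B l)))"
        by (subst (2) sum.atMost_Suc_shift) simp
      finally show ?thesis by (simp only: B'_def scaleC_add_right sum.distrib)
    qed
    moreover have "B' 1 = (real (Suc n) / 2) *\<^sub>R b"
    proof -
      have "scaleC (1/2) b = (1/2::real) *\<^sub>R b" by (simp add: scaleR_eq_scaleC)
      then have "B' 1 = (real n / 2) *\<^sub>R b + (1/2) *\<^sub>R b"
        using B(2,3) rb by (simp add: B'_def)
      also have "\<dots> = (real (Suc n) / 2) *\<^sub>R b"
        unfolding scaleR_add_left[symmetric] by (simp add: field_simps)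
      finally show ?thesis .
    qed
    moreover have "r * B' k = B' k" for k
      using rb by (cases k) (simp_all add: B'_def B(4) distrib_left mult_scaleC_right flip: mult.assoc)
    moreover have "B' k = 0" if "k > Suc n" for k
      using that by (cases k) (simp_all add: B'_def B(5))
    ultimately show ?case using B(2) by (intro exI[of _ B']) (simp add: B'_def)
  qed
  have bound: "real n / 2 * norm b \<le> 1" for n
  proof -
    obtain B where B: "\<And>z. W n z = (\<Sum>k\<le>Suc n. scaleC (z ^ k) (B k))"
      "B 1 = (real n / 2) *\<^sub>R b" using expand by blast
    \<comment> \<open>This exceeds all exponents involved, so averaging over the K-th roots isolates
      the coefficient of \<open>z\<close>.\<close>
    define K where "K = Suc (Suc (Suc n))"
    have K0: "real K > 0" by (simp add: K_def)
    have "(\<Sum>j<K. scaleC (cnj (unity_root K j)) (W n (unity_root K j)))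
        = (\<Sum>k\<le>Suc n. \<Sum>j<K. scaleC (unity_root K j ^ k * cnj (unity_root K j) ^ 1) (B k))"
      unfolding B(1) scaleC_sum_right by (subst sum.swap) (simp add: scaleC_scaleC mult.commute)
    also have "\<dots> = (\<Sum>k\<le>Suc n. if k = 1 then real K *\<^sub>R B k else 0)"
      by (intro sum.cong refl, subst sum_unity_root_scaleC) (auto simp: K_def)
    also have "\<dots> = real K *\<^sub>R B 1" by (subst sum.delta) auto
    finally have "real K * norm (B 1) = norm (\<Sum>j<K. scaleC (cnj (unity_root K j)) (W n (unity_root K j)))"
      by simp
    also have "\<dots> \<le> real (card {..<K}) * 1"
      by (rule sum_norm_bound) (simp add: norm_scaleC W1)
    finally have "norm (B 1) \<le> 1" using K0 by simp
    then show ?thesis unfolding B(2) by simp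
  qed
  show "b = 0"
  proof (rule ccontr)
    assume "b \<noteq> 0"
    then have "norm b > 0" by simp
    then obtain n where "2 / norm b < real n" using reals_Archimedean2 by blast
    then have "real n / 2 * norm b > 1" using \<open>norm b > 0\<close> by (simp add: field_simps)
    then show False using bound[of n] by simp
  qed
qed

text \<open>Let k be the number of the other indices. Then r + (a i)/k is the average of the
  contractions r - a j with j different from i, and r - (a i)/k is a convex combination of r and r -
  a i, so extremality of \<open>r\<close> gives (a i)/k = 0.\<close>

lemma corner_sum_zero:
  fixes r :: "'a::cstar_algebra"
  assumes r: "projection r" and I: "finite I"
    and a: "\<And>i. i \<in> I \<Longrightarrow> r * a i = a i" "\<And>i. i \<in> I \<Longrightarrow> a i * r = a i" "\<And>i. i \<in> I \<Longrightarrow> star (a i) = a i"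
    and n: "\<And>i. i \<in> I \<Longrightarrow> norm (r - a i) \<le> 1"
    and s: "(\<Sum>i\<in>I. a i) = 0" and i: "i \<in> I"
  shows "a i = 0"
proof (cases "I - {i} = {}")
  case True
  then have "I = {i}" using i by auto
  then show ?thesis using s by simp
next
  case False
  define k where "k = real (card (I - {i}))"
  have k: "k \<ge> 1" using False I by (simp add: k_def Suc_le_eq card_gt_0_iff)
  define b where "b = (1 / k) *\<^sub>R a i"
  have sum: "(\<Sum>j\<in>I - {i}. a j) = - a i"
    using s I i by (simp add: sum.remove[of I i] eq_neg_iff_add_eq_0 add.commute)
  have "b = 0"
  proof (rule projection_extreme[OF r])
    show "r * b = b" "b * r = b" using a i by (simp_all add: b_def)
    show "star b = b" using a(3) i by (simp add: b_def scaleR_eq_scaleC star_scaleC)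
    have "r + b = (1 / k) *\<^sub>R (\<Sum>j\<in>I - {i}. r - a j)"
      using k unfolding sum_subtractf sum
      by (simp add: b_def k_def[symmetric] scaleR_add_right sum_constant_scaleR)
    also have "norm \<dots> \<le> (1 / k) * (k * 1)"
      using k n unfolding norm_scaleR k_def by (intro mult_mono sum_norm_bound) auto
    finally show "norm (r + b) \<le> 1" using k by simp
    have "r - b = (1 - 1 / k) *\<^sub>R r + (1 / k) *\<^sub>R (r - a i)"
      by (simp add: b_def algebra_simps)
    also have "norm \<dots> \<le> (1 - 1 / k) * 1 + (1 / k) * 1"
      unfolding norm_scaleR using k n[OF i] projection_norm_le[OF r]
      by (intro norm_triangle_le add_mono) (auto simp: mult_left_le divide_le_eq_1 divide_right_mono)
    finally show "norm (r - b) \<le> 1" by simp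
  qed
  then show ?thesis using k by (simp add: b_def)
qed

text \<open>This avoids the order on self-adjoint elements. Compress by r = p j: with Q the sum, the
  elements r p_k r for k different from j, together with r - rQr at index j, add up to zero, and r
  minus each of them is a contraction. Hence r p_i r, which is
  \<open>star (p i * r) * (p i * r)\<close>, vanishes.\<close>

lemma projections_orthogonal_if_sum_projection:
  fixes p :: "'i \<Rightarrow> 'a::cstar_algebra"
  assumes I: "finite I" and p: "\<And>i. i \<in> I \<Longrightarrow> projection (p i)" and s: "projection (\<Sum>i\<in>I. p i)"
    and ij: "i \<in> I" "j \<in> I" "i \<noteq> j"
  shows "p i * p j = 0"
proof -
  define r where "r = p j"
  define Q where "Q = (\<Sum>i\<in>I. p i)"
  define a where "a k = (if k = j then r - r * Q * r else r * p k * r)" for k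
  have r: "star r = r" "r * r = r" using p ij by (auto simp: r_def projection_def)
  have Q: "star Q = Q" "Q * Q = Q" using s by (auto simp: Q_def projection_def)
  have p': "star (p k) = p k" "p k * p k = p k" if "k \<in> I" for k using p[OF that] by (auto simp: projection_def)
  have r1: "norm r \<le> 1" "norm Q \<le> 1"
    using projection_norm_le p ij s by (auto simp: r_def Q_def)
  have "a i = 0"
  proof (rule corner_sum_zero[OF _ I _ _ _ _ _ ij(1)])
    show "projection r" using p ij by (simp add: r_def)
    show "r * a k = a k" "a k * r = a k" if "k \<in> I" for k
      using r by (simp_all add: a_def algebra_simps) (simp_all flip: mult.assoc)
    show "star (a k) = a k" if "k \<in> I" for k
      using r Q p'(1)[OF that] by (simp add: a_def star_diff star_mult mult.assoc)
    show "norm (r - a k) \<le> 1" if k: "k \<in> I" for k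
    proof (cases "k = j")
      case True
      have "norm (r * Q * r) \<le> norm (r * Q)" "norm (r * Q) \<le> norm Q"
        using r1 by (intro norm_mult_le_left norm_mult_le_right; simp)+
      then show ?thesis using True r1 by (simp add: a_def)
    next
      case False
      define t where "t = r - p k * r"
      have t1: "norm t \<le> 1"
        using norm_diff_projection_mult_le[OF p[OF k], of r] r1 by (simp add: t_def)
      have "p k * (p k * r) = p k * r" using p'(2)[OF k] by (simp flip: mult.assoc)
      then have "r - a k = star t * t"
        using False r p'(1)[OF k]
        by (simp add: a_def t_def star_diff star_mult left_diff_distrib right_diff_distrib mult.assoc)
      then have "norm (r - a k) = (norm t)\<^sup>2" by (simp add: cstar_identity)
      then show ?thesis using t1 by (simp add: power_le_one)
    qed
    have "(\<Sum>k\<in>I. a k) = a j + (\<Sum>k\<in>I - {j}. r * p k * r)"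
      using I ij by (subst sum.remove[of I j]) (auto simp: a_def intro!: sum.cong)
    also have "(\<Sum>k\<in>I - {j}. r * p k * r) = (\<Sum>k\<in>I. r * p k * r) - r * p j * r"
      using I ij by (simp add: sum_diff1)
    also have "(\<Sum>k\<in>I. r * p k * r) = r * Q * r"
      by (simp add: Q_def sum_distrib_left sum_distrib_right)
    finally show "(\<Sum>k\<in>I. a k) = 0" using r by (simp add: a_def r_def[symmetric])
  qed
  then have "star (p i * r) * (p i * r) = 0"
    using ij r p'[OF ij(1)] by (simp add: a_def star_mult mult.assoc) (simp flip: mult.assoc)
  then show ?thesis by (simp add: star_mult_self_eq_0 r_def)
qed

text \<open>Multiplying a linear relation by a single \<open>p i\<close> isolates its
  coefficient.\<close>

lemma orthogonal_idempotents_independent: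
  fixes p :: "'i \<Rightarrow> 'a::cstar_algebra"
  assumes I: "finite I" and p: "\<And>i j. i \<in> I \<Longrightarrow> j \<in> I \<Longrightarrow> p i * p j = (if i = j then p i else 0)"
    and nz: "\<And>i. i \<in> I \<Longrightarrow> p i \<noteq> 0"
  shows "inj_on p I" and "complex_vs.independent (p ` I)"
proof -
  show inj: "inj_on p I"
    using p nz by (metis inj_onI)
  show "complex_vs.independent (p ` I)"
  proof (rule complex_vs.independent_if_scalars_zero)
    show "finite (p ` I)" using I by simp
    fix c x assume s: "(\<Sum>x\<in>p ` I. scaleC (c x) x) = 0" and "x \<in> p ` I"
    then obtain i where i: "i \<in> I" "x = p i" by auto
    have "0 = (\<Sum>j\<in>I. scaleC (c (p j)) (p j)) * p i"
      using s by (simp add: sum.reindex[OF inj])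
    also have "\<dots> = (\<Sum>j\<in>I. if j = i then scaleC (c x) x else 0)"
      unfolding sum_distrib_right using i by (intro sum.cong) (auto simp: mult_scaleC_left p)
    also have "\<dots> = scaleC (c x) x" using i I by simp
    finally show "c x = 0" using nz[OF i(1)] i by (metis complex_vs.scale_eq_0_iff)
  qed
qed

text \<open>Turn the direction of \<open>g\<close> by plus and minus the arc cosine of its modulus.
  This reduces norm bounds for coefficients in the disc to unimodular coefficients.\<close>

lemma complex_unimodular_average:
  assumes "cmod g \<le> 1"
  obtains a b where "cmod a = 1" "cmod b = 1" "g = (a + b) / 2"
proof -
  define t where "t = arccos (cmod g)"
  have t: "cos t = cmod g" using assms by (simp add: t_def cos_arccos_abs)
  show ?thesis
  proof
    show "cmod (cis (Arg g + t)) = 1" "cmod (cis (Arg g - t)) = 1" by simp_all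
    have "cis (Arg g + t) + cis (Arg g - t) = cis (Arg g) * (cis t + cis (- t))"
      by (simp add: cis_mult distrib_left)
    also have "cis t + cis (- t) = complex_of_real (2 * cmod g)"
      by (simp add: complex_eq_iff t)
    also have "cis (Arg g) * complex_of_real (2 * cmod g) = 2 * g"
      using rcis_cmod_Arg[of g] by (simp add: rcis_def mult.commute)
    finally show "g = (cis (Arg g + t) + cis (Arg g - t)) / 2" by simp
  qed
qed

subsection \<open>The universal property for families in the algebra itself\<close>

text \<open>The universal property speaks only of carriers inside \<open>'a \<times> real\<close>.
  To apply it to families in the algebra itself, the algebra is embedded there with second component
  0.\<close>

definition copy_cstar :: "('a::cstar_algebra \<times> real) cstar" where
  "copy_cstar = \<lparr>carrier = range (\<lambda>x. (x, 0)), mult = (\<lambda>a b. (fst a * fst b, 0)), one = undefined,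
     zero = (0, 0), add = (\<lambda>a b. (fst a + fst b, 0)),
     scale = (\<lambda>c a. (scaleC c (fst a), 0)), adj = (\<lambda>a. (star (fst a), 0)), nrm = (\<lambda>a. norm (fst a))\<rparr>"

lemma copy_cstar_simps [simp]:
  "carrier copy_cstar = range (\<lambda>x. (x, 0))"
  "mult copy_cstar = (\<lambda>a b. (fst a * fst b, 0))"
  "zero copy_cstar = (0, 0)"
  "add copy_cstar = (\<lambda>a b. (fst a + fst b, 0))"
  "scale copy_cstar = (\<lambda>c a. (scaleC c (fst a), 0))"
  "adj copy_cstar = (\<lambda>a. (star (fst a), 0))"
  "nrm copy_cstar = (\<lambda>a. norm (fst a))"
  by (simp_all add: copy_cstar_def)

lemma abelian_group_copy_cstar: "abelian_group (copy_cstar :: ('a::cstar_algebra \<times> real) cstar)"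
proof (rule abelian_groupI)
  fix x :: "'a \<times> real"
  assume "x \<in> carrier copy_cstar"
  then show "\<exists>y\<in>carrier copy_cstar. y \<oplus>\<^bsub>copy_cstar\<^esub> x = \<zero>\<^bsub>copy_cstar\<^esub>"
    by (auto intro: exI[of _ "- fst x"])
qed (auto simp: algebra_simps)

lemma a_minus_copy_cstar:
  "x \<ominus>\<^bsub>copy_cstar\<^esub> y = (fst x - fst y, 0 :: real)" for x y :: "'a::cstar_algebra \<times> real"
proof -
  have "\<ominus>\<^bsub>copy_cstar\<^esub> y = (- fst y, 0)"
    unfolding a_inv_def m_inv_def
    by (rule the_equality) (auto simp: add.commute eq_neg_iff_add_eq_0)
  then show ?thesis by (simp add: a_minus_def)
qed

lemma finsum_copy_cstar:
  "finite I \<Longrightarrow> finsum copy_cstar (\<lambda>i. (f i, 0)) I = (\<Sum>i\<in>I. (f i :: 'a::cstar_algebra), 0)"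
proof (induction rule: finite_induct)
  case empty
  interpret abelian_group "copy_cstar :: ('a \<times> real) cstar" by (rule abelian_group_copy_cstar)
  show ?case by simp
next
  case (insert i I)
  interpret abelian_group "copy_cstar :: ('a \<times> real) cstar" by (rule abelian_group_copy_cstar)
  show ?case using insert by (subst finsum_insert) auto
qed

lemma cstar_on_copy_cstar: "cstar_on (copy_cstar :: ('a::cstar_algebra \<times> real) cstar)"
proof -
  let ?B = "copy_cstar :: ('a \<times> real) cstar"
  interpret abelian_group ?B by (rule abelian_group_copy_cstar)
  have d: "nrm ?B (x \<ominus>\<^bsub>?B\<^esub> y) = dist (fst x) (fst y)" for x y
    by (simp add: a_minus_copy_cstar dist_norm)
  interpret M: Metric_space "carrier ?B" "\<lambda>x y. nrm ?B (x \<ominus>\<^bsub>?B\<^esub> y)"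
    unfolding d by unfold_locales (auto simp: dist_commute dist_triangle)
  have mc: "M.mcomplete"
    unfolding M.mcomplete_def
  proof (intro allI impI)
    fix \<sigma> assume \<sigma>: "M.MCauchy \<sigma>"
    then have "Cauchy (\<lambda>n. fst (\<sigma> n))"
      unfolding M.MCauchy_def unfolding d by (simp add: Cauchy_def)
    then obtain l where "(\<lambda>n. fst (\<sigma> n)) \<longlonglongrightarrow> l"
      using Cauchy_convergent convergent_def by blast
    moreover have "\<sigma> n \<in> carrier ?B" for n using \<sigma> unfolding M.MCauchy_def by blast
    ultimately show "\<exists>x. limitin M.mtopology \<sigma> x sequentially"
      by (intro exI[of _ "(l, 0)"], unfold M.limit_metric_sequentially, unfold d)
        (simp add: lim_sequentially)
  qed
  show ?thesis
    by unfold_locales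
      (use mc in \<open>auto simp: algebra_simps scaleC_add_right scaleC_add_left scaleC_scaleC
        mult_scaleC_left mult_scaleC_right norm_scaleC star_add star_scaleC star_mult star_star
        cstar_identity norm_triangle_ineq norm_mult_ineq\<close>)
qed

lemma star_hom_of_family:
  fixes P :: "'v \<Rightarrow> 'a::cstar_algebra"
  assumes A: "is_graph_cstar_algebra E P S" and fin: "finite (arcs E)"
    and QT: "ck_family E type_cstar Q (T :: 'e \<Rightarrow> 'a)"
  obtains \<pi> where "star_hom type_cstar type_cstar \<pi>" "\<And>v. v \<in> verts E \<Longrightarrow> \<pi> (P v) = Q v"
    "\<And>e. e \<in> arcs E \<Longrightarrow> \<pi> (S e) = T e"
proof -
  have "ck_family E copy_cstar (\<lambda>v. (Q v, 0::real)) (\<lambda>e. (T e, 0))"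
    using QT fin unfolding ck_family_type_cstar_iff[OF fin]
    by (simp add: ck_family_def finsum_copy_cstar)
  then obtain \<pi> where \<pi>: "star_hom type_cstar (copy_cstar :: ('a \<times> real) cstar) \<pi>"
    "\<forall>v\<in>verts E. \<pi> (P v) = (Q v, 0)" "\<forall>e\<in>arcs E. \<pi> (S e) = (T e, 0)"
    using A cstar_on_copy_cstar unfolding is_graph_cstar_algebra_def by blast
  have "star_hom type_cstar type_cstar (\<lambda>x. fst (\<pi> x))"
    using \<pi>(1) by (simp add: star_hom_def)
  then show ?thesis using that[of "\<lambda>x. fst (\<pi> x)"] \<pi>(2,3) by simp
qed

section \<open>Relations in the C*-algebra of a graph without sinks\<close>

text \<open>The assumption \<open>emits\<close> excludes sinks, so the summation relation is
  available at every vertex; transitivity supplies it in the final theorem.\<close>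

locale graph_cstar =
  fixes E :: "('v, 'e) pre_digraph"
    and P :: "'v \<Rightarrow> 'a::cstar_algebra"
    and S :: "'e \<Rightarrow> 'a"
  assumes fin: "finite (verts E)" "finite (arcs E)"
    and wf: "\<And>e. e \<in> arcs E \<Longrightarrow> tail E e \<in> verts E" "\<And>e. e \<in> arcs E \<Longrightarrow> head E e \<in> verts E"
    and emits: "\<And>v. v \<in> verts E \<Longrightarrow> \<exists>e\<in>arcs E. tail E e = v"
    and graph_alg: "is_graph_cstar_algebra E P S"
begin

lemma family: "ck_family E type_cstar P S"
  by (rule conjunct1[OF graph_alg[unfolded is_graph_cstar_algebra_def]])

lemma generate: "cstar_subalgebra hull (P ` verts E \<union> S ` arcs E) = UNIV"
  by (rule conjunct1[OF conjunct2[OF graph_alg[unfolded is_graph_cstar_algebra_def]]])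

lemmas family_conjs = family[unfolded ck_family_type_cstar_iff[OF fin(2)]]

lemma P_star [simp]: "v \<in> verts E \<Longrightarrow> star (P v) = P v"
  and P_idem [simp]: "v \<in> verts E \<Longrightarrow> P v * P v = P v"
  using bspec[OF conjunct1[OF family_conjs]] by simp_all

lemma P_mult: "v \<in> verts E \<Longrightarrow> w \<in> verts E \<Longrightarrow> P v * P w = (if v = w then P v else 0)"
  using conjunct1[OF conjunct2[OF family_conjs]] by simp

lemma S_star_S: "e \<in> arcs E \<Longrightarrow> star (S e) * S e = P (head E e)"
  and S_S_star_S: "e \<in> arcs E \<Longrightarrow> S e * star (S e) * S e = S e"
  using conjunct2[OF conjunct2[OF family_conjs]] by (elim conjE, simp)+

lemma P_eq_sum: "v \<in> verts E \<Longrightarrow> P v = (\<Sum>e | e \<in> arcs E \<and> tail E e = v. S e * star (S e))"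
  using conjunct2[OF conjunct2[OF family_conjs]] emits by (elim conjE) blast

lemma projection_P: "v \<in> verts E \<Longrightarrow> projection (P v)"
  by (simp add: projection_def)

lemma S_P [simp]: "e \<in> arcs E \<Longrightarrow> S e * P (head E e) = S e"
  using S_S_star_S[of e] by (simp add: mult.assoc S_star_S)

lemma projection_S_S_star: "e \<in> arcs E \<Longrightarrow> projection (S e * star (S e))"
  unfolding projection_def using S_S_star_S[of e]
  by (simp add: star_mult star_star flip: mult.assoc)

text \<open>This is not among the defining relations: it is forced because the range projections at
  a vertex sum to the vertex projection.\<close>

lemma range_projections_orthogonal:
  assumes "e \<in> arcs E" "f \<in> arcs E" "tail E e = tail E f" "e \<noteq> f"
  shows "(S e * star (S e)) * (S f * star (S f)) = 0"
proof (rule projections_orthogonal_if_sum_projection[where p = "\<lambda>e. S e * star (S e)"])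
  show "finite {e' \<in> arcs E. tail E e' = tail E e}" using fin by simp
  show "projection (\<Sum>e' | e' \<in> arcs E \<and> tail E e' = tail E e. S e' * star (S e'))"
    using projection_P P_eq_sum assms wf by metis
qed (use assms projection_S_S_star in auto)

lemma P_S [simp]:
  assumes e: "e \<in> arcs E"
  shows "P (tail E e) * S e = S e"
proof -
  have "P (tail E e) * (S e * star (S e))
      = (\<Sum>f | f \<in> arcs E \<and> tail E f = tail E e. S f * star (S f) * (S e * star (S e)))"
    using e wf by (subst P_eq_sum) (auto simp: sum_distrib_right)
  also have "\<dots> = (\<Sum>f | f \<in> arcs E \<and> tail E f = tail E e. if f = e then S e * star (S e) else 0)"
    using e range_projections_orthogonal projection_S_S_star[OF e]
    by (intro sum.cong) (auto simp: projection_def)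
  also have "\<dots> = S e * star (S e)" using e fin by simp
  finally show ?thesis using S_S_star_S[OF e] by (metis mult.assoc)
qed

lemma S_star_S_if:
  assumes e: "e \<in> arcs E" and f: "f \<in> arcs E"
  shows "star (S e) * S f = (if e = f then P (head E e) else 0)"
proof (cases "tail E e = tail E f")
  case True
  have "star (S e) * S f = star (S e) * (S e * star (S e) * (S f * star (S f))) * S f"
  proof -
    have "star (S e) * S e * star (S e) = star (S e)"
      using arg_cong[OF S_S_star_S[OF e], of star] by (simp add: star_mult star_star mult.assoc)
    then show ?thesis using S_S_star_S[OF f] by (metis mult.assoc)
  qed
  then show ?thesis
    using range_projections_orthogonal[OF e f True] S_star_S[OF e] by auto
next
  case False
  have "star (S e) * S f = star (P (tail E e) * S e) * (P (tail E f) * S f)"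
    using e f by simp
  also have "\<dots> = star (S e) * (P (tail E e) * P (tail E f)) * S f"
    by (simp only: star_mult P_star[OF wf(1)[OF e]] mult.assoc)
  also have "\<dots> = 0" using False e f wf by (simp add: P_mult)
  finally show ?thesis using False by auto
qed

lemma S_star_S_mult:
  assumes e: "e \<in> arcs E" and f: "f \<in> arcs E"
  shows "star (S e) * (S f * x) = (if e = f then P (head E e) * x else 0)"
  using S_star_S_if[OF e f] by (simp flip: mult.assoc)

lemma star_S_P_tail [simp]: "e \<in> arcs E \<Longrightarrow> star (S e) * P (tail E e) = star (S e)"
  by (metis P_S P_star star_mult wf(1))

lemma P_S_if: "v \<in> verts E \<Longrightarrow> e \<in> arcs E \<Longrightarrow> P v * S e = (if tail E e = v then S e else 0)"
  using P_S[of e] P_mult[of v "tail E e"] wf(1)[of e]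
  by (metis (no_types, lifting) mult.assoc mult_zero_left)

lemma S_P_if: "v \<in> verts E \<Longrightarrow> e \<in> arcs E \<Longrightarrow> S e * P v = (if head E e = v then S e else 0)"
  using S_P[of e] P_mult[of "head E e" v] wf(2)[of e]
  by (metis (no_types, lifting) mult.assoc mult_zero_right)

definition unit_elem :: 'a where
  "unit_elem = (\<Sum>v\<in>verts E. P v)"

lemma unit_elem_P: "v \<in> verts E \<Longrightarrow> unit_elem * P v = P v"
  unfolding unit_elem_def sum_distrib_right
  using fin by (simp add: P_mult if_distrib[where f="\<lambda>x. x * _"] cong: sum.cong)

lemma unit_elem_S: "e \<in> arcs E \<Longrightarrow> unit_elem * S e = S e \<and> S e * unit_elem = S e"
  unfolding unit_elem_def sum_distrib_right sum_distrib_left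
  using fin wf by (simp add: P_S_if S_P_if cong: sum.cong)

lemma star_unit_elem [simp]: "star unit_elem = unit_elem"
  by (simp add: unit_elem_def star_sum)

text \<open>The elements fixed by multiplication with \<open>unit_elem\<close> on both sides form a
  closed *-subalgebra containing the generators.\<close>

lemma unit_elem: "is_identity unit_elem"
proof -
  let ?X = "{x. unit_elem * x = x \<and> x * unit_elem = x}"
  have cl: "closed ?X"
    unfolding Collect_conj_eq
    by (intro closed_Int closed_Collect_eq continuous_intros)
  have "star x \<in> ?X" if "x \<in> ?X" for x
  proof -
    have "unit_elem * star x = star (x * unit_elem)" "star x * unit_elem = star (unit_elem * x)"
      by (simp_all add: star_mult)
    then show ?thesis using that by simp
  qed
  moreover have "x * y \<in> ?X" if "x \<in> ?X" "y \<in> ?X" for x y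
  proof -
    have "unit_elem * (x * y) = unit_elem * x * y" "x * y * unit_elem = x * (y * unit_elem)"
      by (simp_all only: mult.assoc)
    then show ?thesis using that by simp
  qed
  ultimately have "cstar_subalgebra ?X"
    using cl unfolding cstar_subalgebra_def
    by (simp add: distrib_left distrib_right mult_scaleC_left mult_scaleC_right)
  moreover have "P v * unit_elem = P v" if "v \<in> verts E" for v
    using arg_cong[OF unit_elem_P[OF that], of star] that by (simp add: star_mult)
  then have "P ` verts E \<union> S ` arcs E \<subseteq> ?X"
    using unit_elem_P unit_elem_S by blast
  ultimately have "UNIV \<subseteq> ?X" unfolding generate[symmetric] by (rule hull_minimal[rotated])
  then show ?thesis by (auto simp: is_identity_def)
qed

lemma unit_elem_mult [simp]: "unit_elem * x = x" "x * unit_elem = x"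
  using unit_elem by (auto simp: is_identity_def)

lemma unit_elem_eq_sum_S: "unit_elem = (\<Sum>e\<in>arcs E. S e * star (S e))"
proof -
  have "unit_elem = (\<Sum>v\<in>verts E. \<Sum>e | e \<in> arcs E \<and> tail E e = v. S e * star (S e))"
    unfolding unit_elem_def by (intro sum.cong refl P_eq_sum)
  also have "\<dots> = (\<Sum>e\<in>arcs E. S e * star (S e))"
    using fin wf by (intro sum.group) auto
  finally show ?thesis .
qed

lemma unitary_iff: "unitary u \<longleftrightarrow> star u * u = unit_elem \<and> u * star u = unit_elem"
  unfolding unitary_def using unit_elem is_identity_unique by metis

subsection \<open>The canonical shift\<close>

text \<open>The commutant of the vertex projections: on it the shift \<open>\<phi>\<close> is
  multiplicative and is intertwined with the identity by every edge.\<close>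

definition C :: "'a set" where
  "C = {a. \<forall>v\<in>verts E. a * P v = P v * a}"

definition \<phi> :: "'a \<Rightarrow> 'a" where
  "\<phi> a = (\<Sum>e\<in>arcs E. S e * a * star (S e))"

lemma C_mult: "a \<in> C \<Longrightarrow> b \<in> C \<Longrightarrow> a * b \<in> C"
  unfolding C_def by (auto, metis mult.assoc)

lemma C_star: "a \<in> C \<Longrightarrow> star a \<in> C"
  unfolding C_def by (auto, metis star_mult P_star)

lemma C_S_S:
  assumes "e \<in> arcs E" "f \<in> arcs E" "tail E e = tail E f"
  shows "S e * star (S f) \<in> C"
  unfolding C_def
proof (intro CollectI ballI)
  fix v assume v: "v \<in> verts E"
  have "S e * star (S f) * P v = S e * star (P v * S f)"
    using v by (simp add: star_mult mult.assoc)
  then show "S e * star (S f) * P v = P v * (S e * star (S f))"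
    using assms v by (simp add: P_S_if flip: mult.assoc)
qed

lemma \<phi>_C: "\<phi> a \<in> C"
  unfolding C_def
proof (intro CollectI ballI)
  fix v assume v: "v \<in> verts E"
  have "S e * a * star (S e) * P v = P v * (S e * a * star (S e))" if "e \<in> arcs E" for e
  proof -
    have "S e * a * star (S e) * P v = S e * a * star (P v * S e)"
      using v by (simp add: star_mult mult.assoc)
    then show ?thesis using that v by (simp add: P_S_if flip: mult.assoc)
  qed
  then show "\<phi> a * P v = P v * \<phi> a"
    by (simp add: \<phi>_def sum_distrib_left sum_distrib_right cong: sum.cong)
qed

lemma \<phi>_add: "\<phi> (a + b) = \<phi> a + \<phi> b"
  by (simp add: \<phi>_def distrib_left distrib_right sum.distrib)

lemma \<phi>_star: "\<phi> (star a) = star (\<phi> a)"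
  by (simp add: \<phi>_def star_sum star_mult star_star mult.assoc)

lemma \<phi>_unit: "\<phi> unit_elem = unit_elem"
  by (simp add: \<phi>_def unit_elem_eq_sum_S[symmetric])

lemma \<phi>_scaleC: "\<phi> (scaleC c a) = scaleC c (\<phi> a)"
  by (simp add: \<phi>_def mult_scaleC_left mult_scaleC_right scaleC_sum_right)

text \<open>Orthogonality of the ranges leaves only the summand of \<open>e\<close>, where
  \<open>a\<close> moves past the projection of the range vertex. All later intertwining relations
  are iterates of this one.\<close>

lemma \<phi>_S:
  assumes a: "a \<in> C" and e: "e \<in> arcs E"
  shows "\<phi> a * S e = S e * a"
proof -
  have "\<phi> a * S e = (\<Sum>f\<in>arcs E. S f * a * (star (S f) * S e))"
    by (simp add: \<phi>_def sum_distrib_right mult.assoc)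
  also have "\<dots> = (\<Sum>f\<in>arcs E. if f = e then S e * a * P (head E e) else 0)"
    using e by (intro sum.cong) (auto simp: S_star_S_if)
  also have "\<dots> = S e * (a * P (head E e))" using fin e by (simp add: mult.assoc)
  also have "\<dots> = S e * (P (head E e) * a)" using a e wf by (simp add: C_def)
  also have "\<dots> = S e * a" using e by (simp flip: mult.assoc)
  finally show ?thesis .
qed

lemma star_S_\<phi>:
  assumes a: "a \<in> C" and e: "e \<in> arcs E"
  shows "star (S e) * \<phi> a = a * star (S e)"
  using arg_cong[OF \<phi>_S[OF C_star[OF a] e], of star] by (simp add: star_mult star_star \<phi>_star)

lemma \<phi>_mult:
  assumes a: "a \<in> C"
  shows "\<phi> (a * b) = \<phi> a * \<phi> b"
proof -
  have "\<phi> a * \<phi> b = (\<Sum>e\<in>arcs E. \<phi> a * S e * b * star (S e))"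
    by (simp add: \<phi>_def[of b] sum_distrib_left mult.assoc)
  then show ?thesis using \<phi>_S[OF a] by (simp add: \<phi>_def[of "a * b"] mult.assoc)
qed

definition \<phi>n :: "nat \<Rightarrow> 'a \<Rightarrow> 'a" where
  "\<phi>n m = \<phi> ^^ m"

lemma \<phi>n_0 [simp]: "\<phi>n 0 a = a" and \<phi>n_Suc: "\<phi>n (Suc m) a = \<phi> (\<phi>n m a)"
  by (simp_all add: \<phi>n_def)

lemma \<phi>n_add: "\<phi>n (m + n) a = \<phi>n m (\<phi>n n a)"
  by (simp add: \<phi>n_def funpow_add)

lemma \<phi>n_C: "a \<in> C \<Longrightarrow> \<phi>n m a \<in> C"
  by (cases m) (simp_all add: \<phi>n_Suc \<phi>_C)

lemma \<phi>n_plus: "\<phi>n m (a + b) = \<phi>n m a + \<phi>n m b"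
  by (induction m) (simp_all add: \<phi>n_Suc \<phi>_add)

lemma \<phi>n_sum: "finite I \<Longrightarrow> I \<noteq> {} \<Longrightarrow> \<phi>n m (\<Sum>i\<in>I. f i) = (\<Sum>i\<in>I. \<phi>n m (f i))"
  by (induction I rule: finite_ne_induct) (simp_all add: \<phi>n_plus)

lemma \<phi>n_star: "\<phi>n m (star a) = star (\<phi>n m a)"
  by (induction m) (simp_all add: \<phi>n_Suc \<phi>_star)

lemma \<phi>n_unit: "\<phi>n m unit_elem = unit_elem"
  by (induction m) (simp_all add: \<phi>n_Suc \<phi>_unit)

lemma \<phi>n_scaleC: "\<phi>n m (scaleC c a) = scaleC c (\<phi>n m a)"
  by (induction m) (simp_all add: \<phi>n_Suc \<phi>_scaleC)

lemma \<phi>n_mult: "a \<in> C \<Longrightarrow> \<phi>n m (a * b) = \<phi>n m a * \<phi>n m b"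
  by (induction m) (simp_all add: \<phi>n_Suc \<phi>_mult \<phi>n_C)

lemma projection_\<phi>n: "a \<in> C \<Longrightarrow> projection a \<Longrightarrow> projection (\<phi>n m a)"
  unfolding projection_def by (metis \<phi>n_mult \<phi>n_star)

text \<open>The iterated shift carries the projection \<open>star a * a\<close> to a projection, and
  the C*-identity turns this into a norm bound.\<close>

lemma norm_\<phi>n_le_1:
  assumes "a \<in> C" "projection (star a * a)"
  shows "norm (\<phi>n m a) \<le> 1"
  using assms projection_\<phi>n[of "star a * a" m]
  by (intro norm_le_1_if_star_mult_projection) (simp add: C_mult C_star \<phi>n_mult \<phi>n_star)

subsection \<open>Homomorphisms given by families\<close>

lemma hom_of_family:
  assumes "ck_family E type_cstar Q T"
  obtains \<pi> where "star_hom type_cstar type_cstar \<pi>" "\<And>v. v \<in> verts E \<Longrightarrow> \<pi> (P v) = Q v"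
    "\<And>e. e \<in> arcs E \<Longrightarrow> \<pi> (S e) = (T e :: 'a)"
  using star_hom_of_family[OF graph_alg fin(2) assms] by blast

lemma hom_eqI:
  assumes "star_hom type_cstar type_cstar \<pi>" "star_hom type_cstar type_cstar \<rho>"
    "\<And>v. v \<in> verts E \<Longrightarrow> \<pi> (P v) = \<rho> (P v)" "\<And>e. e \<in> arcs E \<Longrightarrow> \<pi> (S e) = (\<rho> (S e) :: 'a)"
  shows "\<pi> = \<rho>"
  using assms by (intro star_hom_eqI[OF unit_elem _ _ generate]) auto

text \<open>As \<open>u\<close> commutes with the vertex projections, the new range projections at
  \<open>v\<close> add up to \<open>u * P v * star u = P v\<close>.\<close>

lemma family_mult_left:
  assumes u: "u \<in> C" "star u * u = unit_elem" "u * star u = unit_elem"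
  shows "ck_family E type_cstar P (\<lambda>e. u * S e)"
proof -
  have 1: "star (u * S e) * (u * S e) = P (head E e)" if "e \<in> arcs E" for e
  proof -
    have "star (u * S e) * (u * S e) = star (S e) * (star u * u) * S e"
      by (simp add: star_mult mult.assoc)
    then show ?thesis using u S_star_S[OF that] by simp
  qed
  have 2: "P v = (\<Sum>e | e \<in> arcs E \<and> tail E e = v. (u * S e) * star (u * S e))" if v: "v \<in> verts E" for v
  proof -
    have "(\<Sum>e | e \<in> arcs E \<and> tail E e = v. (u * S e) * star (u * S e)) = u * P v * star u"
      unfolding P_eq_sum[OF v] by (simp add: sum_distrib_left sum_distrib_right star_mult mult.assoc)
    also have "\<dots> = P v * (u * star u)" using u(1) v by (simp add: C_def mult.assoc)
    finally show ?thesis using u by simp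
  qed
  show ?thesis
    unfolding ck_family_type_cstar_iff[OF fin(2)]
  proof (intro conjI ballI impI)
    fix e assume "e \<in> arcs E"
    then show "u * S e * star (u * S e) * (u * S e) = u * S e"
      using 1[of e] by (simp add: mult.assoc)
  next
    fix v assume "v \<in> verts E"
    then show "P v = (\<Sum>e | e \<in> arcs E \<and> tail E e = v. u * S e * star (u * S e))" by (rule 2)
  qed (simp_all add: 1 P_mult)
qed

text \<open>Existence comes from the universal property and uniqueness from the generators, which
  resolves the definite description. The map is unital because the unit is the sum of the vertex
  projections.\<close>

lemma quasi_free:
  assumes u: "u \<in> C" "unitary u"
  shows "star_hom type_cstar type_cstar (quasi_free E P S u)"
    and "e \<in> arcs E \<Longrightarrow> quasi_free E P S u (S e) = u * S e"
    and "v \<in> verts E \<Longrightarrow> quasi_free E P S u (P v) = P v"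
proof -
  have u': "star u * u = unit_elem" "u * star u = unit_elem" using u(2) by (auto simp: unitary_iff)
  obtain \<pi> where \<pi>: "star_hom type_cstar type_cstar \<pi>" "\<And>v. v \<in> verts E \<Longrightarrow> \<pi> (P v) = P v"
    "\<And>e. e \<in> arcs E \<Longrightarrow> \<pi> (S e) = u * S e"
    using hom_of_family[OF family_mult_left[OF u(1) u']] by blast
  have add: "\<pi> (x + y) = \<pi> x + \<pi> y" for x y using \<pi>(1) by (simp add: star_hom_type_iff)
  then have "\<pi> 0 = 0" by (metis add_cancel_right_right)
  then have "\<pi> (sum f I) = (\<Sum>i\<in>I. \<pi> (f i))" for f :: "'v \<Rightarrow> 'a" and I
    by (induction I rule: infinite_finite_induct) (simp_all add: add)
  then have "\<pi> unit_elem = unit_elem" by (simp add: unit_elem_def \<pi>(2))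
  then have unital: "\<forall>p. is_identity p \<longrightarrow> \<pi> p = p"
    using unit_elem is_identity_unique by metis
  have "quasi_free E P S u = \<pi>"
    unfolding quasi_free_def
  proof (rule the_equality)
    fix \<rho> assume "star_hom type_cstar type_cstar \<rho> \<and> (\<forall>p. is_identity p \<longrightarrow> \<rho> p = p) \<and>
     (\<forall>e\<in>arcs E. \<rho> (S e) = u * S e) \<and> (\<forall>v\<in>verts E. \<rho> (P v) = P v)"
    then show "\<rho> = \<pi>" using \<pi> by (intro hom_eqI) auto
  qed (use \<pi> unital in auto)
  then show "star_hom type_cstar type_cstar (quasi_free E P S u)"
    and "e \<in> arcs E \<Longrightarrow> quasi_free E P S u (S e) = u * S e"
    and "v \<in> verts E \<Longrightarrow> quasi_free E P S u (P v) = P v"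
    using \<pi> by auto
qed

section \<open>The gauge action\<close>

definition gauge_aut :: "complex \<Rightarrow> 'a \<Rightarrow> 'a" where
  "gauge_aut z = quasi_free E P S (scaleC z unit_elem)"

text \<open>A scalar of modulus 1 times the unit is a unitary in \<open>C\<close>, so the gauge
  action is a special case of the quasi-free construction.\<close>

lemma gauge_aut:
  assumes "cmod z = 1"
  shows gauge_aut_hom: "star_hom type_cstar type_cstar (gauge_aut z)"
    and gauge_aut_S: "e \<in> arcs E \<Longrightarrow> gauge_aut z (S e) = scaleC z (S e)"
    and gauge_aut_P: "v \<in> verts E \<Longrightarrow> gauge_aut z (P v) = P v"
proof -
  have "scaleC z unit_elem \<in> C" by (simp add: C_def mult_scaleC_left mult_scaleC_right)
  moreover have "cnj z * z = 1" "z * cnj z = 1"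
    using assms complex_norm_square[of z] by (auto simp: mult.commute)
  then have "unitary (scaleC z unit_elem)"
    by (simp add: unitary_iff star_scaleC mult_scaleC_left mult_scaleC_right scaleC_scaleC)
  ultimately show "star_hom type_cstar type_cstar (gauge_aut z)"
    and "e \<in> arcs E \<Longrightarrow> gauge_aut z (S e) = scaleC z (S e)"
    and "v \<in> verts E \<Longrightarrow> gauge_aut z (P v) = P v"
    using quasi_free[of "scaleC z unit_elem"] by (auto simp: gauge_aut_def mult_scaleC_left)
qed

lemma gauge_aut_simps:
  assumes "cmod z = 1"
  shows "gauge_aut z (x + y) = gauge_aut z x + gauge_aut z y" "gauge_aut z (x * y) = gauge_aut z x * gauge_aut z y"
    "gauge_aut z (scaleC c x) = scaleC c (gauge_aut z x)" "gauge_aut z (star x) = star (gauge_aut z x)"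
    "gauge_aut z 0 = 0" "gauge_aut z (x - y) = gauge_aut z x - gauge_aut z y"
    "norm (gauge_aut z x) \<le> norm x"
proof -
  note g = gauge_aut_hom[OF assms]
  show 1: "gauge_aut z (x + y) = gauge_aut z x + gauge_aut z y" "gauge_aut z (x * y) = gauge_aut z x * gauge_aut z y"
    "gauge_aut z (scaleC c x) = scaleC c (gauge_aut z x)" "gauge_aut z (star x) = star (gauge_aut z x)" for x y c
    using g by (auto simp: star_hom_type_iff)
  show "gauge_aut z 0 = 0" using 1(1)[of 0 0] by simp
  show "gauge_aut z (x - y) = gauge_aut z x - gauge_aut z y" using 1(1)[of "x - y" y] by (simp add: eq_diff_eq)
  show "norm (gauge_aut z x) \<le> norm x" using star_hom_norm_le[OF unit_elem g] .
qed

lemma gauge_aut_sum: "cmod z = 1 \<Longrightarrow> gauge_aut z (\<Sum>i\<in>I. f i) = (\<Sum>i\<in>I. gauge_aut z (f i))"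
  by (induction I rule: infinite_finite_induct) (simp_all add: gauge_aut_simps)

lemma gauge_aut_\<phi>:
  assumes z: "cmod z = 1"
  shows "gauge_aut z (\<phi> a) = \<phi> (gauge_aut z a)"
proof -
  have "z * cnj z = 1" using z complex_norm_square[of z] by simp
  then show ?thesis
    unfolding \<phi>_def gauge_aut_sum[OF z]
    by (intro sum.cong refl)
      (simp add: gauge_aut_simps[OF z] gauge_aut_S[OF z] star_scaleC mult_scaleC_left mult_scaleC_right
        scaleC_scaleC mult.commute[of "cnj z"])
qed


section \<open>The diagonal\<close>

abbreviation D :: "nat \<Rightarrow> 'a set" where
  "D \<equiv> diag_level E P S"

abbreviation pproj :: "'v \<times> 'e list \<Rightarrow> 'a" where
  "pproj \<equiv> path_proj P S"

lemma paths_of_length_0: "paths_of_length E 0 = (\<lambda>v. (v, [])) ` verts E"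
  by (auto simp: paths_of_length_def pre_digraph.awalk_def pre_digraph.cas.simps)

lemma paths_of_length_Suc:
  "paths_of_length E (Suc k)
    = {(tail E e, e # p) | e p. e \<in> arcs E \<and> (head E e, p) \<in> paths_of_length E k}"
  (is "?L = ?R")
proof
  show "?L \<subseteq> ?R"
  proof
    fix \<mu> assume "\<mu> \<in> ?L"
    then obtain v q w where \<mu>: "\<mu> = (v, q)" "pre_digraph.awalk E v q w" "length q = Suc k"
      by (auto simp: paths_of_length_def)
    then obtain e p where q: "q = e # p" by (cases q) auto
    then show "\<mu> \<in> ?R"
      using \<mu> wf by (auto simp: paths_of_length_def pre_digraph.awalk_def pre_digraph.cas.simps)
  qed
  show "?R \<subseteq> ?L"
    using wf by (auto simp: paths_of_length_def pre_digraph.awalk_def pre_digraph.cas.simps)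
qed

lemma finite_paths_of_length: "finite (paths_of_length E k)"
proof (induction k)
  case 0
  then show ?case using fin by (simp add: paths_of_length_0)
next
  case (Suc k)
  have "paths_of_length E (Suc k) \<subseteq> (\<lambda>(e, \<mu>). (tail E e, e # snd \<mu>)) ` (arcs E \<times> paths_of_length E k)"
    by (force simp: paths_of_length_Suc)
  then show ?case using Suc fin finite_subset by blast
qed

lemma path_elem_source: "p \<noteq> [] \<Longrightarrow> path_elem P S (v, p) = path_elem P S (w, p)"
  by (induction p rule: induct_list012) auto

lemma path_elem_Cons:
  "e \<in> arcs E \<Longrightarrow> path_elem P S (tail E e, e # p) = S e * path_elem P S (head E e, p)"
  using path_elem_source[of p "tail E e" "head E e"] by (cases p) auto

lemma path_proj_Nil [simp]: "v \<in> verts E \<Longrightarrow> pproj (v, []) = P v"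
  by (simp add: path_proj_def)

lemma path_proj_Cons:
  "e \<in> arcs E \<Longrightarrow> pproj (tail E e, e # p) = S e * pproj (head E e, p) * star (S e)"
  unfolding path_proj_def path_elem_Cons by (simp add: star_mult mult.assoc)

lemma path_proj_star [simp]: "star (pproj \<mu>) = pproj \<mu>"
  by (simp add: path_proj_def star_mult star_star)

lemma paths_source: "(v, p) \<in> paths_of_length E k \<Longrightarrow> v \<in> verts E"
  by (auto simp: paths_of_length_def pre_digraph.awalk_def)

lemma P_path_proj: "(v, p) \<in> paths_of_length E k \<Longrightarrow> P v * pproj (v, p) = pproj (v, p)"
  by (cases k) (auto simp: paths_of_length_0 paths_of_length_Suc path_proj_Cons simp flip: mult.assoc)

lemma path_proj_mult:
  assumes "\<mu> \<in> paths_of_length E k" "\<nu> \<in> paths_of_length E k"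
  shows "pproj \<mu> * pproj \<nu> = (if \<mu> = \<nu> then pproj \<mu> else 0)"
  using assms
proof (induction k arbitrary: \<mu> \<nu>)
  case 0
  then show ?case by (auto simp: paths_of_length_0 P_mult split: if_splits)
next
  case (Suc k)
  then obtain e p f q where
    \<mu>: "\<mu> = (tail E e, e # p)" "e \<in> arcs E" "(head E e, p) \<in> paths_of_length E k" and
    \<nu>: "\<nu> = (tail E f, f # q)" "f \<in> arcs E" "(head E f, q) \<in> paths_of_length E k"
    by (auto simp: paths_of_length_Suc)
  have "pproj \<mu> * pproj \<nu> = S e * pproj (head E e, p) * (star (S e) * S f) * pproj (head E f, q) * star (S f)"
    using \<mu> \<nu> by (simp add: path_proj_Cons mult.assoc)
  also have "\<dots> = (if e = f then S e * (pproj (head E e, p) * pproj (head E f, q)) * star (S e) else 0)"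
    using \<mu> \<nu> P_path_proj[OF \<nu>(3)] by (simp add: S_star_S_if mult.assoc) (simp flip: mult.assoc)
  finally show ?case
    using Suc.IH[OF \<mu>(3)] \<mu> \<nu> by (auto simp: path_proj_Cons)
qed

lemma diag_level_add: "x \<in> D k \<Longrightarrow> y \<in> D k \<Longrightarrow> x + y \<in> D k"
  and diag_level_scale: "x \<in> D k \<Longrightarrow> scaleC c x \<in> D k"
  and diag_level_zero: "0 \<in> D k"
  and diag_level_path_proj: "\<mu> \<in> paths_of_length E k \<Longrightarrow> pproj \<mu> \<in> D k"
  unfolding diag_level_def
  by (simp_all add: complex_vs.span_add complex_vs.span_scale complex_vs.span_zero complex_vs.span_base)

lemma diag_level_sum: "(\<And>i. i \<in> I \<Longrightarrow> f i \<in> D k) \<Longrightarrow> sum f I \<in> D k"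
  unfolding diag_level_def by (rule complex_vs.span_sum)

lemma diag_level_induct [consumes 1, case_names zero step]:
  assumes "d \<in> D k" "Q 0"
    "\<And>c \<mu> y. \<mu> \<in> paths_of_length E k \<Longrightarrow> Q y \<Longrightarrow> Q (scaleC c (pproj \<mu>) + y)"
  shows "Q d"
  using assms(1) unfolding diag_level_def
  by (induction rule: complex_vs.span_induct_alt) (use assms(2,3) in auto)

lemma diag_level_conj_S:
  assumes d: "d \<in> D k" and e: "e \<in> arcs E"
  shows "S e * d * star (S e) \<in> D (Suc k)"
  using d
proof (induction rule: diag_level_induct)
  case (step c \<mu> y)
  obtain v p where \<mu>: "\<mu> = (v, p)" by (cases \<mu>)
  have "S e * pproj \<mu> * star (S e) \<in> D (Suc k)"
  proof (cases "head E e = v")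
    case True
    then have "(tail E e, e # p) \<in> paths_of_length E (Suc k)"
      using step(1) e \<mu> by (auto simp: paths_of_length_Suc)
    then show ?thesis using diag_level_path_proj True \<mu> path_proj_Cons[OF e, of p] by metis
  next
    case False
    have v: "v \<in> verts E" using step(1) \<mu> paths_source by blast
    have "S e * pproj \<mu> = S e * P v * pproj \<mu>"
      using P_path_proj step(1) \<mu> by (simp add: mult.assoc)
    then show ?thesis using False e v by (simp add: S_P_if diag_level_zero)
  qed
  then show ?case using step(2)
    by (simp add: distrib_left distrib_right mult_scaleC_left mult_scaleC_right diag_level_add
        diag_level_scale)
qed (simp add: diag_level_zero)

lemma diag_level_\<phi>: "d \<in> D k \<Longrightarrow> \<phi> d \<in> D (Suc k)"
  unfolding \<phi>_def by (intro diag_level_sum diag_level_conj_S)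

lemma diag_level_P: "v \<in> verts E \<Longrightarrow> P v \<in> D 0"
  using diag_level_path_proj[of "(v, [])" 0] by (simp add: paths_of_length_0)

lemma diag_level_S: "e \<in> arcs E \<Longrightarrow> S e * star (S e) \<in> D 1"
  using diag_level_conj_S[OF diag_level_P[of "head E e"], of e] wf by simp

text \<open>For paths of length 0 this is the Cuntz-Krieger relation at a vertex; conjugation by
  edges carries it to longer paths.\<close>

lemma diag_level_Suc: "D k \<subseteq> D (Suc k)"
proof -
  have "pproj \<mu> \<in> D (Suc k)" if "\<mu> \<in> paths_of_length E k" for \<mu>
    using that
  proof (induction k arbitrary: \<mu>)
    case 0
    then obtain v where v: "v \<in> verts E" "\<mu> = (v, [])" by (auto simp: paths_of_length_0)
    have "P v \<in> D 1" unfolding P_eq_sum[OF v(1)] by (intro diag_level_sum diag_level_S) auto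
    then show ?case using v by simp
  next
    case (Suc k)
    then obtain e p where \<mu>: "\<mu> = (tail E e, e # p)" "e \<in> arcs E" "(head E e, p) \<in> paths_of_length E k"
      by (auto simp: paths_of_length_Suc)
    then show ?case using diag_level_conj_S[OF Suc.IH[OF \<mu>(3)] \<mu>(2)] by (simp add: path_proj_Cons)
  qed
  then show ?thesis
    unfolding diag_level_def[of E P S k]
    by (intro complex_vs.span_minimal) (auto simp: diag_level_def)
qed

lemma diag_level_mono: "k \<le> l \<Longrightarrow> D k \<subseteq> D l"
  by (rule lift_Suc_mono_le[of D]) (rule diag_level_Suc)

lemma diag_level_mult: "x \<in> D k \<Longrightarrow> y \<in> D k \<Longrightarrow> x * y \<in> D k"
  unfolding diag_level_def
proof (rule cspan_mult_closed)
  fix x y assume "x \<in> pproj ` paths_of_length E k" "y \<in> pproj ` paths_of_length E k"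
  then show "x * y \<in> cspan (pproj ` paths_of_length E k)"
    by (force simp: path_proj_mult complex_vs.span_zero intro: complex_vs.span_base)
qed

lemma diag_level_star: "x \<in> D k \<Longrightarrow> star x \<in> D k"
  unfolding diag_level_def by (rule cspan_star_closed) (auto intro: complex_vs.span_base)

lemma diag_level_commute:
  assumes "x \<in> D k" "y \<in> D l"
  shows "x * y = y * x"
proof -
  define m where "m = max k l"
  have x: "x \<in> D m" and y: "y \<in> D m"
    using assms diag_level_mono[of k m] diag_level_mono[of l m] by (auto simp: m_def)
  have "y * pproj \<mu> = pproj \<mu> * y" if \<mu>: "\<mu> \<in> paths_of_length E m" for \<mu>
    using y
  proof (induction rule: diag_level_induct)
    case (step c \<nu> y)
    then show ?case using \<mu> path_proj_mult[OF \<mu> step(1)] path_proj_mult[OF step(1) \<mu>]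
      by (auto simp: distrib_left distrib_right mult_scaleC_left mult_scaleC_right)
  qed simp
  with x show ?thesis
    by (induction rule: diag_level_induct)
      (auto simp: distrib_left distrib_right mult_scaleC_left mult_scaleC_right)
qed

lemma diag_level_\<phi>n: "d \<in> D k \<Longrightarrow> \<phi>n m d \<in> D (m + k)"
  by (induction m) (simp_all add: \<phi>n_Suc diag_level_\<phi>)

lemma diag_level_subset_diag: "D k \<subseteq> diag E P S"
proof -
  have "pproj ` paths_of_length E k \<subseteq> diag E P S"
    unfolding diag_def paths_def by (rule subset_trans[OF _ hull_subset]) blast
  then show ?thesis
    unfolding diag_level_def diag_def by (intro cspan_subset_cstar_subalgebra cstar_subalgebra_hull)
qed

lemma diag_subset_closure: "diag E P S \<subseteq> closure (\<Union>k. D k)"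
  unfolding diag_def
proof (rule hull_minimal)
  show "pproj ` paths E \<subseteq> closure (\<Union>k. D k)"
    by (rule subset_trans[OF _ closure_subset]) (auto simp: paths_def intro: diag_level_path_proj)
  have common: "\<exists>k. x \<in> D k \<and> y \<in> D k" if xy: "x \<in> (\<Union>k. D k)" "y \<in> (\<Union>k. D k)" for x y
  proof -
    obtain k l where "x \<in> D k" "y \<in> D l" using xy by blast
    then show ?thesis
      using diag_level_mono[of k "max k l"] diag_level_mono[of l "max k l"] by (intro exI[of _ "max k l"]) auto
  qed
  show "cstar_subalgebra (closure (\<Union>k. D k))"
  proof (rule cstar_subalgebra_closure)
    show "0 \<in> (\<Union>k. D k)" using diag_level_zero by blast
    show "x + y \<in> (\<Union>k. D k)" "x * y \<in> (\<Union>k. D k)" if xy: "x \<in> (\<Union>k. D k)" "y \<in> (\<Union>k. D k)" for x y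
    proof -
      obtain k where "x \<in> D k" "y \<in> D k" using common[OF xy] by blast
      then have "x + y \<in> D k" "x * y \<in> D k" by (simp_all add: diag_level_add diag_level_mult)
      then show "x + y \<in> (\<Union>k. D k)" "x * y \<in> (\<Union>k. D k)" by auto
    qed
    show "scaleC a x \<in> (\<Union>k. D k)" "star x \<in> (\<Union>k. D k)" if x: "x \<in> (\<Union>k. D k)" for a x
    proof -
      obtain k where "x \<in> D k" using x by blast
      then have "scaleC a x \<in> D k" "star x \<in> D k" by (simp_all add: diag_level_scale diag_level_star)
      then show "scaleC a x \<in> (\<Union>k. D k)" "star x \<in> (\<Union>k. D k)" by auto
    qed
  qed
qed

lemma gauge_aut_path_proj:
  assumes z: "cmod z = 1" and \<mu>: "\<mu> \<in> paths_of_length E k"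
  shows "gauge_aut z (pproj \<mu>) = pproj \<mu>"
  using \<mu>
proof (induction k arbitrary: \<mu>)
  case 0
  then show ?case using gauge_aut_P[OF z] by (auto simp: paths_of_length_0)
next
  case (Suc k)
  have zz: "z * cnj z = 1" using z complex_norm_square[of z] by simp
  obtain e p where \<mu>: "\<mu> = (tail E e, e # p)" "e \<in> arcs E" "(head E e, p) \<in> paths_of_length E k"
    using Suc.prems by (auto simp: paths_of_length_Suc)
  then show ?case
    using Suc.IH[OF \<mu>(3)] zz
    by (simp add: path_proj_Cons gauge_aut_simps[OF z] gauge_aut_S[OF z] star_scaleC mult_scaleC_left
        mult_scaleC_right scaleC_scaleC mult.commute[of "cnj z"])
qed

lemma gauge_aut_diag_level:
  assumes z: "cmod z = 1" and d: "d \<in> D k"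
  shows "gauge_aut z d = d"
  using d
  by (induction rule: diag_level_induct) (simp_all add: gauge_aut_simps[OF z] gauge_aut_path_proj[OF z])

subsection \<open>Linear combinations of path projections\<close>

text \<open>Coordinates on a level of the diagonal: since the path projections of a fixed length are
  orthogonal, algebraic operations become pointwise operations on coefficients.\<close>

definition comb :: "nat \<Rightarrow> ('v \<times> 'e list \<Rightarrow> complex) \<Rightarrow> 'a" where
  "comb k c = (\<Sum>\<mu>\<in>paths_of_length E k. scaleC (c \<mu>) (pproj \<mu>))"

lemma comb_diag_level: "comb k c \<in> D k"
  unfolding comb_def by (intro diag_level_sum diag_level_scale diag_level_path_proj)

lemma comb_add: "comb k c + comb k c' = comb k (\<lambda>\<mu>. c \<mu> + c' \<mu>)"
  by (simp add: comb_def scaleC_add_left sum.distrib)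

lemma comb_diff: "comb k c - comb k c' = comb k (\<lambda>\<mu>. c \<mu> - c' \<mu>)"
  by (simp add: comb_def complex_vs.scale_left_diff_distrib sum_subtractf)

lemma comb_scale: "scaleC a (comb k c) = comb k (\<lambda>\<mu>. a * c \<mu>)"
  by (simp add: comb_def scaleC_sum_right scaleC_scaleC)

lemma comb_star: "star (comb k c) = comb k (\<lambda>\<mu>. cnj (c \<mu>))"
  by (simp add: comb_def star_sum star_scaleC)

lemma comb_mult: "comb k c * comb k c' = comb k (\<lambda>\<mu>. c \<mu> * c' \<mu>)"
proof -
  have "comb k c * comb k c' = (\<Sum>\<mu>\<in>paths_of_length E k. \<Sum>\<nu>\<in>paths_of_length E k.
      if \<mu> = \<nu> then scaleC (c \<mu> * c' \<mu>) (pproj \<mu>) else 0)"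
    unfolding comb_def sum_product
    by (intro sum.cong refl)
      (auto simp: mult_scaleC_left mult_scaleC_right scaleC_scaleC path_proj_mult mult.commute)
  then show ?thesis using finite_paths_of_length by (simp add: comb_def)
qed

lemma diag_level_eq_comb:
  assumes "d \<in> D k"
  obtains c where "d = comb k c"
proof -
  have "\<exists>c. d = comb k c"
    using assms
  proof (induction rule: diag_level_induct)
    case zero
    show ?case by (rule exI[of _ "\<lambda>_. 0"]) (simp add: comb_def)
  next
    case (step a \<mu> y)
    then obtain c where c: "y = comb k c" by blast
    have "scaleC a (pproj \<mu>) = comb k (\<lambda>\<nu>. if \<nu> = \<mu> then a else 0)"
      unfolding comb_def using step(1) finite_paths_of_length
      by (simp add: if_distrib[where f = "\<lambda>c. scaleC c _"] cong: if_cong)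
    then show ?case using c comb_add by metis
  qed
  then show ?thesis using that by blast
qed

lemma norm_comb_unimodular:
  assumes "\<And>\<mu>. cmod (c \<mu>) = 1"
  shows "norm (comb k c) \<le> 1"
proof (rule norm_le_1_if_star_mult_projection)
  have "cnj (c \<mu>) * c \<mu> = 1" for \<mu>
    using assms[of \<mu>] complex_norm_square[of "c \<mu>"] by (simp add: mult.commute)
  then have "star (comb k c) * comb k c = comb k (\<lambda>_. 1)"
    by (simp add: comb_star comb_mult)
  then show "projection (star (comb k c) * comb k c)"
    by (simp add: projection_def comb_star comb_mult)
qed

text \<open>Each coefficient is the mean of two unimodular numbers, so the combination is the mean
  of two contractions.\<close>

lemma norm_comb_le_1:
  assumes "\<And>\<mu>. cmod (c \<mu>) \<le> 1"
  shows "norm (comb k c) \<le> 1"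
proof -
  have "\<forall>\<mu>. \<exists>a b. cmod a = 1 \<and> cmod b = 1 \<and> c \<mu> = (a + b) / 2"
    using complex_unimodular_average[OF assms] by metis
  then obtain a b where ab: "\<And>\<mu>. cmod (a \<mu>) = 1" "\<And>\<mu>. cmod (b \<mu>) = 1" "\<And>\<mu>. c \<mu> = (a \<mu> + b \<mu>) / 2"
    by metis
  have "comb k c = scaleC (1/2) (comb k a + comb k b)"
    unfolding comb_add comb_scale by (intro arg_cong[of _ _ "comb k"] ext) (simp add: ab(3))
  also have "norm \<dots> = norm (comb k a + comb k b) / 2" by (simp add: norm_scaleC)
  finally show ?thesis
    using norm_triangle_ineq[of "comb k a" "comb k b"] norm_comb_unimodular[of a k] norm_comb_unimodular[of b k] ab
    by simp
qed

text \<open>If \<open>d\<close> acts on \<open>x\<close> as an idempotent, then so does the spectral projection \<open>p\<close> of a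
  nearby \<open>d'\<close> for the values outside the disc of radius \<open>1/2\<close>: on the spectrum,
  \<open>p - d' = g (d'\<^sup>2 - d')\<close> with \<open>g\<close> bounded by \<open>2\<close>.\<close>

lemma approximate_idempotent_action:
  assumes d: "d \<in> diag E P S" and idem: "d * d * x = d * x" and \<eta>: "\<eta> > 0"
  obtains k p where "p \<in> D k" "norm p \<le> 1" "norm (p * x - d * x) < \<eta>"
proof -
  \<comment> \<open>The final error is at most
    \<open>\<delta> * ((4 * norm d + 5) * norm x)\<close>; adding 1 to \<open>norm x\<close> keeps
    the denominator positive and makes the estimate strict.\<close>
  define \<delta> where "\<delta> = min 1 (\<eta> / ((4 * norm d + 5) * (norm x + 1)))"
  have pos: "(4 * norm d + 5) * (norm x + 1) > 0"
    by (intro mult_pos_pos add_nonneg_pos) simp_all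
  then have \<delta>: "\<delta> > 0" "\<delta> \<le> 1" "\<delta> * ((4 * norm d + 5) * (norm x + 1)) \<le> \<eta>"
    using \<eta> by (auto simp: \<delta>_def min_def pos_divide_le_eq pos_le_divide_eq)
  obtain d' where d': "d' \<in> (\<Union>k. D k)" "dist d' d < \<delta>"
    using d diag_subset_closure \<delta>(1) closure_approachable[of d "\<Union>k. D k"] by blast
  then obtain k where k: "d' \<in> D k" by auto
  then obtain c where c: "d' = comb k c" by (rule diag_level_eq_comb)
  \<comment> \<open>The quotient of (indicator - c) by (c^2 - c), with the common factor cancelled:
    on either side of the circle of radius 1/2 the remaining denominator has modulus at least
    1/2.\<close>
  define g where "g \<mu> = (if cmod (c \<mu>) \<le> 1/2 then 1 / (1 - c \<mu>) else - 1 / c \<mu>)" for \<mu>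
  define p where "p = comb k (\<lambda>\<mu>. if cmod (c \<mu>) \<le> 1/2 then 0 else 1)"
  have g2: "cmod (g \<mu>) \<le> 2" for \<mu>
  proof (cases "cmod (c \<mu>) \<le> 1/2")
    case True
    have "cmod (1 - c \<mu>) \<ge> 1/2" using True norm_triangle_ineq2[of 1 "c \<mu>"] by simp
    then have "1 / cmod (1 - c \<mu>) \<le> 1 / (1/2)" by (intro divide_left_mono) auto
    then show ?thesis using True by (simp add: g_def norm_divide)
  next
    case False
    then have "1 / cmod (c \<mu>) \<le> 1 / (1/2)" by (intro divide_left_mono) auto
    then show ?thesis using False by (simp add: g_def norm_divide)
  qed
  have ng: "norm (comb k g) \<le> 2"
  proof -
    have "norm (comb k (\<lambda>\<mu>. (1/2) * g \<mu>)) \<le> 1"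
      using g2 by (intro norm_comb_le_1) (simp add: norm_mult)
    then show ?thesis unfolding comb_scale[symmetric] norm_scaleC by simp
  qed
  have "g \<mu> * (c \<mu> * c \<mu> - c \<mu>) = (if cmod (c \<mu>) \<le> 1/2 then 0 else 1) - c \<mu>" for \<mu>
  proof (cases "cmod (c \<mu>) \<le> 1/2")
    case True
    then have "1 - c \<mu> \<noteq> 0" by auto
    then show ?thesis using True by (simp add: g_def field_simps)
  next
    case False
    then have "c \<mu> \<noteq> 0" by auto
    then show ?thesis using False by (simp add: g_def field_simps)
  qed
  then have pd: "p - d' = comb k g * (d' * d' - d')"
    by (simp add: p_def c comb_diff comb_mult)
  have dd: "norm (d' - d) < \<delta>" using d'(2) by (simp add: dist_norm)
  have nd': "norm d' \<le> norm d + 1"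
    using dd \<delta>(2) norm_triangle_ineq2[of d' d] by simp
  have "p * x - d * x = comb k g * ((d' * d' - d') * x) + (d' - d) * x"
    unfolding mult.assoc[symmetric] pd[symmetric] by (simp add: algebra_simps)
  \<comment> \<open>Subtracting (d^2 - d) x = 0 makes every term contain the small factor
    \<open>d' - d\<close>.\<close>
  also have "(d' * d' - d') * x = (d' * (d' - d) + (d' - d) * d - (d' - d)) * x"
    using idem by (simp add: algebra_simps)
  finally have eq: "p * x - d * x
      = comb k g * ((d' * (d' - d) + (d' - d) * d - (d' - d)) * x) + (d' - d) * x" .
  have n1: "norm (d' * (d' - d) + (d' - d) * d - (d' - d)) \<le> (norm d + 1) * \<delta> + \<delta> * norm d + \<delta>"
  proof -
    have "norm (d' * (d' - d)) \<le> (norm d + 1) * \<delta>" "norm ((d' - d) * d) \<le> \<delta> * norm d"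
      using dd nd' \<delta>(1) by (intro order_trans[OF norm_mult_ineq] mult_mono; simp)+
    then show ?thesis
      using dd norm_triangle_ineq4[of "d' * (d' - d) + (d' - d) * d" "d' - d"]
        norm_triangle_ineq[of "d' * (d' - d)" "(d' - d) * d"] by linarith
  qed
  have "norm (p * x - d * x) \<le> 2 * (((norm d + 1) * \<delta> + \<delta> * norm d + \<delta>) * norm x) + \<delta> * norm x"
    unfolding eq using n1 ng dd \<delta>(1)
    by (intro order_trans[OF norm_triangle_ineq] add_mono order_trans[OF norm_mult_ineq] mult_mono) auto
  also have "\<dots> = \<delta> * ((4 * norm d + 5) * norm x)" by (simp add: algebra_simps)
  also have "\<dots> < \<delta> * ((4 * norm d + 5) * (norm x + 1))"
    using \<delta>(1) by (intro mult_strict_left_mono) (simp_all add: add_nonneg_pos)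
  finally have "norm (p * x - d * x) < \<eta>" using \<delta>(3) by simp
  moreover have "norm p \<le> 1" unfolding p_def by (intro norm_comb_le_1) simp
  ultimately show ?thesis using that comb_diag_level p_def by blast
qed

section \<open>Quasi-free automorphisms moving the first level of the diagonal\<close>

lemma core_level1_induct [consumes 1, case_names zero step]:
  assumes "y \<in> core_level1 E S" "Q 0"
    "\<And>c e f y. e \<in> arcs E \<Longrightarrow> f \<in> arcs E \<Longrightarrow> Q y \<Longrightarrow> Q (scaleC c (S e * star (S f)) + y)"
  shows "Q y"
  using assms(1) unfolding core_level1_def
  by (induction rule: complex_vs.span_induct_alt) (use assms(2,3) in auto)

text \<open>In \<open>S e * star (S f)\<close> the shift is removed by the adjoint factor and
  restored by the other one.\<close>

lemma core_level1_commute_\<phi>: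
  assumes y: "y \<in> core_level1 E S" and a: "a \<in> C"
  shows "y * \<phi> a = \<phi> a * y"
  using y
proof (induction rule: core_level1_induct)
  case (step c e f y)
  have "S e * star (S f) * \<phi> a = \<phi> a * (S e * star (S f))"
    using star_S_\<phi>[OF a step(2)] \<phi>_S[OF a step(1)] by (simp add: mult.assoc) (simp flip: mult.assoc)
  then show ?case using step
    by (simp add: distrib_left distrib_right mult_scaleC_left mult_scaleC_right)
qed simp

text \<open>The scalar is a matrix entry of \<open>y\<close> in the matrix units of the first level.
  Entries between edges with different ranges vanish because their vertex projections are
  orthogonal.\<close>

lemma core_level1_coefficient:
  assumes y: "y \<in> core_level1 E S" and e: "e \<in> arcs E" and g: "g \<in> arcs E"
  obtains c where "star (S e) * y * S g = scaleC c (P (head E e))" "c \<noteq> 0 \<Longrightarrow> head E e = head E g"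
proof -
  have "\<exists>c. star (S e) * y * S g = scaleC c (P (head E e)) \<and> (c \<noteq> 0 \<longrightarrow> head E e = head E g)"
    using y
  proof (induction rule: core_level1_induct)
    case zero
    show ?case by (rule exI[of _ 0]) simp
  next
    case (step a f h y)
    then obtain c where c: "star (S e) * y * S g = scaleC c (P (head E e))"
      "c \<noteq> 0 \<longrightarrow> head E e = head E g" by blast
    have "star (S e) * (S f * star (S h)) * S g = (star (S e) * S f) * (star (S h) * S g)"
      by (simp add: mult.assoc)
    also have "\<dots> = (if e = f \<and> h = g \<and> head E e = head E g then P (head E e) else 0)"
      using step e g wf by (auto simp: S_star_S_if P_mult)
    also have "\<dots> = scaleC (if e = f \<and> h = g \<and> head E e = head E g then 1 else 0) (P (head E e))"
    proof -
      have "(if Q then x else 0) = scaleC (if Q then 1 else 0) x" for Q and x :: 'a by simp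
      then show ?thesis .
    qed
    finally have "star (S e) * (scaleC a (S f * star (S h)) + y) * S g
        = scaleC (a * (if e = f \<and> h = g \<and> head E e = head E g then 1 else 0) + c) (P (head E e))"
      using c(1)
      by (simp only: distrib_left distrib_right mult_scaleC_left mult_scaleC_right scaleC_add_left scaleC_scaleC)
    moreover have "a * (if e = f \<and> h = g \<and> head E e = head E g then 1 else 0) + c \<noteq> 0 \<longrightarrow>
        head E e = head E g"
      using c(2) by (cases "head E e = head E g") simp_all
    ultimately show ?case by blast
  qed
  then show ?thesis using that by blast
qed

lemma frakB_C: "u \<in> frakB E P S \<Longrightarrow> u \<in> C"
  using diag_level_P by (auto simp: frakB_def C_def)

lemma frakB_core: "u \<in> frakB E P S \<Longrightarrow> u \<in> core_level1 E S"
  by (simp add: frakB_def)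

text \<open>The scalar is the product of an entry of \<open>u\<close> in column \<open>g\<close>
  with the conjugate of another one. A non-zero product forces both edges to share the source of
  \<open>g\<close>, as \<open>u\<close> commutes with vertex projections, and its range, by the
  preceding lemma.\<close>

lemma frakB_compress:
  assumes u: "u \<in> frakB E P S" and e: "e \<in> arcs E" and f: "f \<in> arcs E" and g: "g \<in> arcs E"
  obtains c where "S e * star (S e) * (u * (S g * star (S g)) * star u) * (S f * star (S f)) = scaleC c (S e * star (S f))"
    "c \<noteq> 0 \<Longrightarrow> tail E e = tail E f \<and> head E e = head E f"
proof -
  obtain a where a: "star (S e) * u * S g = scaleC a (P (head E e))" "a \<noteq> 0 \<Longrightarrow> head E e = head E g"
    using core_level1_coefficient[OF frakB_core[OF u] e g] by blast
  obtain b where b: "star (S f) * u * S g = scaleC b (P (head E f))" "b \<noteq> 0 \<Longrightarrow> head E f = head E g"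
    using core_level1_coefficient[OF frakB_core[OF u] f g] by blast
  have tails: "star (S h) * u * S g = 0" if h: "h \<in> arcs E" "tail E h \<noteq> tail E g" for h
  proof -
    have "star (S h) * u * S g = star (S h) * P (tail E h) * u * S g" using h by simp
    also have "\<dots> = star (S h) * (P (tail E h) * u) * S g" by (simp add: mult.assoc)
    also have "\<dots> = star (S h) * u * (P (tail E h) * S g)"
    proof -
      have "u * P (tail E h) = P (tail E h) * u" using frakB_C[OF u] wf(1)[OF h(1)] by (simp add: C_def)
      then show ?thesis by (metis mult.assoc)
    qed
    finally show ?thesis using h g wf by (simp add: P_S_if)
  qed
  define c where "c = (if tail E e = tail E g \<and> tail E f = tail E g \<and> head E e = head E f
    then a * cnj b else 0)"
  have "S e * star (S e) * (u * (S g * star (S g)) * star u) * (S f * star (S f))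
      = S e * (star (S e) * u * S g) * star (star (S f) * u * S g) * star (S f)"
    by (simp add: star_mult star_star mult.assoc)
  also have "\<dots> = scaleC c (S e * star (S f))"
  proof (cases "tail E e = tail E g \<and> tail E f = tail E g")
    case False
    then show ?thesis using tails[OF e] tails[OF f] by (auto simp: c_def)
  next
    case True
    show ?thesis
    proof (cases "head E e = head E f")
      case he: True
      have "S e * P (head E f) * P (head E f) = S e" using he e S_P by metis
      then show ?thesis using True he wf f unfolding a(1) b(1)
        by (simp add: c_def star_scaleC mult_scaleC_left mult_scaleC_right scaleC_scaleC mult.commute)
    next
      case False
      have "a = 0 \<or> b = 0"
      proof (rule ccontr)
        assume "\<not> ?thesis"
        then show False using a(2) b(2) False by simp
      qed
      then show ?thesis using False unfolding a(1) b(1) by (auto simp: c_def)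
    qed
  qed
  finally show ?thesis
  proof (rule that)
    show "tail E e = tail E f \<and> head E e = head E f" if "c \<noteq> 0"
      using that unfolding c_def by (metis (full_types))
  qed
qed

lemma diag_level_1: "D 1 = cspan ((\<lambda>e. S e * star (S e)) ` arcs E)"
proof -
  have "paths_of_length E 1 = (\<lambda>e. (tail E e, [e])) ` arcs E"
    using wf by (auto simp: paths_of_length_Suc paths_of_length_0)
  then have "pproj ` paths_of_length E 1 = (\<lambda>e. S e * star (S e)) ` arcs E"
    by (simp add: image_image path_proj_def)
  then show ?thesis by (simp add: diag_level_def)
qed

text \<open>If there were no such entry, conjugation by \<open>u\<close> would map the first level
  into itself, and a dimension count would turn this inclusion into equality. Non-zero vertex
  projections make the edge projections independent.\<close>

lemma ex_mixing:
  assumes u: "u \<in> frakB E P S" "unitary u" and nz: "\<And>v. v \<in> verts E \<Longrightarrow> P v \<noteq> 0"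
    and moved: "(\<lambda>d. u * d * star u) ` D 1 \<noteq> D 1"
  obtains e f g c where "e \<in> arcs E" "f \<in> arcs E" "g \<in> arcs E" "e \<noteq> f" "tail E e = tail E f"
    "head E e = head E f" "c \<noteq> 0"
    "S e * star (S e) * (u * (S g * star (S g)) * star u) * (S f * star (S f)) = scaleC c (S e * star (S f))"
proof (rule ccontr)
  assume no: "\<not> thesis"
  note mixing = that
  define q where "q e = S e * star (S e)" for e
  define r where "r e = u * q e * star u" for e
  have u': "star u * u = unit_elem" "u * star u = unit_elem" using u(2) by (auto simp: unitary_iff)
  have q: "q e * q f = (if e = f then q e else 0)" if "e \<in> arcs E" "f \<in> arcs E" for e f
  proof -
    have "q e * q f = S e * (star (S e) * S f) * star (S f)" by (simp add: q_def mult.assoc)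
    then show ?thesis using that by (simp add: S_star_S_if q_def)
  qed
  have r: "r e * r f = (if e = f then r e else 0)" if "e \<in> arcs E" "f \<in> arcs E" for e f
  proof -
    have "r e * r f = u * q e * (star u * u) * q f * star u" by (simp add: r_def mult.assoc)
    also have "\<dots> = u * (q e * q f) * star u" by (simp add: u' mult.assoc)
    finally show ?thesis using that by (simp add: q r_def)
  qed
  have q0: "q e \<noteq> 0" if "e \<in> arcs E" for e
  proof
    assume "q e = 0"
    then have "star (S e) * q e * S e = 0" by simp
    moreover have "star (S e) * q e * S e = (star (S e) * S e) * (star (S e) * S e)"
      by (simp add: q_def mult.assoc)
    ultimately show False using that nz wf S_star_S by auto
  qed
  have r0: "r e \<noteq> 0" if "e \<in> arcs E" for e
  proof
    assume "r e = 0"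
    then have "star u * r e * u = 0" by simp
    moreover have "star u * r e * u = (star u * u) * q e * (star u * u)" by (simp add: r_def mult.assoc)
    ultimately show False using q0[OF that] u' by simp
  qed
  have r_in: "r g \<in> cspan (q ` arcs E)" if g: "g \<in> arcs E" for g
  proof -
    have z: "q e * r g * q f \<in> cspan (q ` arcs E)" if ef: "e \<in> arcs E" "f \<in> arcs E" for e f
    proof -
      obtain c where c: "S e * star (S e) * (u * (S g * star (S g)) * star u) * (S f * star (S f)) = scaleC c (S e * star (S f))"
        "c \<noteq> 0 \<Longrightarrow> tail E e = tail E f \<and> head E e = head E f"
        using frakB_compress[OF u(1) ef g] by blast
      show ?thesis
      proof (cases "e = f")
        case True
        then show ?thesis using c(1) ef
          by (simp add: q_def r_def complex_vs.span_scale complex_vs.span_base)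
      next
        case False
        then have "c = 0" using no mixing[OF ef g] c by blast
        then show ?thesis using c(1) by (simp add: q_def r_def complex_vs.span_zero)
      qed
    qed
    have "r g = unit_elem * r g * unit_elem" by simp
    also have "\<dots> = (\<Sum>e\<in>arcs E. \<Sum>f\<in>arcs E. q e * r g * q f)"
      unfolding unit_elem_eq_sum_S q_def[symmetric] by (simp add: sum_distrib_left sum_distrib_right) (rule sum.swap)
    also have "\<dots> \<in> cspan (q ` arcs E)" by (intro complex_vs.span_sum z)
    finally show ?thesis .
  qed
  have ind: "inj_on q (arcs E)" "inj_on r (arcs E)" "complex_vs.independent (r ` arcs E)"
    using orthogonal_idempotents_independent[of "arcs E" q] orthogonal_idempotents_independent[of "arcs E" r]
      fin q r q0 r0 by auto
  \<comment> \<open>A \<open>q e\<close> outside the span would give one more independent element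
    than there are edges, all inside the span of the edge projections.\<close>
  have "q ` arcs E \<subseteq> cspan (r ` arcs E)"
  proof (rule ccontr)
    assume "\<not> ?thesis"
    then obtain e where e: "e \<in> arcs E" "q e \<notin> cspan (r ` arcs E)" by auto
    then have "complex_vs.independent (insert (q e) (r ` arcs E))"
      using ind(3) by (simp add: complex_vs.independent_insert)
    moreover have "insert (q e) (r ` arcs E) \<subseteq> cspan (q ` arcs E)"
      using r_in e by (auto intro: complex_vs.span_base)
    ultimately have "card (insert (q e) (r ` arcs E)) \<le> card (q ` arcs E)"
      using complex_vs.independent_span_bound[of "q ` arcs E"] fin by blast
    moreover have "q e \<notin> r ` arcs E" using e(2) by (auto intro: complex_vs.span_base)
    ultimately show False using fin ind(1,2) by (simp add: card_image)
  qed
  then have "cspan (q ` arcs E) = cspan (r ` arcs E)"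
    using r_in by (metis complex_vs.span_eq image_subset_iff)
  moreover have "(\<lambda>d. u * d * star u) ` cspan (q ` arcs E) = cspan (r ` arcs E)"
  proof -
    interpret lin: module_hom scaleC scaleC "\<lambda>d. u * d * star u"
      by unfold_locales (simp_all add: distrib_left distrib_right mult_scaleC_left mult_scaleC_right
          scaleC_add_right scaleC_add_left scaleC_scaleC)
    show ?thesis
      using lin.span_image[of "q ` arcs E"] unfolding cspan_def by (simp add: image_image r_def[abs_def])
  qed
  ultimately show False using moved unfolding diag_level_1 q_def[symmetric] by simp
qed


section \<open>Homogeneous elements\<close>

text \<open>Elements such as \<open>S\<^sub>\<alpha> S\<^sub>\<beta>\<^sup>*\<close> with paths of length \<open>i\<close> and \<open>j\<close>.\<close>

definition H :: "nat \<Rightarrow> nat \<Rightarrow> 'a set" where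
  "H i j = {y. (\<forall>z. cmod z = 1 \<longrightarrow> gauge_aut z y = scaleC (z ^ i * cnj z ^ j) y) \<and>
    (\<forall>a\<in>C. \<forall>m. y * \<phi>n (m + j) a = \<phi>n (m + i) a * y)}"

lemma H_gauge: "y \<in> H i j \<Longrightarrow> cmod z = 1 \<Longrightarrow> gauge_aut z y = scaleC (z ^ i * cnj z ^ j) y"
  and H_shift: "y \<in> H i j \<Longrightarrow> a \<in> C \<Longrightarrow> y * \<phi>n (m + j) a = \<phi>n (m + i) a * y"
  by (auto simp: H_def)

lemma H_zero: "0 \<in> H i j"
  by (simp add: H_def gauge_aut_simps)

lemma H_add: "x \<in> H i j \<Longrightarrow> y \<in> H i j \<Longrightarrow> x + y \<in> H i j"
  by (simp add: H_def gauge_aut_simps scaleC_add_right distrib_left distrib_right)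

lemma H_scale: "x \<in> H i j \<Longrightarrow> scaleC c x \<in> H i j"
  by (simp add: H_def gauge_aut_simps scaleC_scaleC mult_scaleC_left mult_scaleC_right mult.commute)

lemma H_mult:
  assumes x: "x \<in> H i j" and y: "y \<in> H k l"
  shows "x * y \<in> H (i + k) (j + l)"
  unfolding H_def
proof (intro CollectI conjI allI impI ballI)
  fix z :: complex assume "cmod z = 1"
  then show "gauge_aut z (x * y) = scaleC (z ^ (i + k) * cnj z ^ (j + l)) (x * y)"
    using H_gauge[OF x] H_gauge[OF y]
    by (simp add: gauge_aut_simps mult_scaleC_left mult_scaleC_right scaleC_scaleC power_add mult_ac)
next
  fix a m assume a: "a \<in> C"
  have "x * y * \<phi>n (m + (j + l)) a = x * (y * \<phi>n ((m + j) + l) a)"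
    by (simp add: mult.assoc add.assoc)
  also have "\<dots> = x * \<phi>n ((m + k) + j) a * y"
    unfolding H_shift[OF y a] by (simp add: mult.assoc add_ac)
  also have "\<dots> = \<phi>n (m + (i + k)) a * (x * y)"
    unfolding H_shift[OF x a] by (simp add: mult.assoc add_ac)
  finally show "x * y * \<phi>n (m + (j + l)) a = \<phi>n (m + (i + k)) a * (x * y)" .
qed

lemma H_star:
  assumes y: "y \<in> H i j"
  shows "star y \<in> H j i"
  unfolding H_def
proof (intro CollectI conjI allI impI ballI)
  fix z :: complex assume "cmod z = 1"
  then show "gauge_aut z (star y) = scaleC (z ^ j * cnj z ^ i) (star y)"
    using H_gauge[OF y] by (simp add: gauge_aut_simps star_scaleC mult.commute)
next
  fix a m assume a: "a \<in> C"
  show "star y * \<phi>n (m + i) a = \<phi>n (m + j) a * star y"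
    using arg_cong[OF H_shift[OF y C_star[OF a], of m], of star]
    by (simp add: star_mult \<phi>n_star star_star)
qed

text \<open>Only the difference of the indices matters, since z times its conjugate is 1. Raising
  both allows several elements to share the same second index.\<close>

lemma H_Suc:
  assumes y: "y \<in> H i j"
  shows "y \<in> H (Suc i) (Suc j)"
  unfolding H_def
proof (intro CollectI conjI allI impI ballI)
  fix z :: complex assume z: "cmod z = 1"
  have "z ^ Suc i * cnj z ^ Suc j = (z * cnj z) * (z ^ i * cnj z ^ j)" by simp
  also have "z * cnj z = 1" using z complex_norm_square[of z] by simp
  finally show "gauge_aut z y = scaleC (z ^ Suc i * cnj z ^ Suc j) y" using H_gauge[OF y z] by simp
next
  fix a m assume a: "a \<in> C"
  show "y * \<phi>n (m + Suc j) a = \<phi>n (m + Suc i) a * y"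
    using H_shift[OF y a, of "Suc m"] by simp
qed

lemma H_P: "v \<in> verts E \<Longrightarrow> P v \<in> H 0 0"
proof -
  assume v: "v \<in> verts E"
  have "P v * \<phi>n m a = \<phi>n m a * P v" if "a \<in> C" for a m
    using \<phi>n_C[OF that, of m] v by (simp add: C_def)
  then show ?thesis using v by (simp add: H_def gauge_aut_P)
qed

lemma H_S: "e \<in> arcs E \<Longrightarrow> S e \<in> H 1 0"
  by (simp add: H_def gauge_aut_S \<phi>n_Suc \<phi>_S \<phi>n_C)

text \<open>Products and adjoints of homogeneous elements are homogeneous, so their span is a
  *-algebra, and it contains the generators.\<close>

lemma homogeneous_dense: "closure (cspan (\<Union>i j. H i j)) = UNIV"
proof -
  let ?X = "\<Union>i j. H i j"
  have "cstar_subalgebra (closure (cspan ?X))"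
  proof (rule cstar_subalgebra_closure)
    show "x * y \<in> cspan ?X" if "x \<in> cspan ?X" "y \<in> cspan ?X" for x y
      using _ that
    proof (rule cspan_mult_closed)
      fix x y assume "x \<in> ?X" "y \<in> ?X"
      then obtain i j k l where "x \<in> H i j" "y \<in> H k l" by blast
      then have "x * y \<in> H (i + k) (j + l)" by (rule H_mult)
      then show "x * y \<in> cspan ?X" by (intro complex_vs.span_base) blast
    qed
    show "star x \<in> cspan ?X" if "x \<in> cspan ?X" for x
      using _ that
    proof (rule cspan_star_closed)
      fix x assume "x \<in> ?X"
      then obtain i j where "x \<in> H i j" by blast
      then have "star x \<in> H j i" by (rule H_star)
      then show "star x \<in> cspan ?X" by (intro complex_vs.span_base) blast
    qed
  qed (simp_all add: complex_vs.span_zero complex_vs.span_add complex_vs.span_scale)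
  moreover have "P ` verts E \<union> S ` arcs E \<subseteq> closure (cspan ?X)"
  proof -
    have "P ` verts E \<union> S ` arcs E \<subseteq> ?X" using H_P H_S by blast
    also have "\<dots> \<subseteq> cspan ?X" by (rule complex_vs.span_superset)
    also have "\<dots> \<subseteq> closure (cspan ?X)" by (rule closure_subset)
    finally show ?thesis .
  qed
  ultimately have "UNIV \<subseteq> closure (cspan ?X)" unfolding generate[symmetric] by (rule hull_minimal[rotated])
  then show ?thesis by auto
qed

section \<open>Finite sums of homogeneous elements\<close>

text \<open>The component \<open>Y i\<close> has degree i - N; the shift by a common N keeps the
  indices of negative degrees natural.\<close>

definition decomposition :: "nat \<Rightarrow> nat \<Rightarrow> (nat \<Rightarrow> 'a) \<Rightarrow> 'a \<Rightarrow> bool" where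
  "decomposition N M Y y \<longleftrightarrow> (\<forall>i. Y i \<in> H i N) \<and> (\<forall>i\<ge>M. Y i = 0) \<and> y = (\<Sum>i<M. Y i)"

lemma decomposition_raise:
  assumes "decomposition N M Y y" "N \<le> N'"
  shows "\<exists>M Y. decomposition N' M Y y"
  using assms(2)
proof (induction rule: dec_induct)
  case base
  then show ?case using assms(1) by blast
next
  case (step n)
  then obtain M Y where *: "decomposition n M Y y" by blast
  define Y' where "Y' i = (case i of 0 \<Rightarrow> 0 | Suc l \<Rightarrow> Y l)" for i
  have "decomposition (Suc n) (Suc M) Y' y"
    unfolding decomposition_def
  proof (intro conjI allI impI)
    show "Y' i \<in> H i (Suc n)" for i
      using * by (cases i) (auto simp: Y'_def decomposition_def H_zero intro: H_Suc)
    show "Y' i = 0" if "Suc M \<le> i" for i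
      using that * by (cases i) (auto simp: Y'_def decomposition_def)
    show "y = (\<Sum>i<Suc M. Y' i)"
      using * by (subst sum.lessThan_Suc_shift) (simp add: Y'_def decomposition_def)
  qed
  then show ?case by blast
qed

lemma decomposition_weaken:
  assumes "decomposition N M Y y" "M \<le> M'"
  shows "decomposition N M' Y y"
proof -
  have "(\<Sum>i<M'. Y i) = (\<Sum>i<M. Y i)"
    using assms by (intro sum.mono_neutral_right) (auto simp: decomposition_def)
  then show ?thesis using assms by (auto simp: decomposition_def)
qed

lemma ex_decomposition:
  assumes "y \<in> cspan (\<Union>i j. H i j)"
  obtains N M Y where "decomposition N M Y y"
proof -
  have "\<exists>N M Y. decomposition N M Y y"
    using assms
  proof (induction rule: complex_vs.span_induct_alt)
    case base
    have "decomposition 0 0 (\<lambda>_. 0) 0" by (simp add: decomposition_def H_zero)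
    then show ?case by blast
  next
    case (step c x y)
    then obtain i j where x: "x \<in> H i j" by blast
    have "decomposition j (Suc i) (\<lambda>k. if k = i then scaleC c x else 0) (scaleC c x)"
      using x by (simp add: decomposition_def H_zero H_scale)
    moreover obtain N M Y where "decomposition N M Y y" using step by blast
    ultimately obtain M1 Y1 M2 Y2 where
      1: "decomposition (max j N) M1 Y1 (scaleC c x)" and 2: "decomposition (max j N) M2 Y2 y"
      using decomposition_raise[of _ _ _ _ "max j N"] by (meson max.cobounded1 max.cobounded2)
    have "decomposition (max j N) (max M1 M2) (\<lambda>i. Y1 i + Y2 i) (scaleC c x + y)"
      using decomposition_weaken[OF 1, of "max M1 M2"] decomposition_weaken[OF 2, of "max M1 M2"]
      by (simp add: decomposition_def H_add sum.distrib)
    then show ?case by blast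
  qed
  then show ?thesis using that by blast
qed

lemma approximate_by_decomposition:
  assumes "\<epsilon> > 0"
  obtains N M Y y where "decomposition N M Y y" "norm (x - y) < \<epsilon>"
proof -
  have "x \<in> closure (cspan (\<Union>i j. H i j))" by (simp add: homogeneous_dense)
  then obtain y where y: "y \<in> cspan (\<Union>i j. H i j)" "dist y x < \<epsilon>"
    using assms unfolding closure_approachable by blast
  obtain N M Y where "decomposition N M Y y" using ex_decomposition[OF y(1)] .
  then show ?thesis using that y(2) by (simp add: dist_norm norm_minus_commute)
qed

subsection \<open>Discrete Fourier coefficients and Fejer means\<close>

text \<open>A discrete Fourier coefficient: it selects the component of degree b - a, provided K is
  large enough to prevent aliasing.\<close>

definition coef :: "nat \<Rightarrow> nat \<Rightarrow> nat \<Rightarrow> 'a \<Rightarrow> 'a" where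
  "coef a b K y = (1 / real K) *\<^sub>R
    (\<Sum>j<K. scaleC (unity_root K j ^ a * cnj (unity_root K j) ^ b) (gauge_aut (unity_root K j) y))"

lemma coef_diff: "coef a b K (x - y) = coef a b K x - coef a b K y"
  by (simp add: coef_def gauge_aut_simps scaleC_diff_right sum_subtractf scaleR_diff_right)

lemma coef_mult_left:
  assumes "\<And>z. cmod z = 1 \<Longrightarrow> gauge_aut z d = d"
  shows "coef a b K (d * y) = d * coef a b K y"
  using assms by (simp add: coef_def gauge_aut_simps sum_distrib_left mult_scaleC_right)

lemma coef_mult_right:
  assumes "\<And>z. cmod z = 1 \<Longrightarrow> gauge_aut z d = d"
  shows "coef a b K (y * d) = coef a b K y * d"
  using assms by (simp add: coef_def gauge_aut_simps sum_distrib_right mult_scaleC_left)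

lemma norm_coef_le: "norm (coef a b K y) \<le> norm y"
proof (cases "K = 0")
  case True
  then show ?thesis by (simp add: coef_def)
next
  case False
  have "norm (\<Sum>j<K. scaleC (unity_root K j ^ a * cnj (unity_root K j) ^ b) (gauge_aut (unity_root K j) y))
      \<le> real (card {..<K}) * norm y"
    by (rule sum_norm_bound) (simp add: norm_scaleC norm_mult norm_power gauge_aut_simps)
  then show ?thesis using False by (simp add: coef_def divide_le_eq mult.commute)
qed

lemma coef_decomposition:
  assumes Y: "decomposition N M Y y" and K: "K > a + b + N + M"
  shows "coef a b K y = (if a \<le> b + N then Y (b + N - a) else 0)"
proof -
  have K0: "real K \<noteq> 0" using K by simp
  have g: "gauge_aut (unity_root K j) y = (\<Sum>i<M. scaleC (unity_root K j ^ i * cnj (unity_root K j) ^ N) (Y i))" for j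
  proof -
    have "gauge_aut (unity_root K j) y = (\<Sum>i<M. gauge_aut (unity_root K j) (Y i))"
      using Y by (simp add: decomposition_def gauge_aut_sum)
    moreover have "gauge_aut (unity_root K j) (Y i) = scaleC (unity_root K j ^ i * cnj (unity_root K j) ^ N) (Y i)" for i
      using Y by (intro H_gauge) (auto simp: decomposition_def)
    ultimately show ?thesis by simp
  qed
  have "(\<Sum>j<K. scaleC (unity_root K j ^ a * cnj (unity_root K j) ^ b) (gauge_aut (unity_root K j) y))
      = (\<Sum>i<M. \<Sum>j<K. scaleC (unity_root K j ^ (a + i) * cnj (unity_root K j) ^ (b + N)) (Y i))"
    unfolding g scaleC_sum_right by (subst sum.swap) (simp add: scaleC_scaleC power_add mult_ac)
  also have "\<dots> = (\<Sum>i<M. if a + i = b + N then real K *\<^sub>R Y i else 0)"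
    by (intro sum.cong refl, subst sum_unity_root_scaleC) (use K in auto)
  also have "\<dots> = real K *\<^sub>R (if a \<le> b + N then Y (b + N - a) else 0)"
  proof (cases "a \<le> b + N")
    case True
    then have "a + i = b + N \<longleftrightarrow> b + N - a = i" for i by auto
    moreover have "Y (b + N - a) = 0" if "\<not> b + N - a < M" using that Y by (simp add: decomposition_def)
    ultimately show ?thesis using True by auto
  qed simp
  finally show ?thesis using K0 by (simp add: coef_def)
qed

text \<open>The degree b - a = d occurs for L - |d| pairs, so for large K this is the Fejer mean
  with weights 1 - |d|/L.\<close>

definition fejer :: "nat \<Rightarrow> nat \<Rightarrow> 'a \<Rightarrow> 'a" where
  "fejer L K y = (1 / real L) *\<^sub>R (\<Sum>a<L. \<Sum>b<L. coef a b K y)"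

lemma fejer_diff: "fejer L K (x - y) = fejer L K x - fejer L K y"
  by (simp add: fejer_def coef_diff sum_subtractf scaleR_diff_right)

text \<open>The discrete Fejer kernel is the squared modulus of a sum of L powers, hence
  non-negative, and L at most K makes these powers orthogonal. By Parseval the normalised weights
  sum to 1, so the mean is a convex combination of contractive images of \<open>y\<close>.\<close>

lemma norm_fejer_le:
  assumes "L \<le> K" "L > 0"
  shows "norm (fejer L K y) \<le> norm y"
proof -
  define s where "s j = (\<Sum>a<L. unity_root K j ^ a)" for j
  have s: "(\<Sum>a<L. \<Sum>b<L. unity_root K j ^ a * cnj (unity_root K j) ^ b) = complex_of_real ((cmod (s j))\<^sup>2)" for j
    unfolding complex_norm_square s_def by (simp add: sum_product)
  have "complex_of_real (\<Sum>j<K. (cmod (s j))\<^sup>2)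
      = (\<Sum>a<L. \<Sum>b<L. \<Sum>j<K. unity_root K j ^ a * cnj (unity_root K j) ^ b)"
  proof -
    have "complex_of_real (\<Sum>j<K. (cmod (s j))\<^sup>2)
      = (\<Sum>j<K. \<Sum>a<L. \<Sum>b<L. unity_root K j ^ a * cnj (unity_root K j) ^ b)"
      unfolding s by simp
    also have "\<dots> = (\<Sum>a<L. \<Sum>j<K. \<Sum>b<L. unity_root K j ^ a * cnj (unity_root K j) ^ b)"
      by (rule sum.swap)
    also have "\<dots> = (\<Sum>a<L. \<Sum>b<L. \<Sum>j<K. unity_root K j ^ a * cnj (unity_root K j) ^ b)"
      by (intro sum.cong refl sum.swap)
    finally show ?thesis .
  qed
  also have "\<dots> = (\<Sum>a<L. \<Sum>b<L. if a = b then of_nat K else 0)"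
    using assms by (intro sum.cong refl sum_unity_root) auto
  also have "\<dots> = complex_of_real (real L * real K)" by simp
  finally have parseval: "(\<Sum>j<K. (cmod (s j))\<^sup>2) = real L * real K" using of_real_eq_iff by blast
  have "(\<Sum>a<L. \<Sum>b<L. coef a b K y) = (1 / real K) *\<^sub>R
      (\<Sum>a<L. \<Sum>b<L. \<Sum>j<K. scaleC (unity_root K j ^ a * cnj (unity_root K j) ^ b) (gauge_aut (unity_root K j) y))"
    by (simp add: coef_def scaleR_sum_right)
  also have "(\<Sum>a<L. \<Sum>b<L. \<Sum>j<K. scaleC (unity_root K j ^ a * cnj (unity_root K j) ^ b) (gauge_aut (unity_root K j) y))
      = (\<Sum>j<K. (cmod (s j))\<^sup>2 *\<^sub>R gauge_aut (unity_root K j) y)"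
  proof -
    let ?f = "\<lambda>a b j. scaleC (unity_root K j ^ a * cnj (unity_root K j) ^ b) (gauge_aut (unity_root K j) y)"
    have "(\<Sum>a<L. \<Sum>b<L. \<Sum>j<K. ?f a b j) = (\<Sum>a<L. \<Sum>j<K. \<Sum>b<L. ?f a b j)"
      by (intro sum.cong refl sum.swap)
    also have "\<dots> = (\<Sum>j<K. \<Sum>a<L. \<Sum>b<L. ?f a b j)" by (rule sum.swap)
    also have "\<dots> = (\<Sum>j<K. (cmod (s j))\<^sup>2 *\<^sub>R gauge_aut (unity_root K j) y)"
      by (simp only: scaleC_sum_left[symmetric] s scaleR_eq_scaleC)
    finally show ?thesis .
  qed
  finally have "fejer L K y = (1 / (real L * real K)) *\<^sub>R (\<Sum>j<K. (cmod (s j))\<^sup>2 *\<^sub>R gauge_aut (unity_root K j) y)"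
    by (simp add: fejer_def)
  also have "norm \<dots> \<le> (1 / (real L * real K)) * (\<Sum>j<K. (cmod (s j))\<^sup>2 * norm y)"
    unfolding norm_scaleR
    by (intro mult_mono sum_norm_le) (auto simp: gauge_aut_simps mult_left_mono sum_nonneg)
  also have "\<dots> = norm y" using assms by (simp add: sum_distrib_right[symmetric] parseval)
  finally show ?thesis .
qed

text \<open>A crude count of L^2 coefficients divided by L. The factor L does no harm later, where
  the bound on the coefficients is chosen after L.\<close>

lemma norm_fejer_le_coefficients:
  assumes Y: "decomposition N M Y y" and K: "K > 2 * L + N + M" and \<beta>: "\<And>i. norm (Y i) \<le> \<beta>"
  shows "norm (fejer L K y) \<le> real L * \<beta>"
proof -
  have \<beta>0: "0 \<le> \<beta>" using \<beta>[of 0] norm_ge_zero order_trans by blast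
  have c: "norm (coef a b K y) \<le> \<beta>" if "a < L" "b < L" for a b
    using that K \<beta> \<beta>0 by (subst coef_decomposition[OF Y]) auto
  have "norm (\<Sum>b<L. coef a b K y) \<le> real L * \<beta>" if "a < L" for a
    using sum_norm_bound[of "{..<L}" "\<lambda>b. coef a b K y" \<beta>] c[OF that] by simp
  then have "norm (\<Sum>a<L. \<Sum>b<L. coef a b K y) \<le> real L * (real L * \<beta>)"
    using sum_norm_bound[of "{..<L}" "\<lambda>a. \<Sum>b<L. coef a b K y" "real L * \<beta>"] by simp
  then show ?thesis using \<beta>0 by (cases "L = 0") (simp_all add: fejer_def divide_le_eq mult_ac)
qed

lemma norm_fejer_diff_le:
  assumes Y: "decomposition N M Y y" and K: "K > 2 * L + N + M" and L: "L > 0"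
  shows "norm (fejer L K y - y) \<le> real (N + M) * (\<Sum>i<M. norm (Y i)) / real L"
proof -
  \<comment> \<open>The rows a whose partner b = a + i - N falls outside the range 0..L-1. They lie
    among the first N or the last M rows, which bounds the missing weight of
    \<open>Y i\<close>.\<close>
  define bad where "bad i = {a. a < L \<and> \<not> (N \<le> a + i \<and> a + i < L + N)}" for i
  have bad: "card (bad i) \<le> N + M" if "i < M" for i
  proof -
    have "bad i \<subseteq> {..<N} \<union> {L - M..<L}" using that by (auto simp: bad_def)
    then have "card (bad i) \<le> card ({..<N} \<union> {L - M..<L})" by (intro card_mono) auto
    also have "\<dots> \<le> card {..<N} + card {L - M..<L}" by (rule card_Un_le)
    finally show ?thesis by simp
  qed
  have c: "coef a b K y = (\<Sum>i<M. if b + N = a + i then Y i else 0)" if "a < L" "b < L" for a b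
  proof -
    have "coef a b K y = (if a \<le> b + N then Y (b + N - a) else 0)"
      using that K by (intro coef_decomposition[OF Y]) auto
    also have "\<dots> = (\<Sum>i<M. if b + N = a + i then Y i else 0)"
    proof (cases "a \<le> b + N")
      case True
      then have "b + N = a + i \<longleftrightarrow> b + N - a = i" for i by auto
      moreover have "Y (b + N - a) = 0" if "\<not> b + N - a < M" using that Y by (simp add: decomposition_def)
      ultimately show ?thesis using True by auto
    qed simp
    finally show ?thesis .
  qed
  have row: "(\<Sum>b<L. \<Sum>i<M. if b + N = a + i then Y i else 0)
      = (\<Sum>i<M. if a \<in> bad i then 0 else Y i)" if "a < L" for a
  proof -
    have "(\<Sum>b<L. if b + N = a + i then Y i else 0) = (if a \<in> bad i then 0 else Y i)" for i
    proof (cases "N \<le> a + i")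
      case True
      then have "b + N = a + i \<longleftrightarrow> b = a + i - N" for b by auto
      then show ?thesis using True that by (auto simp: bad_def)
    next
      case False
      then show ?thesis using that by (simp add: bad_def)
    qed
    then show ?thesis by (subst sum.swap) simp
  qed
  have "(\<Sum>a<L. \<Sum>b<L. coef a b K y) = (\<Sum>a<L. \<Sum>b<L. \<Sum>i<M. if b + N = a + i then Y i else 0)"
    by (intro sum.cong refl c) auto
  also have "\<dots> = (\<Sum>a<L. \<Sum>i<M. if a \<in> bad i then 0 else Y i)"
    by (rule sum.cong[OF refl]) (use row in auto)
  also have "\<dots> = (\<Sum>a<L. \<Sum>i<M. Y i - (if a \<in> bad i then Y i else 0))"
    by (intro sum.cong refl) auto
  also have "\<dots> = real L *\<^sub>R y - (\<Sum>i<M. \<Sum>a<L. if a \<in> bad i then Y i else 0)"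
    using Y by (subst (2) sum.swap) (simp add: sum_subtractf decomposition_def sum_constant_scaleR)
  also have "(\<Sum>i<M. \<Sum>a<L. if a \<in> bad i then Y i else 0) = (\<Sum>i<M. real (card (bad i)) *\<^sub>R Y i)"
  proof (intro sum.cong refl)
    fix i
    have "{..<L} \<inter> bad i = bad i" by (auto simp: bad_def)
    then show "(\<Sum>a<L. if a \<in> bad i then Y i else 0) = real (card (bad i)) *\<^sub>R Y i"
      by (simp add: sum.If_cases sum_constant_scaleR)
  qed
  finally have "y - fejer L K y = (1 / real L) *\<^sub>R (\<Sum>i<M. real (card (bad i)) *\<^sub>R Y i)"
    using L by (simp add: fejer_def scaleR_diff_right)
  also have "norm \<dots> \<le> (1 / real L) * (\<Sum>i<M. real (N + M) * norm (Y i))"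
    unfolding norm_scaleR using bad
    by (intro mult_mono sum_norm_le) (auto intro!: mult_right_mono sum_nonneg simp flip: of_nat_add)
  finally show ?thesis by (simp add: norm_minus_commute sum_distrib_left sum_divide_distrib)
qed


section \<open>No intertwiners\<close>

text \<open>The witness is the path element of the walk, built by prepending edges to the vertex
  projection; each edge contributes one application of the shift.\<close>

lemma walk_partial_isometry:
  assumes "pre_digraph.awalk E v p w"
  shows "\<exists>\<kappa>. star \<kappa> * \<kappa> = P w \<and> P v * \<kappa> = \<kappa> \<and> \<kappa> * P w = \<kappa> \<and>
    (\<forall>a\<in>C. \<phi>n (length p) a * \<kappa> = \<kappa> * a)"
  using assms
proof (induction p arbitrary: v)
  case Nil
  then have "v \<in> verts E" "v = w" by (auto simp: pre_digraph.awalk_def pre_digraph.cas.simps)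
  then show ?case by (intro exI[of _ "P v"]) (simp add: C_def)
next
  case (Cons e p)
  then have e: "e \<in> arcs E" "tail E e = v" and p: "pre_digraph.awalk E (head E e) p w"
    using wf by (auto simp: pre_digraph.awalk_def pre_digraph.cas.simps)
  obtain \<kappa> where \<kappa>: "star \<kappa> * \<kappa> = P w" "P (head E e) * \<kappa> = \<kappa>" "\<kappa> * P w = \<kappa>"
    "\<And>a. a \<in> C \<Longrightarrow> \<phi>n (length p) a * \<kappa> = \<kappa> * a"
    using Cons.IH[OF p] by blast
  have "star (S e * \<kappa>) * (S e * \<kappa>) = P w"
    using \<kappa>(1,2) S_star_S_mult[OF e(1) e(1)] by (simp add: star_mult mult.assoc)
  moreover have "P v * (S e * \<kappa>) = S e * \<kappa>"
    using e P_S[of e] by (simp flip: mult.assoc)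
  moreover have "S e * \<kappa> * P w = S e * \<kappa>"
    using \<kappa>(3) by (simp add: mult.assoc)
  moreover have "\<phi>n (length (e # p)) a * (S e * \<kappa>) = S e * \<kappa> * a" if "a \<in> C" for a
  proof -
    have "\<phi>n (length (e # p)) a * (S e * \<kappa>) = \<phi> (\<phi>n (length p) a) * S e * \<kappa>"
      by (simp add: \<phi>n_Suc mult.assoc)
    also have "\<dots> = S e * (\<phi>n (length p) a * \<kappa>)"
      using \<phi>_S[OF \<phi>n_C[OF that] e(1)] by (simp add: mult.assoc)
    finally show ?thesis using \<kappa>(4)[OF that] by (simp add: mult.assoc)
  qed
  ultimately show ?case by blast
qed

text \<open>A walk makes \<open>P w\<close> equal to \<open>star \<kappa> * \<kappa>\<close> with
  \<open>P v * \<kappa> = \<kappa>\<close>, so one vanishing vertex projection would annihilate all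
  of them, and hence the unit.\<close>

lemma P_nonzero:
  assumes tr: "transitive_graph E" and x: "(x::'a) \<noteq> 0" and v: "v \<in> verts E"
  shows "P v \<noteq> 0"
proof
  assume Pv: "P v = 0"
  have "P w = 0" if w: "w \<in> verts E" for w
  proof -
    obtain p where "pre_digraph.awalk E v p w" using tr v w by (auto simp: transitive_graph_def)
    then obtain \<kappa> where "star \<kappa> * \<kappa> = P w" "P v * \<kappa> = \<kappa>" using walk_partial_isometry by blast
    then show ?thesis using Pv by simp
  qed
  then have "unit_elem = 0" by (simp add: unit_elem_def)
  then show False using x unit_elem_mult(1)[of x] by simp
qed

text \<open>Compressing with \<open>\<kappa> = S\<^sub>\<mu>\<close> for a loop \<open>\<mu>\<close> at \<open>w\<close> through \<open>f\<close>.\<close>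

lemma norm_vertex_part_le:
  assumes tr: "transitive_graph E" and f: "f \<in> arcs E" and w: "w \<in> verts E" and y: "y \<in> H i j"
  obtains l where "norm (\<phi>n i (P w) * y) \<le> norm (\<phi>n (l + i) (S f * star (S f)) * y)"
proof -
  let ?q = "S f * star (S f)"
  obtain p where p: "pre_digraph.awalk E w p (tail E f)"
    using tr w wf(1)[OF f] unfolding transitive_graph_def by blast
  obtain p' where p': "pre_digraph.awalk E (head E f) p' w"
    using tr w wf(2)[OF f] unfolding transitive_graph_def by blast
  obtain \<kappa>1 where \<kappa>1: "star \<kappa>1 * \<kappa>1 = P (tail E f)" "P w * \<kappa>1 = \<kappa>1"
    "\<And>a. a \<in> C \<Longrightarrow> \<phi>n (length p) a * \<kappa>1 = \<kappa>1 * a"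
    using walk_partial_isometry[OF p] by blast
  obtain \<kappa>2 where \<kappa>2: "star \<kappa>2 * \<kappa>2 = P w" "P (head E f) * \<kappa>2 = \<kappa>2" "\<kappa>2 * P w = \<kappa>2"
    using walk_partial_isometry[OF p'] by blast
  define \<kappa> where "\<kappa> = \<kappa>1 * S f * \<kappa>2"
  define l where "l = length p"
  have q: "?q \<in> C" "?q * S f = S f" using f by (auto simp: C_S_S S_S_star_S)
  have "star \<kappa> * \<kappa> = star \<kappa>2 * (star (S f) * ((star \<kappa>1 * \<kappa>1) * S f)) * \<kappa>2"
    by (simp add: \<kappa>_def star_mult mult.assoc)
  also have "\<dots> = P w" using \<kappa>1(1) \<kappa>2(1,2) f by (simp add: S_star_S mult.assoc)
  finally have \<kappa>\<kappa>: "star \<kappa> * \<kappa> = P w" .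
  have Pl: "P w * \<kappa> = \<kappa>" using \<kappa>1(2) by (simp add: \<kappa>_def flip: mult.assoc)
  have Pr: "\<kappa> * P w = \<kappa>" using \<kappa>2(3) by (simp add: \<kappa>_def mult.assoc)
  \<comment> \<open>As the walk is closed, \<open>\<kappa>\<close> lies in the corner of
    \<open>P w\<close>, whose elements commute with all vertex projections.\<close>
  have \<kappa>C: "\<kappa> \<in> C"
    unfolding C_def
  proof (intro CollectI ballI)
    fix v assume v: "v \<in> verts E"
    have "\<kappa> * P v = \<kappa> * (P w * P v)" "P v * \<kappa> = (P v * P w) * \<kappa>"
      using Pl Pr by (simp_all add: mult.assoc) (simp flip: mult.assoc)
    then show "\<kappa> * P v = P v * \<kappa>" using v w Pl Pr by (cases "v = w") (simp_all add: P_mult)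
  qed
  \<comment> \<open>After the first \<open>l\<close> edges the loop traverses \<open>f\<close>, so
    the shifted range projection of \<open>f\<close> fixes \<open>\<kappa>\<close>.\<close>
  have q\<kappa>: "\<phi>n l ?q * \<kappa> = \<kappa>"
  proof -
    have "\<phi>n l ?q * \<kappa> = \<phi>n l ?q * \<kappa>1 * (S f * \<kappa>2)" by (simp add: \<kappa>_def mult.assoc)
    also have "\<dots> = \<kappa>1 * (?q * S f) * \<kappa>2"
      unfolding l_def \<kappa>1(3)[OF q(1)] by (simp add: mult.assoc)
    finally show ?thesis by (simp add: q(2) \<kappa>_def)
  qed
  have n\<kappa>: "norm (\<phi>n m \<kappa>) \<le> 1" for m
    using \<kappa>C \<kappa>\<kappa> projection_P[OF w] by (intro norm_\<phi>n_le_1) simp_all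
  \<comment> \<open>Moving the right factor across \<open>y\<close> changes its shift exponent from
    j to i; the shifts of \<open>star \<kappa>\<close>, the projection and \<open>\<kappa>\<close>
    then combine to that of \<open>P w\<close>.\<close>
  have "\<phi>n i (star \<kappa>) * (\<phi>n (l + i) ?q * y) * \<phi>n j \<kappa>
      = \<phi>n i (star \<kappa>) * (\<phi>n i (\<phi>n l ?q) * (y * \<phi>n (0 + j) \<kappa>))"
    by (simp add: \<phi>n_add[symmetric] add.commute mult.assoc)
  also have "\<dots> = \<phi>n i (star \<kappa>) * \<phi>n i (\<phi>n l ?q) * \<phi>n i \<kappa> * y"
    unfolding H_shift[OF y \<kappa>C] by (simp add: mult.assoc)
  also have "\<dots> = \<phi>n i (star \<kappa>) * \<phi>n i (\<phi>n l ?q * \<kappa>) * y"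
    using q(1) by (simp add: \<phi>n_mult \<phi>n_C mult.assoc)
  also have "\<dots> = \<phi>n i (P w) * y"
    unfolding q\<kappa> \<kappa>\<kappa>[symmetric] using \<kappa>C by (simp add: \<phi>n_mult C_star)
  finally have "norm (\<phi>n i (P w) * y) = norm (\<phi>n i (star \<kappa>) * (\<phi>n (l + i) ?q * y) * \<phi>n j \<kappa>)" by simp
  also have "\<dots> \<le> norm (\<phi>n i (star \<kappa>) * (\<phi>n (l + i) ?q * y))" by (rule norm_mult_le_right[OF n\<kappa>])
  also have "\<dots> \<le> norm (\<phi>n (l + i) ?q * y)"
    by (rule norm_mult_le_left) (simp add: \<phi>n_star n\<kappa>)
  finally show ?thesis using that by blast
qed

text \<open>The projections \<open>\<phi>n i (P w)\<close> sum to the unit and cut \<open>y\<close>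
  into one piece per vertex. The shift needed for a piece depends on its vertex, which is why the
  bound is assumed for all \<open>m\<close>.\<close>

lemma norm_homogeneous_le:
  assumes tr: "transitive_graph E" and f: "f \<in> arcs E" and y: "y \<in> H i j"
    and \<beta>: "\<And>m. norm (\<phi>n (m + i) (S f * star (S f)) * y) \<le> \<beta>"
  shows "norm y \<le> real (card (verts E)) * \<beta>"
proof -
  have ne: "verts E \<noteq> {}" using f wf by auto
  have "y = \<phi>n i unit_elem * y" by (simp add: \<phi>n_unit)
  also have "\<dots> = (\<Sum>w\<in>verts E. \<phi>n i (P w) * y)"
    unfolding unit_elem_def \<phi>n_sum[OF fin(1) ne] by (simp add: sum_distrib_right)
  finally have "norm y = norm (\<Sum>w\<in>verts E. \<phi>n i (P w) * y)" by simp
  also have "\<dots> \<le> real (card (verts E)) * \<beta>"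
    using norm_vertex_part_le[OF tr f _ y] \<beta> by (intro sum_norm_bound) (meson order_trans)
  finally show ?thesis .
qed

section \<open>The off-diagonal entry against the diagonal\<close>

text \<open>Multiply by the shifted projection of \<open>e\<close> on the left and of
  \<open>f\<close> on the right. The latter moves across \<open>y\<close>, and \<open>p\<close>
  commutes with the former, so orthogonality removes the term with \<open>p\<close>. What remains is
  the shifted entry times \<open>y\<close>.\<close>

lemma mixing_lower_bound:
  assumes ef: "e \<in> arcs E" "f \<in> arcs E" "e \<noteq> f" "tail E e = tail E f" "head E e = head E f"
    and q: "q \<in> C" "S e * star (S e) * q * (S f * star (S f)) = scaleC c (S e * star (S f))"
    and y: "y \<in> H i j" and p: "p \<in> D k"
  shows "cmod c * norm (\<phi>n (m + i) (S f * star (S f)) * y) \<le> norm (p * y - y * \<phi>n (m + j) q)"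
proof -
  define t where "t = m + i"
  define qe where "qe = S e * star (S e)"
  define qf where "qf = S f * star (S f)"
  \<comment> \<open>A partial isometry that turns \<open>S e * star (S f)\<close> into the
    projection \<open>qf\<close>, so its contractive shift recovers the left-hand side.\<close>
  define s where "s = S f * star (S e)"
  have C: "qe \<in> C" "qf \<in> C" "s \<in> C" using ef by (auto simp: qe_def qf_def s_def C_S_S)
  have pqe: "projection qe" and pqf: "projection qf"
    using ef projection_S_S_star by (auto simp: qe_def qf_def)
  have "star s * s = S e * (star (S f) * S f) * star (S e)"
    by (simp add: s_def star_mult star_star mult.assoc)
  also have "\<dots> = qe" using ef S_P[of e] by (simp add: S_star_S qe_def)
  finally have ss: "projection (star s * s)" using pqe by simp
  have n: "norm (\<phi>n l qe) \<le> 1" "norm (\<phi>n l qf) \<le> 1" "norm (\<phi>n l s) \<le> 1" for l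
    using C pqe pqf ss projection_\<phi>n projection_norm_le norm_\<phi>n_le_1 by blast+
  have orth: "qe * qf = 0"
  proof -
    have "qe * qf = S e * (star (S e) * S f) * star (S f)" by (simp add: qe_def qf_def mult.assoc)
    then show ?thesis using ef by (simp add: S_star_S_if)
  qed
  have "qe \<in> D 1" unfolding qe_def by (rule diag_level_S[OF ef(1)])
  then have comm: "\<phi>n t qe * p = p * \<phi>n t qe"
    using diag_level_commute[OF diag_level_\<phi>n p] by blast
  have off: "\<phi>n t qe * \<phi>n t q * \<phi>n t qf = scaleC c (\<phi>n t (S e * star (S f)))"
  proof -
    have "\<phi>n t qe * \<phi>n t q * \<phi>n t qf = \<phi>n t (qe * q * qf)"
      using C q(1) by (simp add: \<phi>n_mult C_mult)
    then show ?thesis unfolding qe_def qf_def q(2) \<phi>n_scaleC .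
  qed
  have sef: "s * (S e * star (S f)) = qf"
  proof -
    have "s * (S e * star (S f)) = S f * (star (S e) * S e) * star (S f)" by (simp add: s_def mult.assoc)
    then show ?thesis using ef S_P[of f] by (simp add: S_star_S qf_def)
  qed
  have yq: "y * \<phi>n (m + j) a = \<phi>n t a * y" if "a \<in> C" for a
    using H_shift[OF y that] by (simp add: t_def)
  have "\<phi>n t s * (\<phi>n t qe * (p * y - y * \<phi>n (m + j) q) * \<phi>n (m + j) qf)
      = \<phi>n t s * (\<phi>n t qe * p * (y * \<phi>n (m + j) qf) - \<phi>n t qe * \<phi>n t q * (y * \<phi>n (m + j) qf))"
    unfolding yq[OF q(1)] by (simp add: left_diff_distrib right_diff_distrib mult.assoc)
  also have "\<dots> = \<phi>n t s * (p * (\<phi>n t qe * \<phi>n t qf) * y - \<phi>n t qe * \<phi>n t q * \<phi>n t qf * y)"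
    unfolding yq[OF C(2)] comm by (simp add: mult.assoc)
  also have "\<dots> = - scaleC c (\<phi>n t s * \<phi>n t (S e * star (S f)) * y)"
    unfolding off unfolding \<phi>n_mult[OF C(1), symmetric] orth
    using \<phi>n_scaleC[of t 0 0] by (simp add: mult_scaleC_left mult_scaleC_right mult.assoc)
  also have "\<dots> = - scaleC c (\<phi>n t qf * y)"
    unfolding \<phi>n_mult[OF C(3), symmetric] sef ..
  finally have "norm (\<phi>n t s * (\<phi>n t qe * (p * y - y * \<phi>n (m + j) q) * \<phi>n (m + j) qf))
      = cmod c * norm (\<phi>n t qf * y)" by (simp add: norm_scaleC)
  moreover have "norm (\<phi>n t s * (\<phi>n t qe * (p * y - y * \<phi>n (m + j) q) * \<phi>n (m + j) qf))
      \<le> norm (p * y - y * \<phi>n (m + j) q)"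
    using norm_mult_le_left[OF n(3)] norm_mult_le_right[OF n(2)] norm_mult_le_left[OF n(1)] order_trans
    by meson
  ultimately show ?thesis by (simp add: t_def qf_def)
qed

lemma gauge_aut_\<phi>n: "cmod z = 1 \<Longrightarrow> gauge_aut z (\<phi>n m a) = \<phi>n m (gauge_aut z a)"
  by (induction m) (simp_all add: \<phi>n_Suc gauge_aut_\<phi>)

text \<open>Every component of an approximant of \<open>x\<close> is bounded by a constant times the
  approximation error. A coarse approximant \<open>z\<close> fixes L so that its Fejer mean is close
  to it; a much finer approximant \<open>y\<close> then has a small Fejer mean, and contractivity
  compares the two.\<close>

lemma no_approximate_intertwiner:
  assumes tr: "transitive_graph E"
    and ef: "e \<in> arcs E" "f \<in> arcs E" "e \<noteq> f" "tail E e = tail E f" "head E e = head E f"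
    and q: "q \<in> C" "projection q" "\<And>z. cmod z = 1 \<Longrightarrow> gauge_aut z q = q"
      "S e * star (S e) * q * (S f * star (S f)) = scaleC c (S e * star (S f))" "c \<noteq> 0"
    and intertwine: "\<And>m \<eta>. \<eta> > 0 \<Longrightarrow>
      \<exists>k. \<exists>p\<in>D k. norm p \<le> 1 \<and> norm (p * x - x * \<phi>n m q) < \<eta>"
  shows "x = 0"
proof (rule ccontr)
  assume x: "x \<noteq> 0"
  \<comment> \<open>The 3 counts the error terms when \<open>x\<close> is replaced by
    \<open>y\<close> in the intertwining relation, the division by \<open>cmod c\<close> undoes the
    mixing bound, and the vertices come from cutting up a component.\<close>
  define V where "V = real (card (verts E)) * 3 / cmod c"
  have V: "V \<ge> 0" by (simp add: V_def)
  have small: "norm (Y i) \<le> V * \<epsilon>"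
    if Y: "decomposition N M Y y" and xy: "norm (x - y) < \<epsilon>" and \<epsilon>: "\<epsilon> > 0" for N M Y y \<epsilon> i
  proof -
    have Yi: "Y i \<in> H i N" using Y by (simp add: decomposition_def)
    have "cmod c * norm (\<phi>n (m + i) (S f * star (S f)) * Y i) \<le> 3 * \<epsilon>" for m
    proof -
      obtain k p where p: "p \<in> D k" "norm p \<le> 1" "norm (p * x - x * \<phi>n (m + N) q) < \<epsilon>"
        using intertwine[OF \<epsilon>] by blast
      let ?q = "\<phi>n (m + N) q"
      have nq: "norm ?q \<le> 1" by (rule projection_norm_le[OF projection_\<phi>n[OF q(1,2)]])
      have "p * y - y * ?q = (p * x - x * ?q) - p * (x - y) + (x - y) * ?q"
        by (simp add: algebra_simps)
      also have "norm \<dots> \<le> norm (p * x - x * ?q) + norm (p * (x - y)) + norm ((x - y) * ?q)"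
        by (meson add_right_mono norm_triangle_ineq norm_triangle_ineq4 order_trans)
      also have "\<dots> \<le> \<epsilon> + \<epsilon> + \<epsilon>"
        using p(3) xy norm_mult_le_left[OF p(2), of "x - y"] norm_mult_le_right[OF nq, of "x - y"]
        by linarith
      finally have 1: "norm (p * y - y * ?q) \<le> 3 * \<epsilon>" by simp
      define K where "K = Suc (N + i + N + M)"
      have gp: "gauge_aut z p = p" and gq: "gauge_aut z ?q = ?q" if "cmod z = 1" for z
        using gauge_aut_diag_level[OF that p(1)] gauge_aut_\<phi>n[OF that] q(3)[OF that] by simp_all
      \<comment> \<open>Exponents N and i select degree i - N, which is that of \<open>Y i\<close>.
        As \<open>p\<close> and the shifted \<open>q\<close> are gauge invariant, the coefficient
        passes through the relation.\<close>
      have "coef N i K y = Y i"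
        using coef_decomposition[OF Y, of N i K] by (simp add: K_def)
      then have "p * Y i - Y i * ?q = coef N i K (p * y - y * ?q)"
        by (simp add: coef_diff coef_mult_left[of p] coef_mult_right[of ?q] gp gq)
      then have "norm (p * Y i - Y i * ?q) \<le> 3 * \<epsilon>"
        using norm_coef_le[of N i K "p * y - y * ?q"] 1 by simp
      then show ?thesis
        using mixing_lower_bound[OF ef q(1,4) Yi p(1), of m] by simp
    qed
    then have "norm (Y i) \<le> real (card (verts E)) * (3 * \<epsilon> / cmod c)"
      using q(5) by (intro norm_homogeneous_le[OF tr ef(2) Yi]) (simp add: pos_le_divide_eq mult.commute)
    then show ?thesis by (simp add: V_def)
  qed
  \<comment> \<open>The closing estimate bounds \<open>norm x\<close> by less than 5r, so the factor
    8 gives a contradiction.\<close>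
  define r where "r = norm x / 8"
  have r: "r > 0" "norm x = 8 * r" using x by (simp_all add: r_def)
  obtain N M Z z where Z: "decomposition N M Z z" "norm (x - z) < r"
    using approximate_by_decomposition[OF r(1)] .
  define T where "T = real (N + M) * (\<Sum>i<M. norm (Z i))"
  obtain L where L: "real L > T / r" "L > 0"
  proof -
    obtain L where "real L > max (T / r) 1" using reals_Archimedean2 by blast
    then show ?thesis using that[of L] by simp
  qed
  \<comment> \<open>Chosen after L, so that the crude Fejer bound L V \<open>\<epsilon>\<close>
    stays below r.\<close>
  define \<epsilon> where "\<epsilon> = r / (1 + real L * V)"
  have LV: "1 + real L * V > 0" using V by (simp add: add_pos_nonneg)
  have \<epsilon>: "\<epsilon> > 0" "\<epsilon> \<le> r" "real L * (V * \<epsilon>) \<le> r"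
  proof -
    show "\<epsilon> > 0" using r LV by (simp add: \<epsilon>_def)
    have "\<epsilon> * (1 + real L * V) = r" using LV by (simp add: \<epsilon>_def)
    then have "\<epsilon> + real L * (V * \<epsilon>) = r" by (simp add: algebra_simps)
    moreover have "real L * (V * \<epsilon>) \<ge> 0" using V \<open>\<epsilon> > 0\<close> by simp
    ultimately show "\<epsilon> \<le> r" "real L * (V * \<epsilon>) \<le> r" using \<open>\<epsilon> > 0\<close> by linarith+
  qed
  obtain N' M' Y y where Y: "decomposition N' M' Y y" "norm (x - y) < \<epsilon>"
    using approximate_by_decomposition[OF \<epsilon>(1)] .
  define K where "K = Suc (2 * L + N + M + N' + M')"
  have 1: "norm (fejer L K z - z) < r"
  proof -
    have "norm (fejer L K z - z) \<le> T / real L"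
      unfolding T_def using Z(1) L(2) by (intro norm_fejer_diff_le) (simp_all add: K_def)
    also have "\<dots> < r" using L r(1) by (simp add: divide_less_eq mult.commute)
    finally show ?thesis .
  qed
  have 2: "norm (fejer L K y) \<le> r"
    using norm_fejer_le_coefficients[OF Y(1), of L K "V * \<epsilon>"] small[OF Y \<epsilon>(1)] \<epsilon>(3)
    by (simp add: K_def)
  have 3: "norm (fejer L K z - fejer L K y) \<le> norm (z - y)"
    unfolding fejer_diff[symmetric] by (rule norm_fejer_le) (simp_all add: K_def L)
  have "norm (z - y) \<le> norm (x - z) + norm (x - y)"
    by (metis add.commute dist_norm dist_triangle norm_minus_commute)
  moreover have "norm x \<le> norm (x - z) + norm (fejer L K z - z) + norm (fejer L K z - fejer L K y)
      + norm (fejer L K y)"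
  proof -
    have "x = (x - z) - (fejer L K z - z) + (fejer L K z - fejer L K y) + fejer L K y" by simp
    then show ?thesis by (smt (verit) norm_triangle_ineq norm_triangle_ineq4)
  qed
  ultimately show False using 1 2 3 Z(2) Y(2) \<epsilon>(2) r by linarith
qed

section \<open>From exact to approximate intertwiners\<close>

lemma gauge_aut_core_level1:
  assumes z: "cmod z = 1" and y: "y \<in> core_level1 E S"
  shows "gauge_aut z y = y"
  using y
proof (induction rule: core_level1_induct)
  case zero
  then show ?case using z by (simp add: gauge_aut_simps)
next
  case (step c e f y)
  have "z * cnj z = 1" using z complex_norm_square[of z] by simp
  then show ?case
    using step z by (simp add: gauge_aut_simps gauge_aut_S star_scaleC mult_scaleC_left mult_scaleC_right
        scaleC_scaleC mult.commute[of "cnj z"])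
qed

text \<open>Applying the map to the summands of \<open>\<phi>\<close> conjugates the shifted image
  by \<open>u\<close>, and elements of the first core level commute with shifts of
  \<open>C\<close>.\<close>

lemma quasi_free_\<phi>:
  assumes u: "u \<in> frakB E P S" "unitary u" and a: "quasi_free E P S u a \<in> C"
  shows "quasi_free E P S u (\<phi> a) = \<phi> (quasi_free E P S u a)"
proof -
  define \<Lambda> where "\<Lambda> = quasi_free E P S u"
  note qf = quasi_free[OF frakB_C[OF u(1)] u(2)]
  have hom: "\<Lambda> (x + y) = \<Lambda> x + \<Lambda> y" "\<Lambda> (x * y) = \<Lambda> x * \<Lambda> y" "\<Lambda> (star x) = star (\<Lambda> x)" for x y
    using qf(1) by (auto simp: \<Lambda>_def star_hom_type_iff)
  have "\<Lambda> 0 = 0" using hom(1)[of 0 0] by simp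
  then have sum: "\<Lambda> (sum g I) = (\<Sum>i\<in>I. \<Lambda> (g i))" for g :: "'e \<Rightarrow> 'a" and I
    by (induction I rule: infinite_finite_induct) (simp_all add: hom)
  have "\<Lambda> (\<phi> a) = u * \<phi> (\<Lambda> a) * star u"
    using qf(2) by (simp add: \<phi>_def sum hom \<Lambda>_def[symmetric] star_mult sum_distrib_left
        sum_distrib_right mult.assoc)
  also have "\<dots> = \<phi> (\<Lambda> a) * (u * star u)"
    using core_level1_commute_\<phi>[OF frakB_core[OF u(1)] a] by (simp add: \<Lambda>_def mult.assoc flip: mult.assoc)
  finally show ?thesis using u(2) by (simp add: unitary_iff \<Lambda>_def)
qed

lemma no_intertwiner:
  assumes tr: "transitive_graph E" and u: "u \<in> frakB E P S" "unitary u"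
    and moved: "(\<lambda>d. u * d * star u) ` D 1 \<noteq> D 1"
    and x: "(\<lambda>d. x * d) ` (quasi_free E P S u ` diag E P S) \<subseteq> (\<lambda>d. d * x) ` diag E P S"
  shows "x = 0"
proof (rule ccontr)
  assume x0: "x \<noteq> 0"
  have u': "star u * u = unit_elem" "u * star u = unit_elem" using u(2) by (auto simp: unitary_iff)
  obtain e f g c where ef: "e \<in> arcs E" "f \<in> arcs E" "g \<in> arcs E" "e \<noteq> f" "tail E e = tail E f"
    "head E e = head E f" "c \<noteq> 0"
    "S e * star (S e) * (u * (S g * star (S g)) * star u) * (S f * star (S f)) = scaleC c (S e * star (S f))"
    using ex_mixing[OF u P_nonzero[OF tr x0] moved] by blast
  define pg where "pg = S g * star (S g)"
  define q where "q = u * pg * star u"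
  have pg: "star pg = pg" "pg * pg = pg" "pg \<in> C" "pg \<in> D 1"
    using projection_S_S_star[OF ef(3)] C_S_S[OF ef(3,3)] diag_level_S[OF ef(3)]
    by (auto simp: pg_def projection_def)
  have qC: "q \<in> C" using frakB_C[OF u(1)] pg(3) by (simp add: q_def C_mult C_star)
  have pq: "projection q"
  proof -
    have "q * q = u * pg * (star u * u) * pg * star u" by (simp add: q_def mult.assoc)
    also have "\<dots> = u * (pg * pg) * star u" by (simp add: u' mult.assoc)
    finally show ?thesis using pg by (simp add: projection_def q_def star_mult star_star mult.assoc)
  qed
  have gq: "gauge_aut z q = q" if "cmod z = 1" for z
    using gauge_aut_core_level1[OF that frakB_core[OF u(1)]] gauge_aut_diag_level[OF that pg(4)] that
    by (simp add: q_def gauge_aut_simps)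
  have \<Lambda>: "quasi_free E P S u (\<phi>n m pg) = \<phi>n m q" for m
  proof (induction m)
    case 0
    have "quasi_free E P S u pg = (u * S g) * star (u * S g)"
      using quasi_free[OF frakB_C[OF u(1)] u(2)] ef(3) by (simp add: pg_def star_hom_type_iff)
    then show ?case by (simp add: q_def pg_def star_mult mult.assoc)
  next
    case (Suc m)
    then show ?case using quasi_free_\<phi>[OF u, of "\<phi>n m pg"] \<phi>n_C[OF qC] by (simp add: \<phi>n_Suc)
  qed
  have "\<exists>k. \<exists>p\<in>D k. norm p \<le> 1 \<and> norm (p * x - x * \<phi>n m q) < \<eta>" if \<eta>: "\<eta> > 0" for m \<eta>
  proof -
    have "\<phi>n m pg \<in> diag E P S" using diag_level_\<phi>n[OF pg(4)] diag_level_subset_diag by blast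
    then have "x * \<phi>n m q \<in> (\<lambda>d. x * d) ` (quasi_free E P S u ` diag E P S)"
      by (subst \<Lambda>[symmetric]) (intro imageI)
    then have "x * \<phi>n m q \<in> (\<lambda>d. d * x) ` diag E P S" using x by (rule subsetD[rotated])
    then obtain d where d: "d \<in> diag E P S" "x * \<phi>n m q = d * x" by blast
    \<comment> \<open>\<open>d\<close> itself need not be idempotent, but on \<open>x\<close> it
      acts as right multiplication by the projection \<open>\<phi>n m q\<close>.\<close>
    have "d * d * x = d * x * \<phi>n m q" using d(2) by (simp add: mult.assoc)
    also have "\<dots> = x * (\<phi>n m q * \<phi>n m q)" using d(2) by (simp flip: mult.assoc)
    also have "\<dots> = d * x" using d(2) projection_\<phi>n[OF qC pq, of m] by (simp add: projection_def)
    finally obtain k p where "p \<in> D k" "norm p \<le> 1" "norm (p * x - d * x) < \<eta>"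
      using approximate_idempotent_action[OF d(1) _ \<eta>] by blast
    then show ?thesis using d(2) by auto
  qed
  then show False
    using no_approximate_intertwiner[OF tr ef(1,2,4,5,6) qC pq gq _ ef(7), of x] ef(8) x0
    unfolding q_def pg_def by blast
qed

end

theorem theorem3p2:
  fixes E :: "('v, 'e) pre_digraph"
    and P :: "'v \<Rightarrow> 'a::cstar_algebra"
    and S :: "'e \<Rightarrow> 'a"
    and u :: 'a
  assumes "fin_digraph E"
    and "transitive_graph E"
    and "every_cycle_has_exit E"
    and "is_graph_cstar_algebra E P S"
    and "u \<in> frakB E P S"
    and "unitary u"
    and "(\<lambda>d. u * d * star u) ` diag_level E P S 1 \<noteq> diag_level E P S 1"
  shows "(\<nexists>x :: 'a. x \<noteq> 0 \<and>
           (\<lambda>d. x * d) ` (quasi_free E P S u ` diag E P S) = (\<lambda>d. d * x) ` diag E P S) \<and>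
         (\<nexists>w :: 'a. unitary w \<and>
           (\<lambda>d. w * d * star w) ` diag E P S = quasi_free E P S u ` diag E P S)"
proof -
  interpret fin_digraph E by fact
  interpret graph_cstar E P S
  \<comment> \<open>A closed walk of non-zero length at \<open>v\<close> starts with an edge leaving
    \<open>v\<close>, so there are no sinks.\<close>
  proof
    fix v assume v: "v \<in> verts E"
    then obtain p where "p \<noteq> []" "awalk v p v"
      using assms(2) by (auto simp: transitive_graph_def)
    then show "\<exists>e\<in>arcs E. tail E e = v"
      by (cases p) (auto simp: awalk_def)
  qed (use assms(4) in auto)
  have no: "x = 0"
    if "(\<lambda>d. x * d) ` (quasi_free E P S u ` diag E P S) = (\<lambda>d. d * x) ` diag E P S" for x
    using no_intertwiner[OF assms(2,5,6,7)] that by blast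
  have "\<not> (unitary w \<and> (\<lambda>d. w * d * star w) ` diag E P S = quasi_free E P S u ` diag E P S)" for w
  proof
    assume w: "unitary w \<and> (\<lambda>d. w * d * star w) ` diag E P S = quasi_free E P S u ` diag E P S"
    then have w': "star w * w = unit_elem" by (simp add: unitary_iff)
    \<comment> \<open>A unitary \<open>w\<close> of the second kind yields the intertwiner
      \<open>star w\<close>.\<close>
    have "(\<lambda>d. star w * d) ` (quasi_free E P S u ` diag E P S) = (\<lambda>d. star w * (w * d * star w)) ` diag E P S"
      using w by (metis image_image)
    also have "\<dots> = (\<lambda>d. d * star w) ` diag E P S"
    proof (rule image_cong[OF refl])
      fix d
      have "star w * (w * d * star w) = (star w * w) * d * star w" by (simp only: mult.assoc)
      then show "star w * (w * d * star w) = d * star w" by (simp add: w')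
    qed
    finally have "star w = 0" by (rule no)
    \<comment> \<open>A vanishing \<open>star w\<close> leaves only the zero algebra, where
      conjugation cannot move the first level; this contradicts the hypothesis on
      \<open>u\<close>.\<close>
    then have "unit_elem = 0" using w' by simp
    then have zero: "x = 0" for x :: 'a using unit_elem_mult(1)[of x] by simp
    have "(\<lambda>d. u * d * star u) ` diag_level E P S 1 = diag_level E P S 1"
    proof (intro equalityI subsetI)
      fix y
      show "y \<in> diag_level E P S 1" by (subst zero) (rule diag_level_zero)
      show "y \<in> (\<lambda>d. u * d * star u) ` diag_level E P S 1"
        by (rule image_eqI[OF _ diag_level_zero[of 1]]) (simp add: zero[of y])
    qed
    then show False using assms(7) by contradiction
  qed
  then show ?thesis using no by blast
qed

end
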